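(* Let $P_n$ denote the path graph on $n$ vertices. Then for $1\le k\le \nu(P_n)=\lfloor\frac{n}{2}\rfloor$, $$\operatorname{reg}\bigl(I(P_n)^{[k]}\bigr)= 2k+\left\lfloor \frac{n-2k}{3} \right\rfloor.$$
   Context: All graphs are finite and simple. Fix a field $\mathbb{K}$. For a graph $G$ with vertex set $V(G)$ (vertices are identified with indeterminates), $R=\mathbb{K}[x\mid x\in V(G)]$ and $I(G)=\langle xy\mid \{x,y\}\in E(G)\rangle\subseteq R$ is the edge ideal. A $k$-matching of $G$ is a set of $k$ pairwise disjoint edges; $\nu(G)$ is the maximum cardinality of a matching. The $k$-th square-free power $I(G)^{[k]}$ is the ideal of $R$ generated by the square-free monomials of $I(G)^k$; equivalently it is generated by the products $\prod_{x\in \bigcup_{e\in M}e}x$ over all $k$-matchings $M$ of $G$. For a nonzero graded ideal $J\subseteq R$ with graded Betti numbers $\beta_{i,j}(J)$ (of $J$ as an $R$-module), $\operatorname{reg}(J)=\max\{j-i\mid \beta_{i,j}(J)\ne 0\}$. The path $P_n$ has vertices $x_1,\dots,x_n$ and edges $\{x_i,x_{i+1}\}$, $1\le i\le n-1$. *)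

theory Defs
  imports
    "HOL-Library.Poly_Mapping"
    "HOL-Library.Disjoint_Sets"
    "HOL-Algebra.Ideal_Product"
    "Jordan_Normal_Form.Matrix"
begin

section \<open>Graphs and matchings\<close>

record 'v ugraph =
  verts :: "'v set"
  edges :: "'v set set"

definition simple_graph :: "'v ugraph \<Rightarrow> bool" where
  "simple_graph G \<longleftrightarrow>
     finite (verts G) \<and> (\<forall>e\<in>edges G. e \<subseteq> verts G \<and> card e = 2)"

definition matching :: "'v ugraph \<Rightarrow> 'v set set \<Rightarrow> bool" where
  "matching G M \<longleftrightarrow> M \<subseteq> edges G \<and> disjoint M"

definition matching_number :: "'v ugraph \<Rightarrow> nat" where
  "matching_number G = Max {card M | M. matching G M}"

text \<open>The vertex $x_i$ of the path is represented by its index $i$.\<close>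

definition path_graph :: "nat \<Rightarrow> nat ugraph" where
  "path_graph n = \<lparr>verts = {1..n}, edges = {{i, i + 1} | i. 1 \<le> i \<and> i + 1 \<le> n}\<rparr>"

lemma simple_graph_path_graph: "simple_graph (path_graph n)"
  by (auto simp: simple_graph_def path_graph_def)


section \<open>Polynomial rings\<close>

text \<open>
  An element of \<^typ>\<open>'v \<Rightarrow>\<^sub>0 nat\<close> is the exponent vector of a monomial. The type below has all
  elements of \<^typ>\<open>'v\<close> as indeterminates; the ring $\mathbb{K}[x \mid x \in V]$ is carved out
  of it as the set of polynomials in which only the indeterminates from $V$ occur.
\<close>

type_synonym ('v, 'k) mpoly = "('v \<Rightarrow>\<^sub>0 nat) \<Rightarrow>\<^sub>0 'k"

definition poly_ring :: "'v set \<Rightarrow> ('v, 'k::field) mpoly ring" where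
  "poly_ring V =
     \<lparr>carrier = {p. \<forall>m\<in>Poly_Mapping.keys p. Poly_Mapping.keys m \<subseteq> V},
      monoid.mult = (*), one = 1, zero = 0, add = (+)\<rparr>"

definition monomial :: "('v \<Rightarrow>\<^sub>0 nat) \<Rightarrow> ('v, 'k::field) mpoly" where
  "monomial m = Poly_Mapping.single m 1"

definition indet :: "'v \<Rightarrow> ('v, 'k::field) mpoly" where
  "indet x = monomial (Poly_Mapping.single x 1)"

definition mono_degree :: "('v \<Rightarrow>\<^sub>0 nat) \<Rightarrow> nat" where
  "mono_degree m = (\<Sum>x\<in>Poly_Mapping.keys m. Poly_Mapping.lookup m x)"

definition squarefree_exponent :: "('v \<Rightarrow>\<^sub>0 nat) \<Rightarrow> bool" where
  "squarefree_exponent m \<longleftrightarrow> (\<forall>x. Poly_Mapping.lookup m x \<le> 1)"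

lemma poly_ring_simps:
  "p \<in> carrier (poly_ring V) \<longleftrightarrow> (\<forall>m\<in>Poly_Mapping.keys p. Poly_Mapping.keys m \<subseteq> V)"
  "p \<otimes>\<^bsub>poly_ring V\<^esub> q = p * q" "p \<oplus>\<^bsub>poly_ring V\<^esub> q = p + q"
  "\<one>\<^bsub>poly_ring V\<^esub> = 1" "\<zero>\<^bsub>poly_ring V\<^esub> = 0"
  by (simp_all add: poly_ring_def)

lemma poly_ring_add_closed:
  assumes "p \<in> carrier (poly_ring V)" "q \<in> carrier (poly_ring V)"
  shows "p + q \<in> carrier (poly_ring V)"
  using assms Poly_Mapping.keys_add[of p q] unfolding poly_ring_simps by blast

lemma poly_ring_mult_closed:
  assumes "p \<in> carrier (poly_ring V)" "q \<in> carrier (poly_ring V)"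
  shows "p * q \<in> carrier (poly_ring V)"
  unfolding poly_ring_simps
proof
  fix m assume "m \<in> Poly_Mapping.keys (p * q)"
  then obtain a b where "m = a + b" "a \<in> Poly_Mapping.keys p" "b \<in> Poly_Mapping.keys q"
    using Poly_Mapping.keys_mult[of p q] by blast
  then show "Poly_Mapping.keys m \<subseteq> V"
    using assms Poly_Mapping.keys_add[of a b] unfolding poly_ring_simps by blast
qed

lemma cring_poly_ring: "cring (poly_ring V :: ('v, 'k::field) mpoly ring)"
proof (rule cringI)
  show "abelian_group (poly_ring V :: ('v, 'k) mpoly ring)"
  proof (rule abelian_groupI, goal_cases)
    case (1 x y) then show ?case using poly_ring_add_closed by (simp add: poly_ring_simps(3))
  next
    case 2 show ?case by (simp add: poly_ring_simps)
  next
    case 3 show ?case by (simp add: poly_ring_simps(3) add.assoc)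
  next
    case 4 show ?case by (simp add: poly_ring_simps(3) add.commute)
  next
    case 5 show ?case by (simp add: poly_ring_simps)
  next
    case (6 x)
    then have "- x \<in> carrier (poly_ring V)" by (simp add: poly_ring_simps)
    then show ?case by (intro bexI[of _ "- x"]) (simp_all add: poly_ring_simps(3,5))
  qed
  show "comm_monoid (poly_ring V :: ('v, 'k) mpoly ring)"
  proof (rule comm_monoidI, goal_cases)
    case (1 x y) then show ?case using poly_ring_mult_closed by (simp add: poly_ring_simps(2))
  next
    case 2 show ?case by (simp add: poly_ring_simps)
  next
    case 3 show ?case by (simp add: poly_ring_simps(2) mult.assoc)
  next
    case 4 show ?case by (simp add: poly_ring_simps)
  next
    case 5 show ?case by (simp add: poly_ring_simps(2) mult.commute)
  qed
next
  fix x y z :: "('v, 'k) mpoly"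
  show "(x \<oplus>\<^bsub>poly_ring V\<^esub> y) \<otimes>\<^bsub>poly_ring V\<^esub> z
      = x \<otimes>\<^bsub>poly_ring V\<^esub> z \<oplus>\<^bsub>poly_ring V\<^esub> y \<otimes>\<^bsub>poly_ring V\<^esub> z"
    by (simp add: poly_ring_simps(2,3) distrib_right)
qed


section \<open>Edge ideals and their square-free powers\<close>

definition edge_ideal :: "'v ugraph \<Rightarrow> ('v, 'k::field) mpoly set" where
  "edge_ideal G = genideal (poly_ring (verts G)) {indet x * indet y | x y. {x, y} \<in> edges G}"

definition ideal_power :: "('a, 'b) ring_scheme \<Rightarrow> 'a set \<Rightarrow> nat \<Rightarrow> 'a set" where
  "ideal_power R I k = ((\<lambda>J. ideal_prod R I J) ^^ k) (carrier R)"

definition squarefree_power :: "'v ugraph \<Rightarrow> nat \<Rightarrow> ('v, 'k::field) mpoly set" where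
  "squarefree_power G k =
     genideal (poly_ring (verts G))
       {monomial m | m. squarefree_exponent m \<and>
          (monomial m :: ('v, 'k) mpoly) \<in> ideal_power (poly_ring (verts G)) (edge_ideal G) k}"


section \<open>Graded Betti numbers and regularity\<close>

definition free_module :: "'v set \<Rightarrow> nat \<Rightarrow> ('v, 'k::field) mpoly vec set" where
  "free_module V r = {v \<in> carrier_vec r. \<forall>a<r. v $ a \<in> carrier (poly_ring V)}"

text \<open>
  Matrices over $R = \mathbb{K}[x \mid x \in V]$ that represent homomorphisms of degree $0$ from
  $\bigoplus_b R(-t_b)$ to $\bigoplus_a R(-s_a)$: the entry in position $(a, b)$ is homogeneous of
  degree $t_b - s_a$ (hence zero if $t_b < s_a$).
\<close>

definition graded_matrix ::
    "'v set \<Rightarrow> nat list \<Rightarrow> nat list \<Rightarrow> ('v, 'k::field) mpoly mat \<Rightarrow> bool" where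
  "graded_matrix V s t A \<longleftrightarrow>
     A \<in> carrier_mat (length s) (length t) \<and>
     (\<forall>a<length s. \<forall>b<length t.
        A $$ (a, b) \<in> carrier (poly_ring V) \<and>
        (\<forall>m\<in>Poly_Mapping.keys (A $$ (a, b)). mono_degree m + s ! a = t ! b))"

text \<open>
  Minimal graded free resolutions
  $\cdots \to F_1 \xrightarrow{A_1} F_0 \xrightarrow{A_0} J \to 0$ of an ideal $J$ of $R$, where
  $F_i = \bigoplus_{b} R(-d_{i,b})$ has finite rank. The augmentation $A_0$ is written as a matrix
  with a single row, i.e. as a map into $R = R(0)$ whose image is required to be $J$. Minimality,
  $A_{i+1}(F_{i+1}) \subseteq \mathfrak{m} F_i$ for the graded maximal ideal $\mathfrak{m}$,
  says that the entries of $A_{i+1}$ have no constant term. No bound on the length is imposed.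
\<close>

definition minimal_graded_free_resolution ::
    "'v set \<Rightarrow> ('v, 'k::field) mpoly set \<Rightarrow> (nat \<Rightarrow> nat list) \<Rightarrow>
     (nat \<Rightarrow> ('v, 'k) mpoly mat) \<Rightarrow> bool" where
  "minimal_graded_free_resolution V J d A \<longleftrightarrow>
     graded_matrix V [0] (d 0) (A 0) \<and>
     (\<forall>i. graded_matrix V (d i) (d (Suc i)) (A (Suc i))) \<and>
     (\<lambda>v. (A 0 *\<^sub>v v) $ 0) ` free_module V (length (d 0)) = J \<and>
     (\<forall>i. {v \<in> free_module V (length (d i)). A i *\<^sub>v v = 0\<^sub>v (dim_row (A i))} =
          (\<lambda>w. A (Suc i) *\<^sub>v w) ` free_module V (length (d (Suc i)))) \<and>
     (\<forall>i. \<forall>a<length (d i). \<forall>b<length (d (Suc i)).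
          Poly_Mapping.lookup (A (Suc i) $$ (a, b)) 0 = 0)"

text \<open>
  $\beta_{i,j}(J)$ is the number of summands $R(-j)$ in step $i$ of a minimal graded free resolution
  of $J$. Such a resolution exists and is unique up to isomorphism for every homogeneous ideal of
  $\mathbb{K}[x \mid x \in V]$ with $V$ finite, so the choice below is immaterial.
\<close>

definition graded_betti :: "'v set \<Rightarrow> ('v, 'k::field) mpoly set \<Rightarrow> nat \<Rightarrow> nat \<Rightarrow> nat" where
  "graded_betti V J i j =
     count_list ((SOME d. \<exists>A. minimal_graded_free_resolution V J d A) i) j"

text \<open>Only meaningful for a nonzero homogeneous ideal.\<close>

definition regularity :: "'v set \<Rightarrow> ('v, 'k::field) mpoly set \<Rightarrow> int" where
  "regularity V J = Max {int j - int i | i j. graded_betti V J i j \<noteq> 0}"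

end

theory Submission
  imports Defs "HOL-Library.Function_Algebras"
begin

text \<open>
  A minimal graded free resolution of \<open>J\<close> and the exactness of the Koszul complex of a free module
  give, by dimension shifting along the syzygies, that \<open>j\<close> is a degree in step \<open>i\<close> iff the
  Koszul homology \<open>H\<^sub>i(x; J)\<^sub>j\<close> is nonzero; the same shift bounds the degrees of the generators of
  all syzygies, which makes them finitely generated, so that minimal resolutions exist. For
  the \<open>k\<close>-th square-free power of the path, Koszul homology splits into multidegrees, and only the
  square-free ones matter. In the multidegree \<open>S\<close> it is the homology of the simplicial
  complex of all \<open>F \<subseteq> S\<close> for which \<open>S - F\<close> contains \<open>k\<close> disjoint edges. Splitting off the last
  vertices of \<open>S\<close> by links and deletions shows that it vanishes in step \<open>i\<close> if
  \<open>3 |S| > 3 i + 4 k + n\<close>. The bound is attained by a path on \<open>2 k\<close> vertices together with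
  \<open>r = \<lfloor>(n - 2 k) / 3\<rfloor>\<close> isolated edges, in step \<open>r\<close>.
\<close>

text \<open>\<open>regularity\<close> rests on an arbitrarily chosen resolution, so two facts are
  unavoidable: a minimal resolution exists, and all of them have the same degrees. Only the
  occurrence of a degree matters, never a rank; hence everything is phrased through vanishing
  (\<open>koszul_acyclic\<close>, \<open>acyclic_at\<close>), and no quotient or dimension is
  formed. Existence needs one degree bound valid in all homological degrees; it holds because
  square-free multidegrees in n variables have degree at most n. The bound
  \<open>3 |S| > 3 i + 4 k + n\<close> is |S| - i > 2k + (n - 2k)/3 cleared of its denominator. What
  shapes its proof is that the link of an end vertex need not be a matching complex: a vertex
  remains that may be matched but can never enter a face. One more splitting, at its neighbour,
  removes it. Each reduction pays for the lost vertices by lowering i, k or the length n of the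
  surrounding path, often with no slack, so n has to vary in the induction. Isolated edges exhaust
  the bound: each occupies three places of the path, one of them a gap, and raises |S| by 2 and i by
  1.\<close>

abbreviation keys :: "('a \<Rightarrow>\<^sub>0 'b::zero) \<Rightarrow> 'a set" where
  "keys \<equiv> Poly_Mapping.keys"

abbreviation lookup :: "('a \<Rightarrow>\<^sub>0 'b::zero) \<Rightarrow> 'a \<Rightarrow> 'b" where
  "lookup \<equiv> Poly_Mapping.lookup"

section \<open>Koszul differentials\<close>

text \<open>The sign of inserting \<open>v\<close> into the ordered wedge of the elements of
  \<open>F\<close>. Using negation instead of a scalar factor lets one differential serve field
  elements, polynomials and vectors of polynomials.\<close>

definition signed :: "nat \<Rightarrow> nat set \<Rightarrow> 'a::ab_group_add \<Rightarrow> 'a" where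
  "signed v F a = (if even (card {x \<in> F. x < v}) then a else - a)"

lemma signed_0 [simp]: "signed v F 0 = 0"
  and signed_add: "signed v F (a + b) = signed v F a + signed v F b"
  and signed_diff: "signed v F (a - b) = signed v F a - signed v F b"
  and signed_minus: "signed v F (- a) = - signed v F a"
  and signed_eq_0_iff [simp]: "signed v F a = 0 \<longleftrightarrow> a = 0"
  and signed_signed [simp]: "signed v F (signed v F a) = a"
  by (simp_all add: signed_def)

lemma signed_sum: "signed v F (sum f A) = (\<Sum>x\<in>A. signed v F (f x))"
  by (simp add: signed_def sum_negf)

lemma additive_signed:
  assumes "\<And>a b. h (a + b) = h a + h b"
  shows "h (signed v F a) = signed v F (h a :: 'b::ab_group_add)"
proof -
  have "h 0 = 0" using assms[of 0 0] by simp
  then have "h (- a) = - h a" using assms[of a "- a"] by (simp add: eq_neg_iff_add_eq_0 add.commute)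
  then show ?thesis by (simp add: signed_def)
qed

lemma card_less_insert:
  assumes "finite F" "v \<notin> F"
  shows "card {x \<in> insert v F. x < w} = card {x \<in> F. x < w} + (if v < w then 1 else (0::nat))"
proof -
  have "{x \<in> insert v F. x < w} = (if v < w then insert v {x \<in> F. x < w} else {x \<in> F. x < w})"
    by auto
  then show ?thesis using assms by simp
qed

text \<open>Exactly one of \<open>v < w\<close> and \<open>w < v\<close> holds, so exactly one of
  the two inner counts grows by one when the other vertex is inserted first.\<close>

lemma signed_swap:
  assumes "finite F" "v \<notin> F" "w \<notin> F" "v \<noteq> w"
  shows "signed v F (signed w (insert v F) a) = - signed w F (signed v (insert w F) a)"
  unfolding signed_def card_less_insert[OF assms(1,2)] card_less_insert[OF assms(1,3)]
  using assms(4) by auto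

text \<open>The operators \<open>X v\<close> are a parameter: identities give the simplicial
  boundary, multiplication by indeterminates gives the Koszul complex of a ring or a module. A chain
  is a function on all sets, and the differential is read off at its target
  \<open>F\<close>.\<close>

definition koszul :: "nat set \<Rightarrow> (nat \<Rightarrow> 'a \<Rightarrow> 'a) \<Rightarrow> (nat set \<Rightarrow> 'a::ab_group_add) \<Rightarrow> nat set \<Rightarrow> 'a"
  where "koszul V X c F = (\<Sum>v\<in>V - F. signed v F (X v (c (insert v F))))"

text \<open>The terms with \<open>v < w\<close> cancel those with \<open>w < v\<close>. Deriving s =
  - s instead would prove nothing in characteristic 2.\<close>

lemma sum_antisym_eq_0:
  fixes t :: "nat \<Rightarrow> nat \<Rightarrow> 'a::ab_group_add"
  assumes "finite D" "\<And>v w. v \<in> D \<Longrightarrow> w \<in> D \<Longrightarrow> v \<noteq> w \<Longrightarrow> t v w = - t w v"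
  shows "(\<Sum>v\<in>D. \<Sum>w\<in>D - {v}. t v w) = 0"
proof -
  let ?A = "{(v, w). v \<in> D \<and> w \<in> D \<and> v < w}" and ?B = "{(v, w). v \<in> D \<and> w \<in> D \<and> w < v}"
  have fin: "finite ?A" "finite ?B"
    using assms(1) by (auto intro: finite_subset[of _ "D \<times> D"])
  have neg: "- t w v = t v w" if "v \<in> D" "w \<in> D" "w < v" for v w
    using assms(2)[of v w] that by simp
  have "(\<Sum>v\<in>D. \<Sum>w\<in>D - {v}. t v w) = (\<Sum>(v, w)\<in>Sigma D (\<lambda>v. D - {v}). t v w)"
    using assms(1) by (simp add: sum.Sigma)
  also have "Sigma D (\<lambda>v. D - {v}) = ?A \<union> ?B" by auto
  also have "(\<Sum>(v, w)\<in>?A \<union> ?B. t v w) = (\<Sum>(v, w)\<in>?A. t v w) + (\<Sum>(v, w)\<in>?B. t v w)"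
    using fin by (intro sum.union_disjoint) auto
  also have "(\<Sum>(v, w)\<in>?B. t v w) = (\<Sum>(v, w)\<in>?A. - t v w)"
    by (rule sum.reindex_bij_witness[of _ prod.swap prod.swap]) (auto intro: neg)
  also have "\<dots> = - (\<Sum>(v, w)\<in>?A. t v w)" by (simp add: sum_negf split_def)
  finally show ?thesis by simp
qed

text \<open>Two vertices taken in either order apply the same commuting operators, but with opposite
  signs.\<close>

lemma koszul_koszul:
  assumes "finite V" "finite F" and add: "\<And>v a b. X v (a + b) = X v a + X v b"
    and comm: "\<And>v w a. X v (X w a) = X w (X v a)"
  shows "koszul V X (koszul V X c) F = 0"
proof -
  have X0: "X v 0 = 0" for v using add[of v 0 0] by simp
  have Xsum: "X v (sum f A) = (\<Sum>x\<in>A. X v (f x))" for v f and A :: "nat set"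
    by (induction A rule: infinite_finite_induct) (simp_all add: add X0)
  let ?t = "\<lambda>v w. signed v F (signed w (insert v F) (X v (X w (c (insert w (insert v F))))))"
  have "koszul V X (koszul V X c) F = (\<Sum>v\<in>V - F. \<Sum>w\<in>V - insert v F. ?t v w)"
    by (simp add: koszul_def Xsum signed_sum additive_signed[of "X v" for v, OF add])
  also have "\<dots> = (\<Sum>v\<in>V - F. \<Sum>w\<in>(V - F) - {v}. ?t v w)"
    by (intro sum.cong refl) auto
  also have "\<dots> = 0"
  proof (rule sum_antisym_eq_0)
    fix v w assume "v \<in> V - F" "w \<in> V - F" "v \<noteq> w"
    then show "?t v w = - ?t w v"
      using signed_swap[of F v w] assms(2) by (simp add: comm[of v w] insert_commute)
  qed (use assms(1) in simp)
  finally show ?thesis .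
qed

lemma koszul_add:
  assumes "\<And>v a b. X v (a + b) = X v a + X v b"
  shows "koszul V X (\<lambda>F. c F + d F) F = koszul V X c F + koszul V X d F"
  by (simp add: koszul_def assms signed_add sum.distrib)

lemma koszul_diff:
  assumes "\<And>v a b. X v (a + b) = X v a + X v b"
  shows "koszul V X (\<lambda>F. c F - d F) F = koszul V X c F - koszul V X d F"
  using koszul_add[of X V "\<lambda>F. c F - d F" d F, OF assms] by simp

lemma koszul_hom:
  assumes "\<And>a b. h (a + b) = h a + h b" "\<And>v a. h (X v a) = Y v (h a)"
  shows "h (koszul V X c F) = koszul V Y (\<lambda>F. h (c F)) F"
proof -
  have "h 0 = 0" using assms(1)[of 0 0] by simp
  then have "h (sum f A) = (\<Sum>x\<in>A. h (f x))" for f and A :: "nat set"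
    by (induction A rule: infinite_finite_induct) (simp_all add: assms(1))
  then show ?thesis
    by (simp add: koszul_def additive_signed[of h, OF assms(1)] assms(2))
qed

section \<open>Homology of simplicial complexes\<close>

abbreviation bdry :: "nat set \<Rightarrow> (nat set \<Rightarrow> 'k::ab_group_add) \<Rightarrow> nat set \<Rightarrow> 'k" where
  "bdry \<sigma> \<equiv> koszul \<sigma> (\<lambda>_ a. a)"

definition simplicial_complex :: "nat set \<Rightarrow> nat set set \<Rightarrow> bool" where
  "simplicial_complex \<sigma> G \<longleftrightarrow> finite \<sigma> \<and> G \<subseteq> Pow \<sigma> \<and> (\<forall>F\<in>G. \<forall>\<rho>\<subseteq>F. \<rho> \<in> G)"

definition simplicial_chain :: "nat set set \<Rightarrow> nat \<Rightarrow> (nat set \<Rightarrow> 'k::ab_group_add) \<Rightarrow> bool" where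
  "simplicial_chain G i f \<longleftrightarrow> (\<forall>F. f F \<noteq> 0 \<longrightarrow> F \<in> G \<and> card F = i)"

text \<open>Chains are graded by the number of vertices, so index \<open>i\<close> is dimension \<open>i - 1\<close>.\<close>

definition acyclic_at :: "'k::ab_group_add itself \<Rightarrow> nat set \<Rightarrow> nat set set \<Rightarrow> nat \<Rightarrow> bool" where
  "acyclic_at K \<sigma> G i \<longleftrightarrow>
     (\<forall>f::nat set \<Rightarrow> 'k. simplicial_chain G i f \<longrightarrow> (\<forall>F. bdry \<sigma> f F = 0) \<longrightarrow>
        (\<exists>g. simplicial_chain G (Suc i) g \<and> (\<forall>F. bdry \<sigma> g F = f F)))"

section \<open>Splitting a complex at a vertex: deletion, link and their exact sequence\<close>

definition deletion :: "nat \<Rightarrow> nat set set \<Rightarrow> nat set set" where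
  "deletion v G = {F \<in> G. v \<notin> F}"

definition link :: "nat \<Rightarrow> nat set set \<Rightarrow> nat set set" where
  "link v G = {F. v \<notin> F \<and> insert v F \<in> G}"

definition restrict_link :: "nat \<Rightarrow> (nat set \<Rightarrow> 'k::ab_group_add) \<Rightarrow> nat set \<Rightarrow> 'k" where
  "restrict_link v f F = (if v \<in> F then 0 else signed v F (f (insert v F)))"

definition restrict_deletion :: "nat \<Rightarrow> (nat set \<Rightarrow> 'k::ab_group_add) \<Rightarrow> nat set \<Rightarrow> 'k" where
  "restrict_deletion v f F = (if v \<in> F then 0 else f F)"

definition cone_chain :: "nat \<Rightarrow> (nat set \<Rightarrow> 'k::ab_group_add) \<Rightarrow> nat set \<Rightarrow> 'k" where
  "cone_chain v f F = (if v \<in> F then signed v (F - {v}) (f (F - {v})) else 0)"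

text \<open>A chain is determined by its two parts, and in terms of them the boundary is
  \<open>(g\<^sub>0, g\<^sub>1) \<mapsto> (\<partial> g\<^sub>0 + g\<^sub>1, - \<partial> g\<^sub>1)\<close>.\<close>

lemma chain_eqI:
  assumes "restrict_deletion v f = restrict_deletion v g" "restrict_link v f = restrict_link v g"
  shows "f F = g F"
proof (cases "v \<in> F")
  case True
  then have "insert v (F - {v}) = F" by blast
  then show ?thesis
    using fun_cong[OF assms(2), of "F - {v}"]
    by (auto simp: restrict_link_def signed_def split: if_splits)
next
  case False
  then show ?thesis using fun_cong[OF assms(1), of F] by (simp add: restrict_deletion_def)
qed

lemma restrict_cone [simp]:
  "restrict_deletion v (cone_chain v f) = 0"
  "restrict_link v (cone_chain v f) = restrict_deletion v f"
  by (auto simp: fun_eq_iff restrict_deletion_def restrict_link_def cone_chain_def insert_Diff_if)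

lemma restrict_idem:
  assumes "\<And>F. v \<in> F \<Longrightarrow> f F = 0"
  shows "restrict_deletion v f = f" "restrict_link v f = 0"
  using assms by (auto simp: fun_eq_iff restrict_deletion_def restrict_link_def)

lemma restrict_deletion_bdry:
  assumes "finite \<sigma>" "v \<in> \<sigma>" "v \<notin> F"
  shows "bdry \<sigma> f F = bdry (\<sigma> - {v}) (restrict_deletion v f) F + restrict_link v f F"
proof -
  have "\<sigma> - F = insert v (\<sigma> - {v} - F)" using assms by auto
  then have "bdry \<sigma> f F = signed v F (f (insert v F)) + (\<Sum>x\<in>\<sigma> - {v} - F. signed x F (f (insert x F)))"
    using assms by (simp add: koszul_def)
  also have "(\<Sum>x\<in>\<sigma> - {v} - F. signed x F (f (insert x F)))
      = bdry (\<sigma> - {v}) (restrict_deletion v f) F"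
    unfolding koszul_def using assms by (intro sum.cong refl) (auto simp: restrict_deletion_def)
  finally show ?thesis using assms by (simp add: restrict_link_def add.commute)
qed

lemma restrict_link_bdry:
  assumes "finite F" "v \<notin> F"
  shows "restrict_link v (bdry \<sigma> f) F = - bdry (\<sigma> - {v}) (restrict_link v f) F"
proof -
  have "restrict_link v (bdry \<sigma> f) F
      = (\<Sum>x\<in>\<sigma> - insert v F. signed v F (signed x (insert v F) (f (insert x (insert v F)))))"
    using assms by (simp add: restrict_link_def koszul_def signed_sum)
  also have "\<dots> = (\<Sum>x\<in>\<sigma> - {v} - F. - signed x F (restrict_link v f (insert x F)))"
  proof (intro sum.cong)
    fix x assume "x \<in> \<sigma> - {v} - F"
    then show "signed v F (signed x (insert v F) (f (insert x (insert v F))))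
        = - signed x F (restrict_link v f (insert x F))"
      using signed_swap[of F v x] assms by (auto simp: restrict_link_def insert_commute)
  qed auto
  finally show ?thesis by (simp add: koszul_def sum_negf)
qed

lemma simplicial_complexD:
  assumes "simplicial_complex \<sigma> G"
  shows "finite \<sigma>" "\<And>F. F \<in> G \<Longrightarrow> F \<subseteq> \<sigma>" "\<And>F. F \<in> G \<Longrightarrow> finite F"
    "\<And>F \<rho>. F \<in> G \<Longrightarrow> \<rho> \<subseteq> F \<Longrightarrow> \<rho> \<in> G"
  using assms unfolding simplicial_complex_def by (auto intro: finite_subset)

lemma simplicial_complex_link:
  "simplicial_complex \<sigma> G \<Longrightarrow> simplicial_complex (\<sigma> - {v}) (link v G)"
proof -
  assume G: "simplicial_complex \<sigma> G"
  have "\<rho> \<in> link v G" if "F \<in> link v G" "\<rho> \<subseteq> F" for F \<rho>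
    using G that insert_mono[OF that(2), of v] unfolding simplicial_complex_def link_def by auto
  moreover have "link v G \<subseteq> Pow (\<sigma> - {v})"
    using G unfolding simplicial_complex_def link_def by auto
  ultimately show ?thesis using G unfolding simplicial_complex_def by simp
qed

lemma simplicial_complex_deletion:
  "simplicial_complex \<sigma> G \<Longrightarrow> simplicial_complex (\<sigma> - {v}) (deletion v G)"
  unfolding simplicial_complex_def deletion_def by auto

lemma simplicial_chainI:
  "(\<And>F. f F \<noteq> 0 \<Longrightarrow> F \<in> G \<and> card F = i) \<Longrightarrow> simplicial_chain G i f"
  by (simp add: simplicial_chain_def)

lemma simplicial_chainD:
  "simplicial_chain G i f \<Longrightarrow> f F \<noteq> 0 \<Longrightarrow> F \<in> G"
  "simplicial_chain G i f \<Longrightarrow> f F \<noteq> 0 \<Longrightarrow> card F = i"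
  by (auto simp: simplicial_chain_def)

lemma simplicial_chain_0 [simp]: "simplicial_chain G i 0" "simplicial_chain G i (\<lambda>_. 0)"
  by (auto simp: simplicial_chain_def)

lemma simplicial_chain_add:
  assumes "simplicial_chain G i f" "simplicial_chain G i g"
  shows "simplicial_chain G i (\<lambda>F. f F + g F)"
proof (rule simplicial_chainI)
  fix F assume "f F + g F \<noteq> 0"
  then have "f F \<noteq> 0 \<or> g F \<noteq> 0" by auto
  then show "F \<in> G \<and> card F = i" using assms by (auto simp: simplicial_chain_def)
qed

lemma simplicial_chain_minus:
  "simplicial_chain G i f \<Longrightarrow> simplicial_chain G i (\<lambda>F. - f F)"
  by (simp add: simplicial_chain_def)

lemma simplicial_chain_diff:
  "simplicial_chain G i f \<Longrightarrow> simplicial_chain G i g \<Longrightarrow> simplicial_chain G i (\<lambda>F. f F - g F)"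
  using simplicial_chain_add[OF _ simplicial_chain_minus, of G i f g] by simp

lemma simplicial_chain_bdry:
  assumes "simplicial_complex \<sigma> G" "simplicial_chain G (Suc i) f"
  shows "simplicial_chain G i (bdry \<sigma> f)"
proof (rule simplicial_chainI)
  fix F assume "bdry \<sigma> f F \<noteq> 0"
  then obtain x where x: "x \<in> \<sigma> - F" "f (insert x F) \<noteq> 0"
    unfolding koszul_def by (metis (no_types, lifting) signed_0 sum.neutral)
  then have "insert x F \<in> G" "card (insert x F) = Suc i"
    using assms(2) by (auto simp: simplicial_chain_def)
  moreover from this have "finite (insert x F)"
    using simplicial_complexD(3)[OF assms(1), of "insert x F"] by simp
  ultimately show "F \<in> G \<and> card F = i"
    using x simplicial_complexD(4)[OF assms(1)] by auto
qed

lemma bdry_eq_0_outside: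
  assumes "simplicial_complex \<sigma> G" "simplicial_chain G i f" "F \<notin> G"
  shows "bdry \<sigma> f F = 0"
  unfolding koszul_def
proof (rule sum.neutral, intro ballI)
  fix x assume "x \<in> \<sigma> - F"
  have "insert x F \<notin> G" using assms(3) simplicial_complexD(4)[OF assms(1)] by blast
  then show "signed x F (f (insert x F)) = 0" using assms(2) by (auto simp: simplicial_chain_def)
qed

text \<open>\<open>koszul_koszul\<close> needs a finite \<open>F\<close>, whereas chains are defined
  on infinite sets too. There the boundary of a chain is zero because no face is infinite.\<close>

lemma bdry_bdry:
  assumes "simplicial_complex \<sigma> G" "simplicial_chain G i f"
  shows "bdry \<sigma> (bdry \<sigma> f) F = 0"
proof (cases "finite F")
  case True
  then show ?thesis using simplicial_complexD(1)[OF assms(1)] by (intro koszul_koszul) auto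
next
  case False
  have "bdry \<sigma> f (insert x F) = 0" for x
    using bdry_eq_0_outside[OF assms] simplicial_complexD(3)[OF assms(1)] False
    by (metis finite_insert)
  then show ?thesis by (simp add: koszul_def)
qed

lemma bdry_add: "bdry \<sigma> (\<lambda>F. f F + g F) F = bdry \<sigma> f F + bdry \<sigma> g F"
  and bdry_diff: "bdry \<sigma> (\<lambda>F. f F - g F) F = bdry \<sigma> f F - bdry \<sigma> g F"
  by (simp_all add: koszul_add koszul_diff)

lemma bdry_minus: "bdry \<sigma> (\<lambda>F. - f F) F = - bdry \<sigma> f F"
  by (simp add: koszul_def signed_minus sum_negf)

lemma bdry_off_vertex:
  assumes "\<And>F. v \<in> F \<Longrightarrow> f F = 0" "finite \<sigma>"
  shows "bdry \<sigma> f F = bdry (\<sigma> - {v}) f F"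
proof -
  have "bdry (\<sigma> - {v}) f F = (\<Sum>x\<in>\<sigma> - F. signed x F (f (insert x F)))"
    unfolding koszul_def using assms by (intro sum.mono_neutral_left) auto
  then show ?thesis by (simp add: koszul_def)
qed

lemma simplicial_chain_restrict_link:
  assumes "simplicial_complex \<sigma> G" "simplicial_chain G (Suc i) f"
  shows "simplicial_chain (link v G) i (restrict_link v f)"
proof (rule simplicial_chainI)
  fix F assume "restrict_link v f F \<noteq> 0"
  then have *: "v \<notin> F" "f (insert v F) \<noteq> 0" by (auto simp: restrict_link_def split: if_splits)
  then have "insert v F \<in> G" "card (insert v F) = Suc i"
    using assms(2) by (auto simp: simplicial_chain_def)
  moreover from this have "finite (insert v F)"
    using simplicial_complexD(3)[OF assms(1), of "insert v F"] by simp
  ultimately show "F \<in> link v G \<and> card F = i" using * by (auto simp: link_def)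
qed

lemma simplicial_chain_cone:
  assumes "simplicial_complex (\<sigma> - {v}) (link v G)" "simplicial_chain (link v G) i f"
  shows "simplicial_chain G (Suc i) (cone_chain v f)"
proof (rule simplicial_chainI)
  fix F assume "cone_chain v f F \<noteq> 0"
  then have *: "v \<in> F" "f (F - {v}) \<noteq> 0" by (auto simp: cone_chain_def split: if_splits)
  then have "F - {v} \<in> link v G" "card (F - {v}) = i"
    using assms(2) by (auto simp: simplicial_chain_def)
  moreover from this have "finite (F - {v})"
    using simplicial_complexD(3)[OF assms(1), of "F - {v}"] by simp
  moreover have "insert v (F - {v}) = F" using * by blast
  ultimately show "F \<in> G \<and> card F = Suc i"
    using * card_insert_disjoint[of "F - {v}" v] by (auto simp: link_def)
qed

lemma simplicial_chain_deletion_iff: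
  "simplicial_chain (deletion v G) i f \<longleftrightarrow> simplicial_chain G i f \<and> (\<forall>F. v \<in> F \<longrightarrow> f F = 0)"
  by (auto simp: simplicial_chain_def deletion_def)

lemma restrict_link_eq_0_iff:
  "restrict_link v f = 0 \<longleftrightarrow> (\<forall>F. v \<in> F \<longrightarrow> f F = 0)"
proof
  assume *: "restrict_link v f = 0"
  show "\<forall>F. v \<in> F \<longrightarrow> f F = 0"
  proof (intro allI impI)
    fix F assume "v \<in> F"
    then have "insert v (F - {v}) = F" by blast
    then show "f F = 0" using fun_cong[OF *, of "F - {v}"] by (simp add: restrict_link_def)
  qed
qed (auto simp: restrict_link_def fun_eq_iff)

lemma restrict_link_add:
  "restrict_link v (\<lambda>F. f F + g F) F = restrict_link v f F + restrict_link v g F"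
  by (simp add: restrict_link_def signed_add)

lemma restrict_link_diff:
  "restrict_link v (\<lambda>F. f F - g F) F = restrict_link v f F - restrict_link v g F"
  by (simp add: restrict_link_def signed_diff)

text \<open>Extends \<open>restrict_link_bdry\<close> to all sets: if \<open>F\<close> is infinite
  or contains \<open>v\<close>, it is no face of the link, and both sides are zero.\<close>

lemma restrict_link_bdry_chain:
  assumes G: "simplicial_complex \<sigma> G" and f: "simplicial_chain G (Suc i) f"
  shows "restrict_link v (bdry \<sigma> f) F = - bdry (\<sigma> - {v}) (restrict_link v f) F"
proof (cases "finite F \<and> v \<notin> F")
  case True
  then show ?thesis using restrict_link_bdry by blast
next
  case False
  then have "F \<notin> link v G"
    using simplicial_complexD(3)[OF simplicial_complex_link[OF G, of v], of F] by (auto simp: link_def)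
  then have "bdry (\<sigma> - {v}) (restrict_link v f) F = 0"
    using bdry_eq_0_outside[OF simplicial_complex_link[OF G] simplicial_chain_restrict_link[OF G f]]
    by blast
  moreover have "restrict_link v (bdry \<sigma> f) F = 0"
    using False bdry_eq_0_outside[OF G f, of "insert v F"] simplicial_complexD(3)[OF G, of "insert v F"]
    by (auto simp: restrict_link_def)
  ultimately show ?thesis by simp
qed

text \<open>The contraction cones the part of the cycle that avoids \<open>v\<close>. The boundary
  of this cone has the right deletion part by construction, and the right link part because in a
  cycle the boundary of the deletion part is minus the link part.\<close>

lemma acyclic_cone:
  assumes G: "simplicial_complex \<sigma> G" and v: "v \<in> \<sigma>" and cone: "\<And>F. F \<in> G \<Longrightarrow> insert v F \<in> G"
  shows "acyclic_at K \<sigma> G i"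
  unfolding acyclic_at_def
proof (intro allI impI)
  fix f :: "nat set \<Rightarrow> 'a" assume f: "simplicial_chain G i f" and cyc: "\<forall>F. bdry \<sigma> f F = 0"
  have fin: "finite \<sigma>" using simplicial_complexD(1)[OF G] .
  define g where "g = cone_chain v (restrict_deletion v f)"
  have "simplicial_chain (link v G) i (restrict_deletion v f)"
    using f cone by (auto simp: simplicial_chain_def restrict_deletion_def link_def)
  then have g: "simplicial_chain G (Suc i) g"
    unfolding g_def using simplicial_chain_cone simplicial_complex_link[OF G] by blast
  have idem: "restrict_deletion v (restrict_deletion v f) = restrict_deletion v f"
    by (auto simp: restrict_deletion_def)
  have eq: "bdry (\<sigma> - {v}) (restrict_deletion v f) F = - restrict_link v f F" if "v \<notin> F" for F
    using restrict_deletion_bdry[OF fin v that, of f] cyc by (simp add: eq_neg_iff_add_eq_0)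
  have "bdry \<sigma> g F = f F" for F
  proof (rule chain_eqI[of v])
    show "restrict_deletion v (bdry \<sigma> g) = restrict_deletion v f"
    proof
      fix F show "restrict_deletion v (bdry \<sigma> g) F = restrict_deletion v f F"
        using restrict_deletion_bdry[OF fin v, of F g]
        by (cases "v \<in> F") (simp_all add: restrict_deletion_def[of v "bdry \<sigma> g"] g_def idem,
            simp_all add: restrict_deletion_def koszul_def)
    qed
    show "restrict_link v (bdry \<sigma> g) = restrict_link v f"
    proof
      fix F show "restrict_link v (bdry \<sigma> g) F = restrict_link v f F"
      proof (cases "v \<in> F")
        case False
        then show ?thesis
          using restrict_link_bdry_chain[OF G g, of v F] eq by (simp add: g_def idem)
      qed (simp add: restrict_link_def)
    qed
  qed
  then show "\<exists>g. simplicial_chain G (Suc i) g \<and> (\<forall>F. bdry \<sigma> g F = f F)" using g by blast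
qed

text \<open>The cone over \<open>h\<close> has a boundary whose link part is minus that of
  \<open>f\<close>. Adding it therefore changes \<open>f\<close> by a boundary into a chain that
  avoids \<open>v\<close>.\<close>

lemma link_correction:
  assumes G: "simplicial_complex \<sigma> G" and v: "v \<in> \<sigma>" and f: "simplicial_chain G i f"
    and h: "simplicial_chain (link v G) i h"
      "\<And>F. bdry (\<sigma> - {v}) h F = restrict_link v f F"
  shows "\<exists>g. simplicial_chain G (Suc i) g \<and>
    simplicial_chain (deletion v G) i (\<lambda>F. f F + bdry \<sigma> g F)"
proof -
  have L: "simplicial_complex (\<sigma> - {v}) (link v G)" using simplicial_complex_link[OF G] .
  define g where "g = cone_chain v h"
  have g: "simplicial_chain G (Suc i) g"
    unfolding g_def using simplicial_chain_cone[OF L h(1)] .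
  have hd: "restrict_deletion v h = h"
    using h(1) by (intro restrict_idem) (auto simp: simplicial_chain_def link_def)
  have "restrict_link v (\<lambda>F. f F + bdry \<sigma> g F) F = 0" for F
    using restrict_link_bdry_chain[OF G g, of v F] h(2)[of F]
    by (simp add: restrict_link_add g_def hd)
  then have "restrict_link v (\<lambda>F. f F + bdry \<sigma> g F) = 0" by auto
  then have "simplicial_chain (deletion v G) i (\<lambda>F. f F + bdry \<sigma> g F)"
    unfolding simplicial_chain_deletion_iff restrict_link_eq_0_iff
    using simplicial_chain_add[OF f simplicial_chain_bdry[OF G g]] by blast
  then show ?thesis using g by blast
qed

text \<open>The next three lemmas express the exactness of
  \<open>H\<^sub>i (link) \<rightarrow> H\<^sub>i (deletion) \<rightarrow> H\<^sub>i (G) \<rightarrow> H\<^sub>i\<^sub>-\<^sub>1 (link) \<rightarrow> H\<^sub>i\<^sub>-\<^sub>1 (deletion)\<close>.\<close>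

lemma acyclic_from_link_deletion:
  assumes G: "simplicial_complex \<sigma> G" and v: "v \<in> \<sigma>"
    and L: "i \<noteq> 0 \<Longrightarrow> acyclic_at K (\<sigma> - {v}) (link v G) (i - 1)"
    and D: "acyclic_at K (\<sigma> - {v}) (deletion v G) i"
  shows "acyclic_at (K::'k::ab_group_add itself) \<sigma> G i"
  unfolding acyclic_at_def
proof (intro allI impI)
  fix f :: "nat set \<Rightarrow> 'k" assume f: "simplicial_chain G i f" and cyc: "\<forall>F. bdry \<sigma> f F = 0"
  have fin: "finite \<sigma>" using simplicial_complexD(1)[OF G] .
  have "\<exists>h. simplicial_chain (link v G) i h \<and> (\<forall>F. bdry (\<sigma> - {v}) h F = restrict_link v f F)"
  \<comment> \<open>In index 0 only the empty face can carry a coefficient, so the link part is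
    zero; there is no lower index of the link to refer to.\<close>
  proof (cases i)
    case 0
    have "restrict_link v f F = 0" for F
    proof (rule ccontr)
      assume "restrict_link v f F \<noteq> 0"
      then have "f (insert v F) \<noteq> 0" by (auto simp: restrict_link_def split: if_splits)
      then have "insert v F \<in> G" "card (insert v F) = 0" using f 0 by (auto simp: simplicial_chain_def)
      then show False using simplicial_complexD(3)[OF G, of "insert v F"] by simp
    qed
    then show ?thesis by (intro exI[of _ 0]) (simp add: koszul_def)
  next
    case (Suc j)
    note f' = f[unfolded Suc]
    have "restrict_link v (bdry \<sigma> f) F = 0" for F
      using cyc by (simp add: restrict_link_def)
    then have "\<forall>F. bdry (\<sigma> - {v}) (restrict_link v f) F = 0"
      using restrict_link_bdry_chain[OF G f', of v] by simp
    then show ?thesis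
      using L simplicial_chain_restrict_link[OF G f', of v] Suc unfolding acyclic_at_def by auto
  qed
  then obtain h where h: "simplicial_chain (link v G) i h"
      "\<And>F. bdry (\<sigma> - {v}) h F = restrict_link v f F" by blast
  obtain g where g: "simplicial_chain G (Suc i) g"
    and e: "simplicial_chain (deletion v G) i (\<lambda>F. f F + bdry \<sigma> g F)"
    using link_correction[OF G v f h] by blast
  have "bdry (\<sigma> - {v}) (\<lambda>F. f F + bdry \<sigma> g F) F = 0" for F
    using bdry_off_vertex[of v "\<lambda>F. f F + bdry \<sigma> g F" \<sigma> F] e fin
    by (simp add: simplicial_chain_deletion_iff bdry_add cyc bdry_bdry[OF G g])
  then obtain k where k: "simplicial_chain (deletion v G) (Suc i) k"
      "\<And>F. bdry (\<sigma> - {v}) k F = f F + bdry \<sigma> g F"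
    using D e unfolding acyclic_at_def by blast
  have "bdry \<sigma> k F = bdry (\<sigma> - {v}) k F" for F
    using k(1) fin by (intro bdry_off_vertex) (auto simp: simplicial_chain_deletion_iff)
  then have "bdry \<sigma> (\<lambda>F. k F - g F) F = f F" for F
    by (simp add: bdry_diff k(2))
  moreover have "simplicial_chain G (Suc i) (\<lambda>F. k F - g F)"
    using k(1) g by (auto simp: simplicial_chain_deletion_iff intro: simplicial_chain_diff)
  ultimately show "\<exists>g. simplicial_chain G (Suc i) g \<and> (\<forall>F. bdry \<sigma> g F = f F)" by blast
qed

lemma acyclic_deletion:
  assumes G: "simplicial_complex \<sigma> G" and v: "v \<in> \<sigma>"
    and L: "acyclic_at K (\<sigma> - {v}) (link v G) i"
    and GK: "acyclic_at K \<sigma> G i"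
  shows "acyclic_at (K::'k::ab_group_add itself) (\<sigma> - {v}) (deletion v G) i"
  unfolding acyclic_at_def
proof (intro allI impI)
  fix f :: "nat set \<Rightarrow> 'k"
  assume f: "simplicial_chain (deletion v G) i f" and cyc: "\<forall>F. bdry (\<sigma> - {v}) f F = 0"
  have fin: "finite \<sigma>" using simplicial_complexD(1)[OF G] .
  have off: "\<And>F. v \<in> F \<Longrightarrow> f F = 0" and fG: "simplicial_chain G i f"
    using f by (auto simp: simplicial_chain_deletion_iff)
  have "\<forall>F. bdry \<sigma> f F = 0" using bdry_off_vertex[of v f \<sigma>] off fin cyc by simp
  then obtain g where g: "simplicial_chain G (Suc i) g" "\<And>F. bdry \<sigma> g F = f F"
    using GK fG unfolding acyclic_at_def by blast
  \<comment> \<open>The chain \<open>g\<close> may use \<open>v\<close>, but its boundary does not,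
    so the link part of \<open>g\<close> is a cycle. As this cycle bounds in the link,
    \<open>g\<close> can be moved off \<open>v\<close> without changing its boundary.\<close>
  have "restrict_link v f = 0" using off by (simp add: restrict_link_eq_0_iff)
  moreover have "bdry \<sigma> g = f" using g(2) by blast
  ultimately have "\<forall>F. bdry (\<sigma> - {v}) (restrict_link v g) F = 0"
    using restrict_link_bdry_chain[OF G g(1), of v] by simp
  then obtain h where h: "simplicial_chain (link v G) (Suc i) h"
      "\<And>F. bdry (\<sigma> - {v}) h F = restrict_link v g F"
    using L simplicial_chain_restrict_link[OF G g(1), of v] unfolding acyclic_at_def by blast
  obtain k where k: "simplicial_chain G (Suc (Suc i)) k"
    and e: "simplicial_chain (deletion v G) (Suc i) (\<lambda>F. g F + bdry \<sigma> k F)"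
    using link_correction[OF G v g(1) h] by blast
  have "bdry (\<sigma> - {v}) (\<lambda>F. g F + bdry \<sigma> k F) F = f F" for F
    using bdry_off_vertex[of v "\<lambda>F. g F + bdry \<sigma> k F" \<sigma> F] e fin
    by (simp add: simplicial_chain_deletion_iff bdry_add bdry_bdry[OF G k] g(2))
  then show "\<exists>g. simplicial_chain (deletion v G) (Suc i) g \<and> (\<forall>F. bdry (\<sigma> - {v}) g F = f F)"
    using e by blast
qed

lemma acyclic_link:
  assumes G: "simplicial_complex \<sigma> G" and v: "v \<in> \<sigma>"
    and D: "acyclic_at K (\<sigma> - {v}) (deletion v G) i"
    and GK: "acyclic_at K \<sigma> G (Suc i)"
  shows "acyclic_at (K::'k::ab_group_add itself) (\<sigma> - {v}) (link v G) i"
  unfolding acyclic_at_def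
proof (intro allI impI)
  fix f :: "nat set \<Rightarrow> 'k"
  assume f: "simplicial_chain (link v G) i f" and cyc: "\<forall>F. bdry (\<sigma> - {v}) f F = 0"
  have fin: "finite \<sigma>" using simplicial_complexD(1)[OF G] .
  have off: "\<And>F. v \<in> F \<Longrightarrow> f F = 0" using f by (auto simp: simplicial_chain_def link_def)
  have "simplicial_chain (deletion v G) i f"
    using f simplicial_complexD(4)[OF G] unfolding simplicial_chain_def link_def deletion_def
    by blast
  then obtain h where h: "simplicial_chain (deletion v G) (Suc i) h"
      "\<And>F. bdry (\<sigma> - {v}) h F = f F"
    using D cyc unfolding acyclic_at_def by blast
  have hG: "simplicial_chain G (Suc i) h" and hoff: "\<And>F. v \<in> F \<Longrightarrow> h F = 0"
    using h(1) by (auto simp: simplicial_chain_deletion_iff)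
  \<comment> \<open>A preimage of \<open>f\<close> under the connecting map: the boundary of the
    cone over \<open>f\<close> is corrected by \<open>h\<close>, which leaves a cycle of
    \<open>G\<close> with link part \<open>f\<close>.\<close>
  define e where "e = (\<lambda>F. cone_chain v f F - h F)"
  have e: "simplicial_chain G (Suc i) e"
    unfolding e_def
    using simplicial_chain_cone[OF simplicial_complex_link[OF G] f] hG simplicial_chain_diff by blast
  have linkF: "restrict_link v e = f"
    using restrict_idem(1)[of v f] restrict_idem(2)[of v h] off hoff
    by (simp add: fun_eq_iff e_def restrict_link_diff)
  have delF: "restrict_deletion v e = (\<lambda>F. - h F)"
    using hoff by (auto simp: e_def restrict_deletion_def cone_chain_def)
  have "restrict_deletion v (bdry \<sigma> e) = 0"
  proof
    fix F show "restrict_deletion v (bdry \<sigma> e) F = 0 F"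
      using restrict_deletion_bdry[OF fin v, of F e]
      by (auto simp: restrict_deletion_def[of v "bdry \<sigma> e"] linkF delF bdry_minus h(2))
  qed
  moreover have "restrict_link v (bdry \<sigma> e) = 0"
    using restrict_link_bdry_chain[OF G e, of v] cyc by (auto simp: linkF)
  ultimately have "\<forall>F. bdry \<sigma> e F = 0"
    using chain_eqI[of v "bdry \<sigma> e" 0] restrict_idem[of v "0 :: nat set \<Rightarrow> 'k"] by simp
  then obtain g where g: "simplicial_chain G (Suc (Suc i)) g" "\<And>F. bdry \<sigma> g F = e F"
    using GK e unfolding acyclic_at_def by blast
  have "bdry \<sigma> g = e" using g(2) by blast
  then have "bdry (\<sigma> - {v}) (\<lambda>F. - restrict_link v g F) F = f F" for F
    using restrict_link_bdry_chain[OF G g(1), of v F] by (simp add: linkF bdry_minus)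
  moreover have "simplicial_chain (link v G) (Suc i) (\<lambda>F. - restrict_link v g F)"
    using simplicial_chain_minus[OF simplicial_chain_restrict_link[OF G g(1)]] .
  ultimately show "\<exists>g. simplicial_chain (link v G) (Suc i) g \<and> (\<forall>F. bdry (\<sigma> - {v}) g F = f F)"
    by blast
qed

section \<open>Matchings in induced subgraphs of a path\<close>

text \<open>\<open>T\<close> will be the support of a monomial. Removing both endpoints keeps the
  edges disjoint without a set of edges, and the length of the path enters only through the
  support.\<close>

fun has_matching :: "nat \<Rightarrow> nat set \<Rightarrow> bool" where
  "has_matching 0 T = True"
| "has_matching (Suc k) T = (\<exists>i. i \<in> T \<and> Suc i \<in> T \<and> has_matching k (T - {i, Suc i}))"

lemma has_matching_mono: "has_matching k T \<Longrightarrow> T \<subseteq> U \<Longrightarrow> has_matching k U"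
proof (induction k arbitrary: T U)
  case (Suc k)
  then obtain i where i: "i \<in> T" "Suc i \<in> T" "has_matching k (T - {i, Suc i})" by auto
  then have "has_matching k (U - {i, Suc i})" using Suc.IH[of _ "U - {i, Suc i}"] Suc.prems(2) by blast
  then show ?case using i Suc.prems(2) by auto
qed simp

lemma has_matching_card: "has_matching k T \<Longrightarrow> finite T \<Longrightarrow> 2 * k \<le> card T"
proof (induction k arbitrary: T)
  case (Suc k)
  then obtain i where i: "i \<in> T" "Suc i \<in> T" "has_matching k (T - {i, Suc i})" by auto
  have "card {i, Suc i} \<le> card T" using i Suc.prems(2) by (intro card_mono) auto
  then have "card (T - {i, Suc i}) + 2 = card T" using i Suc.prems(2)
    by (subst card_Diff_subset) auto
  then show ?case using Suc.IH[OF i(3)] Suc.prems(2) by simp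
qed simp

text \<open>No edge of a matching meets an isolated vertex. The left neighbour is described by
  \<open>Suc u = v\<close>, which covers \<open>v = 0\<close> without truncated subtraction.\<close>

lemma has_matching_Diff_isolated:
  assumes "\<And>u. Suc u = v \<Longrightarrow> u \<notin> T" "Suc v \<notin> T"
  shows "has_matching k (T - {v}) \<longleftrightarrow> has_matching k T"
proof
  show "has_matching k T \<Longrightarrow> has_matching k (T - {v})" using assms
  proof (induction k arbitrary: T)
    case (Suc k)
    then obtain i where i: "i \<in> T" "Suc i \<in> T" "has_matching k (T - {i, Suc i})" by auto
    have "has_matching k (T - {i, Suc i} - {v})" using Suc.IH[OF i(3)] Suc.prems by blast
    moreover have "i \<noteq> v" "Suc i \<noteq> v" using i Suc.prems by auto
    moreover have "T - {i, Suc i} - {v} = T - {v} - {i, Suc i}" by blast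
    ultimately show ?case using i by auto
  qed simp
qed (auto intro: has_matching_mono)

lemma has_matching_end_edge:
  assumes "w \<in> T" "Suc w \<in> T" "Suc (Suc w) \<notin> T"
  shows "has_matching (Suc k) T \<longleftrightarrow> has_matching k (T - {w, Suc w})"
proof
  show "has_matching (Suc k) T \<Longrightarrow> has_matching k (T - {w, Suc w})" using assms
  proof (induction k arbitrary: T)
    case (Suc k)
    obtain i where i: "i \<in> T" "Suc i \<in> T" "has_matching (Suc k) (T - {i, Suc i})"
      using Suc.prems(1) by (auto simp del: has_matching.simps(2) simp: has_matching.simps(2)[of "Suc k"])
    have "i \<noteq> Suc w" using i Suc.prems by auto
    then consider "i = w" | "Suc i = w" | "i \<noteq> w" "Suc i \<noteq> w" "i \<noteq> Suc w" by blast
    then show ?case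
    proof cases
      case 1
      then show ?thesis using i by simp
    next
      case 2
      have "has_matching (Suc k) (T - {i, Suc i} - {Suc w})"
        using has_matching_Diff_isolated[of "Suc w" "T - {i, Suc i}" "Suc k"] i(3) 2 Suc.prems by auto
      then show ?thesis by (rule has_matching_mono) (use 2 in auto)
    next
      case 3
      then have "has_matching k (T - {i, Suc i} - {w, Suc w})"
        using Suc.IH[OF i(3)] Suc.prems by auto
      moreover have "T - {i, Suc i} - {w, Suc w} = T - {w, Suc w} - {i, Suc i}" by blast
      ultimately show ?thesis using 3 i by auto
    qed
  qed simp
qed (use assms in auto)

section \<open>The complexes computing the multigraded Betti numbers\<close>

text \<open>The homology of this complex is the homology of the Koszul complex of the
  square-free power in the multidegree \<open>S\<close>: the face \<open>F\<close> carries the monomial with support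
  \<open>S - F\<close>.\<close>

definition matching_complex :: "nat \<Rightarrow> nat set \<Rightarrow> nat set set" where
  "matching_complex k S = {F. F \<subseteq> S \<and> has_matching k (S - F)}"

lemma simplicial_complex_matching:
  "finite S \<Longrightarrow> simplicial_complex S (matching_complex k S)"
  unfolding simplicial_complex_def matching_complex_def
  by (auto elim!: has_matching_mono)

lemma deletion_Collect: "deletion u {F. F \<subseteq> A \<and> P F} = {F. F \<subseteq> A - {u} \<and> P F}"
  unfolding deletion_def by auto

lemma link_Collect:
  "u \<in> A \<Longrightarrow> link u {F. F \<subseteq> A \<and> P F} = {F. F \<subseteq> A - {u} \<and> P (insert u F)}"
  unfolding link_def by auto

lemma link_matching_complex:
  "x \<in> S \<Longrightarrow> link x (matching_complex k S) = matching_complex k (S - {x})"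
  unfolding link_def matching_complex_def by (auto simp: Diff_insert2[symmetric])

text \<open>Moving an isolated vertex from \<open>S - F\<close> into the face destroys no edge, so
  the complex is a cone with this vertex as apex.\<close>

lemma acyclic_isolated:
  assumes "finite S" "v \<in> S" "\<And>u. Suc u = v \<Longrightarrow> u \<notin> S" "Suc v \<notin> S"
  shows "acyclic_at K S (matching_complex k S) i"
proof (rule acyclic_cone[OF simplicial_complex_matching[OF assms(1)] assms(2)])
  fix F assume "F \<in> matching_complex k S"
  then show "insert v F \<in> matching_complex k S"
    using has_matching_Diff_isolated[of v "S - F" k] assms(2-4)
    by (auto simp: matching_complex_def Diff_insert[symmetric])
qed

text \<open>A face avoiding both end vertices leaves the whole end edge in \<open>S - F\<close>,
  where the matching may be assumed to use it; one edge fewer is then asked of the rest.\<close>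

lemma matching_complex_end_edge:
  assumes "w \<in> S" "Suc w \<in> S" "Suc (Suc w) \<notin> S"
  shows "deletion (Suc w) (deletion w (matching_complex (Suc k) S)) = matching_complex k (S - {w, Suc w})"
proof -
  have "has_matching (Suc k) (S - F) \<longleftrightarrow> has_matching k (S - {w, Suc w} - F)"
    if "w \<notin> F" "Suc w \<notin> F" for F
  proof -
    have "S - {w, Suc w} - F = S - F - {w, Suc w}" by blast
    then show ?thesis using has_matching_end_edge[of w "S - F" k] assms that by simp
  qed
  then show ?thesis unfolding deletion_def matching_complex_def by auto
qed

text \<open>\<open>Suc w\<close> has been used up by the face while \<open>w\<close> can no longer
  enter it, so \<open>w\<close> stays available for an edge with its left neighbour. In general this
  is no matching complex.\<close>

lemma link_end_vertex:
  assumes "w \<in> S" "Suc w \<in> S"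
  shows "link (Suc w) (deletion w (matching_complex k S)) =
    {F. F \<subseteq> S - {w, Suc w} \<and> has_matching k (insert w (S - {w, Suc w} - F))}"
proof -
  have eq: "S - insert (Suc w) F = insert w (S - {w, Suc w} - F)" if "w \<notin> F" for F
    using assms that by auto
  show ?thesis
  proof (rule Set.set_eqI)
    fix F
    show "F \<in> link (Suc w) (deletion w (matching_complex k S)) \<longleftrightarrow>
        F \<in> {F. F \<subseteq> S - {w, Suc w} \<and> has_matching k (insert w (S - {w, Suc w} - F))}"
      using assms eq[of F] by (cases "w \<in> F") (auto simp: link_def deletion_def matching_complex_def)
  qed
qed

lemma link_end_vertex_isolated:
  assumes "w \<in> S" "Suc w \<in> S" "\<And>u. Suc u = w \<Longrightarrow> u \<notin> S"
  shows "link (Suc w) (deletion w (matching_complex k S)) = matching_complex k (S - {w, Suc w})"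
proof -
  have "has_matching k (insert w T) \<longleftrightarrow> has_matching k T" if "T \<subseteq> S - {w, Suc w}" for T
    using has_matching_Diff_isolated[of w "insert w T" k] assms(3) that by (auto simp: subset_Diff_insert)
  then show ?thesis
    unfolding link_end_vertex[OF assms(1,2)] unfolding matching_complex_def by auto
qed

text \<open>Let v be the largest vertex and w = v - 1. If k = 0 or v is isolated, the complex is a
  cone. Otherwise the link of w is one, as v is isolated in \<open>S - {w}\<close>, and only the
  deletion of w has to be split at v. The induction applies to every piece because 3i + 4k + N drops
  by at least 3 for each vertex removed. Deleting v too: two vertices, drop 4 from k and 2 from N.
  Link of v, with w isolated: two vertices, drop 3 from i and 3 from N. If w has a left neighbour u,
  the link of v is split at u: three vertices, drop 3 from N, and either 3 from i and 4 from k
  (deletion) or 6 from i (link).\<close>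

theorem acyclic_matching_complex:
  assumes "S \<subseteq> {1..N}" "3 * card S > 3 * i + 4 * k + N"
  shows "acyclic_at (K::'k::ab_group_add itself) S (matching_complex k S) i"
  using assms
proof (induction "card S" arbitrary: S N i k rule: less_induct)
  case less
  have fin: "finite S" using less.prems(1) finite_subset by blast
  have "S \<noteq> {}" using less.prems(2) by auto
  define v where "v = Max S"
  have v: "v \<in> S" "\<And>x. x \<in> S \<Longrightarrow> x \<le> v" using fin \<open>S \<noteq> {}\<close> by (auto simp: v_def)
  have vN: "v \<le> N" "1 \<le> v" using v less.prems(1) by auto
  have top: "Suc v \<notin> S" using v(2)[of "Suc v"] by auto
  note G = simplicial_complex_matching[OF fin, of k]
  show ?case
  proof (cases "k = 0 \<or> v - 1 \<notin> S \<or> v = 1")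
    case True
    have "0 \<notin> S" using less.prems(1) by auto
    show ?thesis
    proof (cases "k = 0")
      case True
      then show ?thesis using v(1) by (intro acyclic_cone[OF G]) (auto simp: matching_complex_def)
    next
      case False
      with \<open>0 \<notin> S\<close> True have "u \<notin> S" if "Suc u = v" for u using that by auto
      then show ?thesis using acyclic_isolated[OF fin v(1) _ top] by blast
    qed
  next
    case False
    define w where "w = v - 1"
    have vw: "v = Suc w" "w \<in> S" "1 \<le> w" using False vN by (auto simp: w_def)
    obtain k' where k': "k = Suc k'" using False by (cases k) auto
    let ?S = "S - {w, v}"
    have cS: "card ?S + 2 = card S"
      using card_mono[of S "{w, v}"] fin v(1) vw by (subst card_Diff_subset) auto
    have S_sub: "?S \<subseteq> {1..w - 1}"
    proof
      fix x assume "x \<in> ?S"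
      then show "x \<in> {1..w - 1}" using v(2)[of x] less.prems(1) vw(1) by auto
    qed
    let ?D = "deletion w (matching_complex k S)"
    have DC: "simplicial_complex (S - {w}) ?D" using simplicial_complex_deletion[OF G] .
    have S2: "S - {w} - {v} = ?S" by auto
    have link: "acyclic_at K ?S (link v ?D) j" if "i = Suc j" for j
    proof (cases "w - 1 \<in> S \<and> w \<noteq> 1")
      case False
      have "u \<notin> S" if "Suc u = w" for u using False that less.prems(1) by (cases u) auto
      then have "link v ?D = matching_complex k ?S"
        using link_end_vertex_isolated[of w S] vw v(1) by blast
      moreover have "?S \<subseteq> {1..w - 2}"
      proof
        fix x assume "x \<in> ?S"
        then show "x \<in> {1..w - 2}"
          using subsetD[OF S_sub, of x] False by (cases "x = w - 1") auto
      qed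
      moreover have "3 * card ?S > 3 * j + 4 * k + (w - 2)"
      \<comment> \<open>For \<open>w = 1\<close> truncation stops \<open>w - 2\<close> from lowering
        the bound by 3. But then \<open>S\<close> has two elements, and \<open>i\<close> and
        \<open>k\<close> being positive contradicts the assumed inequality.\<close>
      proof (cases "w = 1")
        case True
        then have "?S = {}" using S_sub by simp
        then have "card ?S = 0" by (simp only: card.empty)
        then show ?thesis using less.prems(2) that k' cS by linarith
      next
        case False
        then show ?thesis using less.prems(2) vN that vw cS by linarith
      qed
      ultimately show ?thesis using less.hyps[of ?S "w - 2" j k] cS by simp
    next
      case True
      \<comment> \<open>Splitting at \<open>u\<close> settles the role of \<open>w\<close>: if
        \<open>u\<close> stays outside the face, \<open>u\<close> and \<open>w\<close> form an end
        edge that may be matched; if \<open>u\<close> enters the face, \<open>w\<close> becomes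
        isolated.\<close>
      define u where "u = w - 1"
      have u: "w = Suc u" "u \<in> S" "1 \<le> u" using True vw by (auto simp: u_def)
      have uS: "u \<in> ?S" using u vw by auto
      let ?T = "?S - {u}"
      have cT: "card ?T + 3 = card S" using uS fin cS card_Suc_Diff1[of ?S u] by simp
      have T_sub: "?T \<subseteq> {1..u - 1}"
      proof
        fix x assume "x \<in> ?T"
        then show "x \<in> {1..u - 1}" using subsetD[OF S_sub, of x] u(1) by (cases "x = u") auto
      qed
      let ?L = "link v ?D"
      have L: "simplicial_complex ?S ?L" using simplicial_complex_link[OF DC, of v] S2 by simp
      have Leq: "?L = {F. F \<subseteq> ?S \<and> has_matching k (insert w (?S - F))}"
        using link_end_vertex[of w S] vw v(1) by simp
      have "has_matching k (insert w (?S - F)) \<longleftrightarrow> has_matching k' (?T - F)"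
        if "u \<notin> F" for F
      proof -
        have "insert w (?S - F) - {u, Suc u} = ?T - F" using u(1) by auto
        moreover have "Suc (Suc u) \<notin> insert w (?S - F)" using u(1) vw(1) by auto
        ultimately show ?thesis
          using has_matching_end_edge[of u "insert w (?S - F)" k'] u(1) uS that k' by auto
      qed
      then have Ldel: "deletion u ?L = matching_complex k' ?T"
        unfolding Leq deletion_Collect unfolding matching_complex_def by (intro Collect_cong) blast
      have "has_matching k (insert w (?S - insert u F)) \<longleftrightarrow> has_matching k (?T - F)" for F
      proof -
        have eq: "insert w (?S - insert u F) - {w} = ?T - F" by auto
        have "has_matching k (insert w (?S - insert u F) - {w})
            \<longleftrightarrow> has_matching k (insert w (?S - insert u F))"
          by (rule has_matching_Diff_isolated) (use u(1) vw(1) in auto)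
        then show ?thesis unfolding eq by simp
      qed
      then have Llink: "link u ?L = matching_complex k ?T"
        unfolding Leq link_Collect[OF uS] unfolding matching_complex_def by simp
      show ?thesis
      proof (rule acyclic_from_link_deletion[OF L uS])
        have "3 * card ?T > 3 * j + 4 * k' + (u - 1)"
          using less.prems(2) vN that vw u k' cT by linarith
        then show "acyclic_at K ?T (deletion u ?L) j"
          unfolding Ldel using less.hyps[of ?T "u - 1" j k'] cT T_sub by simp
        assume "j \<noteq> 0"
        then have "3 * card ?T > 3 * (j - 1) + 4 * k + (u - 1)"
          using less.prems(2) vN that vw u cT by linarith
        then show "acyclic_at K ?T (link u ?L) (j - 1)"
          unfolding Llink using less.hyps[of ?T "u - 1" "j - 1" k] cT T_sub by simp
      qed
    qed
    have del: "acyclic_at K (S - {w}) ?D i"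
    proof (rule acyclic_from_link_deletion[OF DC])
      show "v \<in> S - {w}" using v vw by simp
      show "acyclic_at K (S - {w} - {v}) (link v ?D) (i - 1)" if "i \<noteq> 0"
        unfolding S2 using link[of "i - 1"] that by simp
      have "3 * card ?S > 3 * i + 4 * k' + (w - 1)"
        using less.prems(2) vN vw k' cS by linarith
      then have "acyclic_at K ?S (matching_complex k' ?S) i"
        using less.hyps[of ?S "w - 1" i k'] cS S_sub by simp
      then show "acyclic_at K (S - {w} - {v}) (deletion v ?D) i"
        unfolding S2 using matching_complex_end_edge[of w S k'] vw v(1) top k' by simp
    qed
    have "acyclic_at K (S - {w}) (matching_complex k (S - {w})) j" for j
      using v(1) vw top fin by (intro acyclic_isolated[of _ v]) auto
    then have "acyclic_at K (S - {w}) (link w (matching_complex k S)) j" for j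
      using link_matching_complex[OF vw(2)] by simp
    then show ?thesis using acyclic_from_link_deletion[OF G vw(2)] del by blast
  qed
qed

text \<open>A path on \<open>2k\<close> vertices together with \<open>r\<close> isolated edges.\<close>

fun extremal_set :: "nat \<Rightarrow> nat \<Rightarrow> nat set" where
  "extremal_set k 0 = {1..2 * k}"
| "extremal_set k (Suc r) = {2 * k + 3 * r + 2, 2 * k + 3 * r + 3} \<union> extremal_set k r"

lemma extremal_set_subset: "extremal_set k r \<subseteq> {1..2 * k + 3 * r}"
  by (induction r) auto

lemma finite_extremal_set [simp]: "finite (extremal_set k r)"
  by (induction r) auto

lemma card_extremal_set: "card (extremal_set k r) = 2 * k + 2 * r"
proof (induction r)
  case (Suc r)
  have "2 * k + 3 * r + 2 \<notin> extremal_set k r" "2 * k + 3 * r + 3 \<notin> extremal_set k r"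
    using extremal_set_subset[of k r] by auto
  then show ?case using Suc by simp
qed simp

lemma has_matching_path: "has_matching k {1..2 * k}"
proof (induction k)
  case (Suc k)
  have "{1..2 * Suc k} - {2 * k + 1, Suc (2 * k + 1)} = {1..2 * k}" by auto
  then have "has_matching k ({1..2 * Suc k} - {2 * k + 1, Suc (2 * k + 1)})" using Suc by simp
  then show ?case unfolding has_matching.simps(2) by (intro exI[of _ "2 * k + 1"]) auto
qed simp

text \<open>For \<open>r = 0\<close> all 2k vertices are needed by the matching, so the empty set is
  the only face and its class is not a boundary. An added isolated edge shifts this class up by one
  index: the link of \<open>w\<close> is a cone, and deleting both its vertices leaves
  \<open>k - 1\<close> edges to be found, where the vanishing bound holds with slack 4. The exact
  sequence then carries acyclicity of the larger complex in index \<open>Suc r\<close> down to the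
  smaller one in index \<open>r\<close>.\<close>

theorem not_acyclic_extremal:
  assumes "k \<ge> 1"
  shows "\<not> acyclic_at (K::'k::field itself) (extremal_set k r) (matching_complex k (extremal_set k r)) r"
proof (induction r)
  case 0
  let ?S = "{1..2 * k}" and ?G = "matching_complex k {1..2 * k}"
  \<comment> \<open>The generator in index 0, that is in dimension -1.\<close>
  define f :: "nat set \<Rightarrow> 'k" where "f F = (if F = {} then 1 else 0)" for F
  have f: "simplicial_chain ?G 0 f"
    using has_matching_path[of k] by (auto simp: simplicial_chain_def f_def matching_complex_def)
  have cyc: "\<forall>F. bdry ?S f F = 0" by (simp add: koszul_def f_def)
  have "False" if g: "simplicial_chain ?G (Suc 0) g" and b: "\<forall>F. bdry ?S g F = f F" for g
  proof -
    have "bdry ?S g {} \<noteq> 0" using b by (simp add: f_def)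
    then obtain x where x: "x \<in> ?S" "g {x} \<noteq> 0"
      unfolding koszul_def by (metis (no_types, lifting) Diff_empty signed_0 sum.neutral)
    then have "has_matching k (?S - {x})" using g by (auto simp: simplicial_chain_def matching_complex_def)
    then have "2 * k \<le> card (?S - {x})" using has_matching_card by blast
    moreover have "card (?S - {x}) = 2 * k - 1" using x(1) by simp
    ultimately show False using assms by linarith
  qed
  with f cyc have "\<not> acyclic_at K ?S ?G 0" unfolding acyclic_at_def by blast
  then show ?case by simp
next
  case (Suc r)
  let ?S = "extremal_set k (Suc r)" and ?T = "extremal_set k r"
  define w where "w = 2 * k + 3 * r + 2"
  have SS: "?S = {w, Suc w} \<union> ?T" by (simp add: w_def eval_nat_numeral)
  have T: "?T \<subseteq> {1..2 * k + 3 * r}" by (rule extremal_set_subset)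
  have w: "w \<in> ?S" "Suc w \<in> ?S" "Suc (Suc w) \<notin> ?S" and uS: "\<And>u. Suc u = w \<Longrightarrow> u \<notin> ?S"
    using T unfolding SS by (auto simp: w_def)
  have TS: "?S - {w, Suc w} = ?T" using T unfolding SS by (auto simp: w_def)
  have TS': "?S - {w} - {Suc w} = ?T" using TS by blast
  obtain k' where k': "k = Suc k'" using assms by (cases k) auto
  let ?G = "matching_complex k ?S"
  have G: "simplicial_complex ?S ?G" by (simp add: simplicial_complex_matching)
  show ?case
  proof
    assume a: "acyclic_at K ?S ?G (Suc r)"
    have "acyclic_at K (?S - {w}) (matching_complex k (?S - {w})) (Suc r)"
      by (rule acyclic_isolated[of _ "Suc w"]) (use w in auto)
    then have "acyclic_at K (?S - {w}) (link w ?G) (Suc r)"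
      using link_matching_complex[OF w(1)] by simp
    then have "acyclic_at K (?S - {w}) (deletion w ?G) (Suc r)"
      using acyclic_deletion[OF G w(1) _ a] by blast
    note D = this
    have "acyclic_at K (?S - {w} - {Suc w}) (deletion (Suc w) (deletion w ?G)) r"
    proof -
      have "acyclic_at K ?T (matching_complex k' ?T) r"
        using k' by (intro acyclic_matching_complex[OF T]) (simp add: card_extremal_set)
      then show ?thesis
        using matching_complex_end_edge[OF w, of k'] TS TS' k' by simp
    qed
    then have "acyclic_at K (?S - {w} - {Suc w}) (link (Suc w) (deletion w ?G)) r"
      using acyclic_link[OF simplicial_complex_deletion[OF G] _ _ D] w(2) by simp
    then have "acyclic_at K ?T (matching_complex k ?T) r"
      using link_end_vertex_isolated[OF w(1,2) uS, of k] TS TS' by simp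
    then show False using Suc.IH by contradiction
  qed
qed

section \<open>Polynomials and multidegree strands\<close>

lemma poly_ring_zero [simp]: "0 \<in> carrier (poly_ring V)"
  and poly_ring_one [simp]: "1 \<in> carrier (poly_ring V)"
  by (simp_all add: poly_ring_simps)

lemma poly_ring_uminus: "p \<in> carrier (poly_ring V) \<Longrightarrow> - p \<in> carrier (poly_ring V)"
  by (simp add: poly_ring_simps)

lemma poly_ring_sum:
  "(\<And>x. x \<in> A \<Longrightarrow> f x \<in> carrier (poly_ring V)) \<Longrightarrow> sum f A \<in> carrier (poly_ring V)"
  by (induction A rule: infinite_finite_induct) (auto intro: poly_ring_add_closed)

lemma poly_ring_single:
  "keys m \<subseteq> V \<Longrightarrow> Poly_Mapping.single m a \<in> carrier (poly_ring V)"
  by (simp add: poly_ring_simps)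

lemma poly_ring_indet: "v \<in> V \<Longrightarrow> indet v \<in> carrier (poly_ring V)"
  by (simp add: indet_def monomial_def poly_ring_single)

lemma poly_ring_signed:
  "p \<in> carrier (poly_ring V) \<Longrightarrow> signed v F p \<in> carrier (poly_ring V)"
  by (simp add: signed_def poly_ring_uminus)

lemma lookup_single_mult:
  fixes a :: "'v \<Rightarrow>\<^sub>0 nat" and c :: "'k::field"
  shows "lookup (Poly_Mapping.single a c * p) m =
    (if \<exists>q. m = a + q then c * lookup p (m - a) else 0)"
proof -
  have "lookup (Poly_Mapping.single a c * p) m
      = c * (\<Sum>q. lookup p q when m = a + q)"
    by (simp add: lookup_mult lookup_single when_mult)
  also have "\<dots> = (if \<exists>q. m = a + q then c * lookup p (m - a) else 0)"
  proof (cases "\<exists>q. m = a + q")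
    case True
    then obtain q where q: "m = a + q" by blast
    then have "(\<lambda>r. lookup p r when m = a + r) = (\<lambda>r. lookup p r when r = q)"
      by (auto simp: fun_eq_iff when_def)
    then show ?thesis using q by simp
  qed simp
  finally show ?thesis .
qed

lemma lookup_indet_mult:
  fixes p :: "('v, 'k::field) mpoly"
  shows "lookup (indet v * p) m =
    (if v \<in> keys m then lookup p (m - Poly_Mapping.single v 1) else 0)"
proof -
  have "(\<exists>q. m = Poly_Mapping.single v 1 + q) \<longleftrightarrow> v \<in> keys m"
  proof
    assume "v \<in> keys m"
    then have "lookup m v \<noteq> 0" by (simp add: in_keys_iff)
    then have "m = Poly_Mapping.single v 1 + (m - Poly_Mapping.single v 1)"
      by (intro poly_mapping_eqI) (auto simp: lookup_add lookup_minus lookup_single when_def)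
    then show "\<exists>q. m = Poly_Mapping.single v 1 + q" by blast
  qed (auto simp: in_keys_iff lookup_add)
  then show ?thesis by (simp add: indet_def monomial_def lookup_single_mult)
qed

lemma mono_degree_eq_sum:
  "finite A \<Longrightarrow> keys m \<subseteq> A \<Longrightarrow> mono_degree m = (\<Sum>x\<in>A. lookup m x)"
  unfolding mono_degree_def by (intro sum.mono_neutral_left) (auto simp: in_keys_iff)

lemma mono_degree_add [simp]: "mono_degree (a + b) = mono_degree a + mono_degree b"
proof -
  let ?A = "keys a \<union> keys b"
  show ?thesis
    using mono_degree_eq_sum[of ?A a] mono_degree_eq_sum[of ?A b] mono_degree_eq_sum[of ?A "a + b"]
      Poly_Mapping.keys_add[of a b] by (simp add: lookup_add sum.distrib)
qed

lemma mono_degree_single [simp]: "mono_degree (Poly_Mapping.single v n) = n"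
  by (simp add: mono_degree_def)

lemma mono_degree_0 [simp]: "mono_degree 0 = 0"
  by (simp add: mono_degree_def)

lemma mono_degree_eq_0_iff: "mono_degree m = 0 \<longleftrightarrow> m = 0"
proof
  assume "mono_degree m = 0"
  then show "m = 0" by (intro poly_mapping_eqI) (auto simp: mono_degree_def in_keys_iff)
qed simp

definition sqfree_mono :: "'v set \<Rightarrow> 'v \<Rightarrow>\<^sub>0 nat" where
  "sqfree_mono F = (\<Sum>x\<in>F. Poly_Mapping.single x 1)"

lemma lookup_sqfree_mono [simp]:
  "finite F \<Longrightarrow> lookup (sqfree_mono F) x = (if x \<in> F then 1 else 0)"
  by (simp add: sqfree_mono_def lookup_sum lookup_single when_def)

lemma keys_sqfree_mono [simp]: "finite F \<Longrightarrow> keys (sqfree_mono F) = F"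
  by (auto simp: in_keys_iff split: if_splits)

lemma mono_degree_sqfree_mono [simp]: "finite F \<Longrightarrow> mono_degree (sqfree_mono F) = card F"
  by (simp add: mono_degree_def)

lemma sqfree_mono_insert:
  "finite F \<Longrightarrow> v \<notin> F \<Longrightarrow> sqfree_mono (insert v F) = Poly_Mapping.single v 1 + sqfree_mono F"
  by (simp add: sqfree_mono_def)

lemma minus_sqfree_mono_eq_iff:
  assumes "finite F" "F \<subseteq> keys m"
  shows "m - sqfree_mono F = p \<longleftrightarrow> m = p + sqfree_mono F"
proof -
  have "m - sqfree_mono F + sqfree_mono F = m"
  proof (rule poly_mapping_eqI)
    fix x show "lookup (m - sqfree_mono F + sqfree_mono F) x = lookup m x"
      using assms by (cases "x \<in> F") (auto simp: lookup_add lookup_minus in_keys_iff subset_iff)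
  qed
  then show ?thesis by auto
qed

lemma keys_add_sqfree_mono:
  fixes p :: "'v \<Rightarrow>\<^sub>0 nat"
  shows "finite F \<Longrightarrow> keys (p + sqfree_mono F) = keys p \<union> F"
  by (auto simp: in_keys_iff lookup_add split: if_splits)

lemma keys_minus_sqfree_mono_subset:
  fixes m :: "'v \<Rightarrow>\<^sub>0 nat"
  shows "finite F \<Longrightarrow> keys (m - sqfree_mono F) \<subseteq> keys m"
  by (auto simp: in_keys_iff lookup_minus)

text \<open>The piece of multidegree \<open>m\<close> of a Koszul chain: the exterior generator of
  \<open>F\<close> has the degree of the square-free monomial on \<open>F\<close>, and the
  coefficient supplies the rest. The guard keeps truncated differences out.\<close>

definition strand :: "(nat \<Rightarrow>\<^sub>0 nat) \<Rightarrow> (nat set \<Rightarrow> (nat, 'k::field) mpoly) \<Rightarrow> nat set \<Rightarrow> 'k" where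
  "strand m c F = (if F \<subseteq> keys m
     then lookup (c F) (m - sqfree_mono F) else 0)"

abbreviation poly_koszul ::
    "nat set \<Rightarrow> (nat set \<Rightarrow> (nat, 'k::field) mpoly) \<Rightarrow> nat set \<Rightarrow> (nat, 'k) mpoly" where
  "poly_koszul V \<equiv> koszul V (\<lambda>v p. indet v * p)"

lemma lookup_signed: "lookup (signed v F p) m = signed v F (lookup p m)"
  by (simp add: signed_def)

text \<open>Multiplication by x_v shifts exponents by v, which is just what \<open>F\<close> gains
  in \<open>insert v F\<close>. So in each multidegree the Koszul differential is a simplicial
  boundary on the support; a \<open>v\<close> outside \<open>keys m\<close> contributes
  nothing.\<close>

lemma strand_koszul:
  assumes "finite V" "keys m \<subseteq> V"
  shows "strand m (poly_koszul V c) F = bdry (keys m) (strand m c) F"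
proof (cases "F \<subseteq> keys m")
  case False
  then show ?thesis by (auto simp: strand_def koszul_def intro!: sum.neutral)
next
  case True
  then have fin: "finite F" using finite_subset[OF _ finite_keys] by blast
  have "strand m (poly_koszul V c) F
      = (\<Sum>v\<in>V - F. signed v F (lookup (indet v * c (insert v F)) (m - sqfree_mono F)))"
    using True by (simp add: strand_def koszul_def lookup_sum lookup_signed)
  also have "\<dots> = (\<Sum>v\<in>keys m - F. signed v F (strand m c (insert v F)))"
  proof (rule sum.mono_neutral_cong_right)
    show "\<forall>v\<in>V - F - (keys m - F).
        signed v F (lookup (indet v * c (insert v F)) (m - sqfree_mono F)) = 0"
      using keys_minus_sqfree_mono_subset[OF fin, of m] by (auto simp: lookup_indet_mult)
    fix v assume v: "v \<in> keys m - F"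
    then have "v \<in> keys (m - sqfree_mono F)"
      using fin by (simp add: in_keys_iff lookup_minus)
    moreover have "m - sqfree_mono F - Poly_Mapping.single v 1 = m - sqfree_mono (insert v F)"
      using v fin by (simp add: sqfree_mono_insert diff_diff_eq add.commute)
    ultimately show "signed v F (lookup (indet v * c (insert v F)) (m - sqfree_mono F))
        = signed v F (strand m c (insert v F))"
      using True v by (simp add: strand_def lookup_indet_mult)
  qed (use assms in auto)
  finally show ?thesis by (simp add: koszul_def)
qed

text \<open>If \<open>Q\<close> is membership in a monomial ideal, this is its upper Koszul
  simplicial complex in degree \<open>m\<close>.\<close>

definition mono_complex :: "((nat \<Rightarrow>\<^sub>0 nat) \<Rightarrow> bool) \<Rightarrow> (nat \<Rightarrow>\<^sub>0 nat) \<Rightarrow> nat set set" where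
  "mono_complex Q m = {F. F \<subseteq> keys m \<and> Q (m - sqfree_mono F)}"

definition mono_chain ::
    "nat set \<Rightarrow> ((nat \<Rightarrow>\<^sub>0 nat) \<Rightarrow> bool) \<Rightarrow> nat \<Rightarrow> (nat set \<Rightarrow> (nat, 'k::field) mpoly) \<Rightarrow> bool" where
  "mono_chain V Q i c \<longleftrightarrow> (\<forall>F. (c F \<noteq> 0 \<longrightarrow> F \<subseteq> V \<and> card F = i) \<and>
     c F \<in> carrier (poly_ring V) \<and> (\<forall>p\<in>keys (c F). Q p))"

lemma mono_chainD:
  assumes "mono_chain V Q i c"
  shows "c F \<noteq> 0 \<Longrightarrow> F \<subseteq> V" "c F \<noteq> 0 \<Longrightarrow> card F = i" "c F \<in> carrier (poly_ring V)"
    "p \<in> keys (c F) \<Longrightarrow> Q p" "p \<in> keys (c F) \<Longrightarrow> keys p \<subseteq> V"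
  using assms by (auto simp: mono_chain_def poly_ring_simps)

lemma simplicial_chain_strand:
  assumes "mono_chain V Q i c"
  shows "simplicial_chain (mono_complex Q m) i (strand m c)"
proof (rule simplicial_chainI)
  fix F assume "strand m c F \<noteq> 0"
  then have *: "F \<subseteq> keys m" "m - sqfree_mono F \<in> keys (c F)"
    by (auto simp: strand_def in_keys_iff split: if_splits)
  then have "c F \<noteq> 0" by auto
  then show "F \<in> mono_complex Q m \<and> card F = i"
    using * mono_chainD[OF assms] by (auto simp: mono_complex_def)
qed

lemma koszul_in_poly_ring:
  assumes "\<And>F. c F \<in> carrier (poly_ring V)"
  shows "poly_koszul V c F \<in> carrier (poly_ring V)"
  unfolding koszul_def using assms
  by (intro poly_ring_sum poly_ring_signed poly_ring_mult_closed poly_ring_indet) auto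

lemma strand_eqI:
  assumes V: "finite V" "F \<subseteq> V" and P: "c F \<in> carrier (poly_ring V)" "d F \<in> carrier (poly_ring V)"
    and eq: "\<And>m. keys m \<subseteq> V \<Longrightarrow> strand m c F = strand m d F"
  shows "c F = d F"
proof (rule poly_mapping_eqI)
  fix p
  have fin: "finite F" using V finite_subset by blast
  show "lookup (c F) p = lookup (d F) p"
  proof (cases "keys p \<subseteq> V")
    case True
    let ?m = "p + sqfree_mono F"
    have "keys ?m \<subseteq> V" "F \<subseteq> keys ?m"
      using True V(2) fin by (auto simp: keys_add_sqfree_mono)
    then show ?thesis using eq[of ?m] by (simp add: strand_def)
  next
    case False
    then show ?thesis using P by (metis in_keys_iff poly_ring_simps(1))
  qed
qed

text \<open>Only the finitely many multidegrees in \<open>Ms\<close> occur in \<open>c\<close>.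
  Bounding chains are chosen there, each value \<open>g m F\<close> is placed at the monomial
  \<open>m - sqfree_mono F\<close>, and the results are added; in all other multidegrees the sum has
  zero strand.\<close>

lemma koszul_boundary_of_strands:
  fixes c :: "nat set \<Rightarrow> (nat, 'k::field) mpoly"
  assumes V: "finite V" and c: "mono_chain V Q i c"
    and ex: "\<And>m. keys m \<subseteq> V \<Longrightarrow>
      \<exists>g. simplicial_chain (mono_complex Q m) (Suc i) g \<and>
        (\<forall>F. bdry (keys m) g F = strand m c F)"
  shows "\<exists>u. mono_chain V Q (Suc i) u \<and> poly_koszul V u = c"
proof -
  from ex obtain g where g: "\<And>m. keys m \<subseteq> V \<Longrightarrow> simplicial_chain (mono_complex Q m) (Suc i) (g m)"
    "\<And>m F. keys m \<subseteq> V \<Longrightarrow> bdry (keys m) (g m) F = strand m c F"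
    by metis
  define Ms where "Ms = (\<Union>F\<in>Pow V. (\<lambda>p. p + sqfree_mono F) ` keys (c F))"
  have finMs: "finite Ms" using V by (simp add: Ms_def)
  have MsV: "keys m \<subseteq> V" if m: "m \<in> Ms" for m
  proof -
    from m obtain F p where F: "F \<subseteq> V" and "p \<in> keys (c F)" and m: "m = p + sqfree_mono F"
      by (auto simp: Ms_def)
    then have "keys p \<subseteq> V" using mono_chainD(5)[OF c] by blast
    then show ?thesis using F V unfolding m by (simp add: keys_add_sqfree_mono finite_subset)
  qed
  define u where "u F = (\<Sum>m\<in>{m\<in>Ms. F \<subseteq> keys m}.
     Poly_Mapping.single (m - sqfree_mono F) (g m F))" for F
  have u: "lookup (u F) p =
      (if p + sqfree_mono F \<in> Ms then g (p + sqfree_mono F) F else 0)" if fin: "finite F" for F p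
  proof -
    have iff: "F \<subseteq> keys m \<and> m - sqfree_mono F = p \<longleftrightarrow> m = p + sqfree_mono F" for m
      using minus_sqfree_mono_eq_iff[OF fin, of m p] keys_add_sqfree_mono[OF fin, of p] by auto
    have "lookup (u F) p
        = (\<Sum>m\<in>{m\<in>Ms. F \<subseteq> keys m}. if m - sqfree_mono F = p then g m F else 0)"
      by (simp add: u_def lookup_sum lookup_single when_def)
    also have "\<dots> = (\<Sum>m\<in>Ms. if F \<subseteq> keys m then
        if m - sqfree_mono F = p then g m F else 0 else 0)"
      by (rule sum.inter_filter[OF finMs])
    also have "\<dots> = (\<Sum>m\<in>Ms. if m = p + sqfree_mono F then g m F else 0)"
      using iff by (intro sum.cong refl) (simp flip: iff)
    finally show ?thesis using finMs by simp
  qed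
  have u0: "u F = 0" if "infinite F" for F
  proof -
    have none: "{m\<in>Ms. F \<subseteq> keys m} = {}"
      using that finite_subset[OF _ finite_keys] by blast
    show ?thesis unfolding u_def none by simp
  qed
  have key: "p + sqfree_mono F \<in> Ms \<and> g (p + sqfree_mono F) F \<noteq> 0 \<and> finite F"
    if "p \<in> keys (u F)" for p F
    using that u[of F p] u0[of F] by (cases "finite F") (auto simp: in_keys_iff split: if_splits)
  have uch: "mono_chain V Q (Suc i) u"
    unfolding mono_chain_def
  proof (intro allI conjI impI ballI)
    fix F
    have *: "keys p \<subseteq> V \<and> Q p \<and> F \<subseteq> V \<and> card F = Suc i"
      if "p \<in> keys (u F)" for p
    proof -
      let ?m = "p + sqfree_mono F"
      have m: "?m \<in> Ms" "g ?m F \<noteq> 0" "finite F" using key[OF that] by auto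
      have kV: "keys ?m \<subseteq> V" using MsV[OF m(1)] .
      have "F \<in> mono_complex Q ?m" "card F = Suc i"
        using simplicial_chainD[OF g(1)[OF kV] m(2)] by auto
      then show ?thesis using kV m(3) by (auto simp: mono_complex_def keys_add_sqfree_mono)
    qed
    show "u F \<in> carrier (poly_ring V)" using * by (auto simp: poly_ring_simps)
    show "Q p" if "p \<in> keys (u F)" for p using *[OF that] by blast
    assume "u F \<noteq> 0"
    then obtain p where "p \<in> keys (u F)" by (metis all_not_in_conv keys_eq_empty)
    then show "F \<subseteq> V" "card F = Suc i" using * by blast+
  qed
  have strand_u: "strand m u = (if m \<in> Ms then g m else 0)" if kV: "keys m \<subseteq> V" for m
  proof
    fix F
    show "strand m u F = (if m \<in> Ms then g m else 0) F"
    proof (cases "F \<subseteq> keys m")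
      case True
      then have fin: "finite F" using finite_subset[OF _ finite_keys] by blast
      then have "m - sqfree_mono F + sqfree_mono F = m"
        using minus_sqfree_mono_eq_iff[OF fin True, of "m - sqfree_mono F"] by simp
      then show ?thesis using True u[OF fin, of "m - sqfree_mono F"] by (simp add: strand_def)
    next
      case False
      then have "g m F = 0" using g(1)[OF kV] by (auto simp: simplicial_chain_def mono_complex_def)
      then show ?thesis using False by (simp add: strand_def)
    qed
  qed
  have strand_c: "strand m c F = 0" if "m \<notin> Ms" for m F
  proof (rule ccontr)
    assume "strand m c F \<noteq> 0"
    then have *: "F \<subseteq> keys m" "m - sqfree_mono F \<in> keys (c F)"
      by (auto simp: strand_def in_keys_iff split: if_splits)
    then have fin: "finite F" and "c F \<noteq> 0" using finite_subset[OF *(1) finite_keys] by auto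
    then have "F \<subseteq> V" using mono_chainD(1)[OF c] by blast
    moreover have "m = (m - sqfree_mono F) + sqfree_mono F"
      using minus_sqfree_mono_eq_iff[OF fin *(1)] by blast
    ultimately have "m \<in> Ms" using *(2) unfolding Ms_def by blast
    then show False using that by contradiction
  qed
  have eq: "strand m (poly_koszul V u) F = strand m c F" if kV: "keys m \<subseteq> V" for m F
  proof (cases "m \<in> Ms")
    case True
    then show ?thesis using strand_koszul[OF V kV, of u F] strand_u[OF kV] g(2)[OF kV] by simp
  next
    case False
    then show ?thesis using strand_koszul[OF V kV, of u F] strand_u[OF kV] strand_c
      by (simp add: koszul_def)
  qed
  have "poly_koszul V u F = c F" for F
  proof (cases "F \<subseteq> V")
    case False
    then have "c F = 0" "\<And>v. u (insert v F) = 0" using mono_chainD(1)[OF c] mono_chainD(1)[OF uch] by blast+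
    then show ?thesis by (simp add: koszul_def)
  next
    case True
    then show ?thesis
      using strand_eqI[OF V True, of "poly_koszul V u" c] eq koszul_in_poly_ring[of u]
        mono_chainD(3)[OF uch] mono_chainD(3)[OF c] by blast
  qed
  then show ?thesis using uch by blast
qed

text \<open>In a multidegree \<open>m\<close> other than 0 the complex is the full simplex on a
  nonempty support, hence a cone. In multidegree 0 only the constant term at the empty face could
  survive, and \<open>const\<close> excludes it.\<close>

lemma koszul_exact_poly_ring:
  fixes c :: "nat set \<Rightarrow> (nat, 'k::field) mpoly"
  assumes V: "finite V" and c: "mono_chain V (\<lambda>_. True) i c" and cyc: "\<And>F. poly_koszul V c F = 0"
    and const: "lookup (c {}) 0 = 0"
  shows "\<exists>u. mono_chain V (\<lambda>_. True) (Suc i) u \<and> poly_koszul V u = c"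
proof (rule koszul_boundary_of_strands[OF V c])
  fix m :: "nat \<Rightarrow>\<^sub>0 nat" assume mV: "keys m \<subseteq> V"
  let ?G = "mono_complex (\<lambda>_. True) m"
  have G: "simplicial_complex (keys m) ?G"
    by (auto simp: simplicial_complex_def mono_complex_def)
  have st: "simplicial_chain ?G i (strand m c)" by (rule simplicial_chain_strand[OF c])
  have b: "\<forall>F. bdry (keys m) (strand m c) F = 0"
    by (simp add: strand_koszul[OF V mV, of c, symmetric] strand_def[of m "poly_koszul V c"] cyc)
  show "\<exists>g. simplicial_chain ?G (Suc i) g \<and> (\<forall>F. bdry (keys m) g F = strand m c F)"
  proof (cases "m = 0")
    case True
    then have "strand m c F = 0" for F
      using const by (auto simp: strand_def sqfree_mono_def)
    then show ?thesis by (intro exI[of _ 0]) (simp add: koszul_def)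
  next
    case False
    then obtain v where v: "v \<in> keys m" by (metis all_not_in_conv keys_eq_empty)
    have "acyclic_at TYPE('k) (keys m) ?G i"
      using v by (intro acyclic_cone[OF G v]) (auto simp: mono_complex_def)
    then show ?thesis using st b unfolding acyclic_at_def by blast
  qed
qed

section \<open>Graded submodules of free modules\<close>

definition filter_poly :: "(('v \<Rightarrow>\<^sub>0 nat) \<Rightarrow> bool) \<Rightarrow> ('v, 'k::field) mpoly \<Rightarrow> ('v, 'k) mpoly" where
  "filter_poly Q p = Poly_Mapping.mapp (\<lambda>m a. if Q m then a else 0) p"

lemma lookup_filter_poly [simp]:
  "lookup (filter_poly Q p) m = (if Q m then lookup p m else 0)"
  by (simp add: filter_poly_def lookup_mapp when_def in_keys_iff)

lemma keys_filter_poly: "keys (filter_poly Q p) = {m \<in> keys p. Q m}"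
  by (auto simp: in_keys_iff split: if_splits)

lemma filter_poly_0 [simp]: "filter_poly Q 0 = 0"
  and filter_poly_add: "filter_poly Q (p + q) = filter_poly Q p + filter_poly Q q"
  by (auto intro!: poly_mapping_eqI simp: lookup_add)

lemma filter_poly_sum: "filter_poly Q (sum f A) = (\<Sum>x\<in>A. filter_poly Q (f x))"
  by (induction A rule: infinite_finite_induct) (simp_all add: filter_poly_add)

lemma filter_poly_eq_self: "(\<And>m. m \<in> keys p \<Longrightarrow> Q m) \<Longrightarrow> filter_poly Q p = p"
  by (intro poly_mapping_eqI) (auto simp: in_keys_iff)

lemma filter_poly_eq_0: "(\<And>m. m \<in> keys p \<Longrightarrow> \<not> Q m) \<Longrightarrow> filter_poly Q p = 0"
  by (intro poly_mapping_eqI) (auto simp: in_keys_iff)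

text \<open>Applied to homogeneous \<open>q\<close>, where the condition on a product depends on the
  other factor alone; graded parts of products then become products with graded parts.\<close>

lemma filter_poly_mult:
  assumes "\<And>x y. x \<in> keys q \<Longrightarrow> Q (x + y) \<longleftrightarrow> R y"
  shows "filter_poly Q (q * p) = q * filter_poly R p"
proof -
  have p: "p = filter_poly R p + filter_poly (\<lambda>y. \<not> R y) p"
    by (intro poly_mapping_eqI) (simp add: lookup_add)
  have "filter_poly Q (q * filter_poly R p) = q * filter_poly R p"
  proof (rule filter_poly_eq_self)
    fix m assume "m \<in> keys (q * filter_poly R p)"
    then obtain x y where "m = x + y" "x \<in> keys q" "y \<in> keys (filter_poly R p)"
      using Poly_Mapping.keys_mult by blast
    then show "Q m" using assms by (simp add: keys_filter_poly)
  qed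
  moreover have "filter_poly Q (q * filter_poly (\<lambda>y. \<not> R y) p) = 0"
  proof (rule filter_poly_eq_0)
    fix m assume "m \<in> keys (q * filter_poly (\<lambda>y. \<not> R y) p)"
    then obtain x y where "m = x + y" "x \<in> keys q"
      "y \<in> keys (filter_poly (\<lambda>y. \<not> R y) p)"
      using Poly_Mapping.keys_mult by blast
    then show "\<not> Q m" using assms by (simp add: keys_filter_poly)
  qed
  ultimately show ?thesis
    by (subst p) (simp add: distrib_left filter_poly_add)
qed

lemma filter_poly_in_poly_ring:
  "p \<in> carrier (poly_ring V) \<Longrightarrow> filter_poly Q p \<in> carrier (poly_ring V)"
  by (auto simp: poly_ring_simps keys_filter_poly)

text \<open>Vectors of every rank share one type, and the rank appears only as vanishing beyond it
  in \<open>free_vecs\<close>; sums and maps need no dimension conditions.\<close>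

type_synonym 'k polyvec = "nat \<Rightarrow> (nat, 'k) mpoly"

lemma sum_fun_apply: "sum f A x = (\<Sum>i\<in>A. f i x)"
  by (induction A rule: infinite_finite_induct) simp_all

definition scale :: "(nat, 'k::field) mpoly \<Rightarrow> 'k polyvec \<Rightarrow> 'k polyvec" where
  "scale p v a = p * v a"

lemma scale_add_right: "scale p (v + w) = scale p v + scale p w"
  and scale_commute: "scale p (scale q v) = scale q (scale p v)"
  and scale_0_right [simp]: "scale p 0 = 0"
  and scale_1_left [simp]: "scale 1 v = v"
  and scale_minus_left: "scale (- p) v = - scale p v"
  and scale_scale: "scale p (scale q v) = scale (p * q) v"
  by (auto simp: scale_def fun_eq_iff algebra_simps)

definition free_vecs :: "nat set \<Rightarrow> nat \<Rightarrow> 'k::field polyvec set" where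
  "free_vecs V r = {v. (\<forall>a. v a \<in> carrier (poly_ring V)) \<and> (\<forall>a\<ge>r. v a = 0)}"

text \<open>The part of degree \<open>j - n\<close> of an element of \<open>\<Oplus>\<^sub>a R(-s\<^sub>a)\<close>; the offset \<open>n\<close> will be
  the degree of the exterior part of a Koszul chain.\<close>

definition degree_part :: "nat list \<Rightarrow> nat \<Rightarrow> nat \<Rightarrow> 'k::field polyvec \<Rightarrow> 'k polyvec" where
  "degree_part s n j v a = filter_poly (\<lambda>m. mono_degree m + s ! a + n = j) (v a)"

definition homogeneous :: "nat list \<Rightarrow> nat \<Rightarrow> nat \<Rightarrow> 'k::field polyvec \<Rightarrow> bool" where
  "homogeneous s n j v \<longleftrightarrow> (\<forall>a. \<forall>m\<in>keys (v a). mono_degree m + s ! a + n = j)"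

lemma degree_part_homogeneous: "homogeneous s n j v \<Longrightarrow> degree_part s n j v = v"
  by (auto simp: homogeneous_def degree_part_def fun_eq_iff intro: filter_poly_eq_self)

lemma homogeneous_degree_part: "homogeneous s n j (degree_part s n j v)"
  by (auto simp: homogeneous_def degree_part_def keys_filter_poly)

lemma homogeneous_0 [simp]: "homogeneous s n j 0"
  by (simp add: homogeneous_def)

lemma degree_part_0 [simp]: "degree_part s n j 0 = 0"
  and degree_part_add: "degree_part s n j (v + w) = degree_part s n j v + degree_part s n j w"
  by (simp_all add: degree_part_def fun_eq_iff filter_poly_add)

lemma degree_part_scale_indet:
  "degree_part s n j (scale (indet x) v) = scale (indet x) (degree_part s (Suc n) j v)"
  unfolding degree_part_def scale_def fun_eq_iff
  by (intro allI filter_poly_mult) (simp add: indet_def monomial_def)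

definition poly_submodule :: "nat set \<Rightarrow> 'k::field polyvec set \<Rightarrow> bool" where
  "poly_submodule V N \<longleftrightarrow> 0 \<in> N \<and> (\<forall>v\<in>N. \<forall>w\<in>N. v + w \<in> N) \<and>
     (\<forall>p\<in>carrier (poly_ring V). \<forall>v\<in>N. scale p v \<in> N)"

definition graded_submodule :: "nat set \<Rightarrow> nat list \<Rightarrow> 'k::field polyvec set \<Rightarrow> bool" where
  "graded_submodule V s N \<longleftrightarrow> N \<subseteq> free_vecs V (length s) \<and> poly_submodule V N \<and>
     (\<forall>n j. \<forall>v\<in>N. degree_part s n j v \<in> N)"

lemma poly_submoduleD:
  assumes "poly_submodule V N"
  shows "0 \<in> N" "v \<in> N \<Longrightarrow> w \<in> N \<Longrightarrow> v + w \<in> N"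
    "p \<in> carrier (poly_ring V) \<Longrightarrow> v \<in> N \<Longrightarrow> scale p v \<in> N"
    "v \<in> N \<Longrightarrow> - v \<in> N" "v \<in> N \<Longrightarrow> w \<in> N \<Longrightarrow> v - w \<in> N"
proof -
  show 1: "0 \<in> N" "v \<in> N \<Longrightarrow> w \<in> N \<Longrightarrow> v + w \<in> N"
    "p \<in> carrier (poly_ring V) \<Longrightarrow> v \<in> N \<Longrightarrow> scale p v \<in> N" for v w p
    using assms by (auto simp: poly_submodule_def)
  show 2: "v \<in> N \<Longrightarrow> - v \<in> N" for v
    using 1(3)[of "- 1" v] poly_ring_uminus[OF poly_ring_one, of V] by (simp add: scale_minus_left)
  show "v \<in> N \<Longrightarrow> w \<in> N \<Longrightarrow> v - w \<in> N" using 1(2)[OF _ 2, of v w] by simp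
qed

lemma poly_submodule_sum:
  assumes "poly_submodule V N" "\<And>x. x \<in> A \<Longrightarrow> f x \<in> N"
  shows "sum f A \<in> N"
  using assms(2)
  by (induction A rule: infinite_finite_induct) (auto intro: poly_submoduleD[OF assms(1)])

lemma graded_submoduleD:
  assumes "graded_submodule V s N"
  shows "N \<subseteq> free_vecs V (length s)" "poly_submodule V N" "v \<in> N \<Longrightarrow> degree_part s n j v \<in> N"
  using assms by (auto simp: graded_submodule_def)

lemma graded_submodule_free: "graded_submodule V s (free_vecs V (length s))"
  by (auto simp: graded_submodule_def poly_submodule_def free_vecs_def degree_part_def scale_def
      poly_ring_add_closed poly_ring_mult_closed filter_poly_in_poly_ring)

abbreviation vec_koszul ::
    "nat set \<Rightarrow> (nat set \<Rightarrow> 'k::field polyvec) \<Rightarrow> nat set \<Rightarrow> 'k polyvec" where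
  "vec_koszul V \<equiv> koszul V (\<lambda>x. scale (indet x))"

definition koszul_chain ::
    "nat set \<Rightarrow> 'k::field polyvec set \<Rightarrow> nat \<Rightarrow> (nat set \<Rightarrow> 'k polyvec) \<Rightarrow> bool" where
  "koszul_chain V N i c \<longleftrightarrow> (\<forall>F. c F \<in> N \<and> (c F \<noteq> 0 \<longrightarrow> F \<subseteq> V \<and> card F = i))"

definition homogeneous_chain :: "nat list \<Rightarrow> nat \<Rightarrow> (nat set \<Rightarrow> 'k::field polyvec) \<Rightarrow> bool" where
  "homogeneous_chain s j c \<longleftrightarrow> (\<forall>F. homogeneous s (card F) j (c F))"

lemma homogeneous_chainD:
  assumes "homogeneous_chain s j c" "m \<in> keys (c F a)"
  shows "mono_degree m + s ! a + card F = j"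
  using assms by (simp add: homogeneous_chain_def homogeneous_def)

text \<open>Vanishing of the Koszul homology \<open>H\<^sub>i(x; N)\<^sub>j = Tor\<^sub>i(N, K)\<^sub>j\<close>.\<close>

definition koszul_acyclic ::
    "nat set \<Rightarrow> nat list \<Rightarrow> 'k::field polyvec set \<Rightarrow> nat \<Rightarrow> nat \<Rightarrow> bool" where
  "koszul_acyclic V s N i j \<longleftrightarrow>
     (\<forall>c. koszul_chain V N i c \<longrightarrow> homogeneous_chain s j c \<longrightarrow> vec_koszul V c = 0 \<longrightarrow>
        (\<exists>u. koszul_chain V N (Suc i) u \<and> vec_koszul V u = c))"

lemma koszul_chainD:
  assumes "koszul_chain V N i c"
  shows "c F \<in> N" "c F \<noteq> 0 \<Longrightarrow> F \<subseteq> V" "c F \<noteq> 0 \<Longrightarrow> card F = i"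
  using assms by (auto simp: koszul_chain_def)

lemma koszul_apply: "vec_koszul V c F a = poly_koszul V (\<lambda>F. c F a) F"
  using koszul_hom[of "\<lambda>u. u a" "\<lambda>x. scale (indet x)" "\<lambda>v p. indet v * p"] by (simp add: scale_def)

lemma vec_koszul_vec_koszul:
  assumes V: "finite V" and c: "koszul_chain V N i c"
  shows "vec_koszul V (vec_koszul V c) = 0"
proof
  fix F
  show "vec_koszul V (vec_koszul V c) F = 0 F"
  proof (cases "finite F")
    case True
    then show ?thesis using koszul_koszul[of V F "\<lambda>x. scale (indet x)" c] V
      by (simp add: scale_add_right scale_commute)
  next
    case False
    then have "c (insert x (insert y F)) = 0" for x y
      using koszul_chainD(2)[OF c, of "insert x (insert y F)"] finite_subset[OF _ V] by auto
    then show ?thesis by (simp add: koszul_def)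
  qed
qed

lemma koszul_chain_vec_koszul:
  assumes V: "finite V" and N: "poly_submodule V N" and c: "koszul_chain V N (Suc i) c"
  shows "koszul_chain V N i (vec_koszul V c)"
  unfolding koszul_chain_def
proof (intro allI conjI impI)
  fix F
  show "vec_koszul V c F \<in> N"
    unfolding koszul_def
  proof (rule poly_submodule_sum[OF N])
    fix x assume "x \<in> V - F"
    then have "scale (indet x) (c (insert x F)) \<in> N"
      using poly_submoduleD(3)[OF N poly_ring_indet] koszul_chainD(1)[OF c] by blast
    then show "signed x F (scale (indet x) (c (insert x F))) \<in> N"
      using poly_submoduleD(4)[OF N] by (simp add: signed_def)
  qed
  assume "vec_koszul V c F \<noteq> 0"
  then obtain x where x: "x \<in> V - F" "c (insert x F) \<noteq> 0"
    unfolding koszul_def by (metis (no_types, lifting) scale_0_right signed_0 sum.neutral)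
  then have *: "insert x F \<subseteq> V" "card (insert x F) = Suc i"
    using koszul_chainD(2,3)[OF c] by blast+
  then show "F \<subseteq> V" by blast
  have "finite F" using *(1) finite_subset[OF _ V] by blast
  then show "card F = i" using *(2) x(1) by simp
qed

lemma homogeneous_vec_koszul:
  assumes V: "finite V" and c: "koszul_chain V N i c" and h: "homogeneous_chain s j c"
  shows "homogeneous_chain s j (vec_koszul V c)"
  unfolding homogeneous_chain_def homogeneous_def
proof (intro allI ballI)
  fix F a m assume m: "m \<in> keys (vec_koszul V c F a)"
  have "vec_koszul V c F a = (\<Sum>x\<in>V - F. signed x F (indet x * c (insert x F) a))"
    by (simp add: koszul_apply) (simp add: koszul_def)
  then have "lookup (vec_koszul V c F a) m
      = (\<Sum>x\<in>V - F. signed x F (lookup (indet x * c (insert x F) a) m))"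
    by (simp add: lookup_sum lookup_signed)
  moreover have "lookup (vec_koszul V c F a) m \<noteq> 0" using m by (simp add: in_keys_iff)
  ultimately obtain x where x: "x \<in> V - F" "lookup (indet x * c (insert x F) a) m \<noteq> 0"
    by (metis (no_types, lifting) signed_0 sum.neutral)
  then have "m \<in> keys (indet x * c (insert x F) a)" by (simp add: in_keys_iff)
  then obtain y where y: "m = Poly_Mapping.single x 1 + y" "y \<in> keys (c (insert x F) a)"
    using Poly_Mapping.keys_mult[of "indet x" "c (insert x F) a"] by (auto simp: indet_def monomial_def)
  then have "c (insert x F) \<noteq> 0" by auto
  then have "finite F" using koszul_chainD(2)[OF c] finite_subset[OF _ V] by (meson finite_insert)
  moreover have "mono_degree y + s ! a + card (insert x F) = j"
    using homogeneous_chainD[OF h y(2)] .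
  ultimately show "mono_degree m + s ! a + card F = j"
    using y(1) x(1) by simp
qed

definition chain_degree_part ::
    "nat list \<Rightarrow> nat \<Rightarrow> (nat set \<Rightarrow> 'k::field polyvec) \<Rightarrow> nat set \<Rightarrow> 'k polyvec" where
  "chain_degree_part s j c F = degree_part s (card F) j (c F)"

lemma koszul_chain_degree_part:
  assumes "graded_submodule V s N" "koszul_chain V N i c"
  shows "koszul_chain V N i (chain_degree_part s j c)"
proof -
  have "c F = 0 \<Longrightarrow> chain_degree_part s j c F = 0" for F
    by (simp add: chain_degree_part_def)
  then show ?thesis
    using assms(2) graded_submoduleD(3)[OF assms(1)] unfolding koszul_chain_def
    by (metis chain_degree_part_def)
qed

lemma homogeneous_chain_degree_part: "homogeneous_chain s j (chain_degree_part s j c)"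
  by (simp add: homogeneous_chain_def chain_degree_part_def homogeneous_degree_part)

lemma chain_degree_part_homogeneous: "homogeneous_chain s j c \<Longrightarrow> chain_degree_part s j c = c"
  by (simp add: homogeneous_chain_def chain_degree_part_def degree_part_homogeneous fun_eq_iff)

lemma degree_part_sum: "degree_part s n j (sum f A) = (\<Sum>x\<in>A. degree_part s n j (f x))"
  by (simp add: fun_eq_iff degree_part_def sum_fun_apply filter_poly_sum)

lemma degree_part_signed: "degree_part s n j (signed x F v) = signed x F (degree_part s n j v)"
  using additive_signed[of "degree_part s n j", OF degree_part_add] .

text \<open>The bounding chain in \<open>koszul_acyclic\<close> need not be homogeneous; as the
  differential respects degrees, its part of degree \<open>j\<close> bounds as well.\<close>

lemma vec_koszul_degree_part:
  assumes V: "finite V" and c: "koszul_chain V N i c"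
  shows "vec_koszul V (chain_degree_part s j c) = chain_degree_part s j (vec_koszul V c)"
proof
  fix F
  have "scale (indet x) (chain_degree_part s j c (insert x F))
      = degree_part s (card F) j (scale (indet x) (c (insert x F)))" if "x \<in> V - F" for x
  proof (cases "finite F")
    case True
    then show ?thesis using that by (simp add: chain_degree_part_def degree_part_scale_indet)
  next
    case False
    then have "c (insert x F) = 0" using koszul_chainD(2)[OF c] finite_subset[OF _ V] by (meson finite_insert)
    then show ?thesis by (simp add: chain_degree_part_def)
  qed
  then show "vec_koszul V (chain_degree_part s j c) F = chain_degree_part s j (vec_koszul V c) F"
    by (simp add: koszul_def chain_degree_part_def[of s j "\<lambda>F. sum _ _"]
        chain_degree_part_def[of s j "koszul _ _ _"] degree_part_sum degree_part_signed)
qed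

text \<open>Exactness is applied to each coordinate; coordinates from \<open>r\<close> on are reset
  to zero.\<close>

lemma koszul_exact_free:
  fixes c :: "nat set \<Rightarrow> 'k::field polyvec"
  assumes V: "finite V" and c: "koszul_chain V (free_vecs V r) i c" and cyc: "vec_koszul V c = 0"
    and const: "\<And>a. lookup (c {} a) 0 = 0"
  shows "\<exists>u. koszul_chain V (free_vecs V r) (Suc i) u \<and> vec_koszul V u = c"
proof -
  have "\<exists>u. mono_chain V (\<lambda>_. True) (Suc i) u \<and> poly_koszul V u = (\<lambda>F. c F a)" for a
  proof (rule koszul_exact_poly_ring[OF V])
    show "mono_chain V (\<lambda>_. True) i (\<lambda>F. c F a)"
      using c unfolding koszul_chain_def mono_chain_def free_vecs_def by force
    show "poly_koszul V (\<lambda>F. c F a) F = 0" for F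
      using cyc koszul_apply[of V c F a] by simp
    show "lookup (c {} a) 0 = 0" by (rule const)
  qed
  then obtain u where u: "\<And>a. mono_chain V (\<lambda>_. True) (Suc i) (u a)"
    "\<And>a. poly_koszul V (u a) = (\<lambda>F. c F a)" by metis
  define w :: "nat set \<Rightarrow> 'k polyvec" where "w F a = (if a < r then u a F else 0)" for F a
  have "koszul_chain V (free_vecs V r) (Suc i) w"
    unfolding koszul_chain_def
  proof (intro allI conjI impI)
    fix F
    show "w F \<in> free_vecs V r" using mono_chainD(3)[OF u(1)] by (simp add: free_vecs_def w_def)
    assume "w F \<noteq> 0"
    then obtain a where "u a F \<noteq> 0" by (auto simp: w_def fun_eq_iff split: if_splits)
    then show "F \<subseteq> V" "card F = Suc i" using mono_chainD(1,2)[OF u(1)] by blast+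
  qed
  moreover have "vec_koszul V w = c"
  proof (intro ext)
    fix F a
    show "vec_koszul V w F a = c F a"
    proof (cases "a < r")
      case True
      then have "(\<lambda>F. w F a) = u a" by (simp add: w_def fun_eq_iff)
      then show ?thesis using u(2)[of a] by (simp add: koszul_apply)
    next
      case False
      then have "(\<lambda>F. w F a) = (\<lambda>_. 0)" by (simp add: w_def)
      moreover have "c F a = 0" using False koszul_chainD(1)[OF c, of F] by (simp add: free_vecs_def)
      ultimately show ?thesis by (simp add: koszul_apply) (simp add: koszul_def)
    qed
  qed
  ultimately show ?thesis by blast
qed

section \<open>Dimension shifting along syzygies\<close>

definition apply_matrix ::
    "nat \<Rightarrow> nat \<Rightarrow> (nat \<Rightarrow> nat \<Rightarrow> (nat, 'k::field) mpoly) \<Rightarrow> 'k polyvec \<Rightarrow> 'k polyvec" where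
  "apply_matrix r q M v a = (if a < r then \<Sum>b<q. M a b * v b else 0)"

definition graded_array ::
    "nat set \<Rightarrow> nat list \<Rightarrow> nat list \<Rightarrow> (nat \<Rightarrow> nat \<Rightarrow> (nat, 'k::field) mpoly) \<Rightarrow> bool" where
  "graded_array V s t M \<longleftrightarrow> (\<forall>a<length s. \<forall>b<length t. M a b \<in> carrier (poly_ring V) \<and>
     (\<forall>m\<in>keys (M a b). mono_degree m + s ! a = t ! b))"

lemma apply_matrix_add: "apply_matrix r q M (v + w) = apply_matrix r q M v + apply_matrix r q M w"
  by (simp add: apply_matrix_def fun_eq_iff distrib_left sum.distrib)

lemma apply_matrix_0 [simp]: "apply_matrix r q M 0 = 0"
  by (simp add: apply_matrix_def fun_eq_iff)

lemma apply_matrix_diff: "apply_matrix r q M (v - w) = apply_matrix r q M v - apply_matrix r q M w"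
  using apply_matrix_add[of r q M "v - w" w] by simp

lemma apply_matrix_scale: "apply_matrix r q M (scale p v) = scale p (apply_matrix r q M v)"
  by (simp add: apply_matrix_def scale_def fun_eq_iff sum_distrib_left mult.left_commute)

definition syzygies ::
    "nat set \<Rightarrow> nat \<Rightarrow> nat \<Rightarrow> (nat \<Rightarrow> nat \<Rightarrow> (nat, 'k::field) mpoly) \<Rightarrow> 'k polyvec set" where
  "syzygies V r q M = {v \<in> free_vecs V q. apply_matrix r q M v = 0}"

definition matrix_image ::
    "nat set \<Rightarrow> nat \<Rightarrow> nat \<Rightarrow> (nat \<Rightarrow> nat \<Rightarrow> (nat, 'k::field) mpoly) \<Rightarrow> 'k polyvec set" where
  "matrix_image V r q M = apply_matrix r q M ` free_vecs V q"

lemma apply_matrix_koszul: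
  "apply_matrix r q M (vec_koszul V c F) = vec_koszul V (\<lambda>F. apply_matrix r q M (c F)) F"
  using koszul_hom[of "apply_matrix r q M" "\<lambda>x. scale (indet x)" "\<lambda>x. scale (indet x)",
      OF apply_matrix_add apply_matrix_scale] .

lemma degree_part_apply_matrix:
  assumes "graded_array V s t M"
  shows "apply_matrix (length s) (length t) M (degree_part t n j v)
    = degree_part s n j (apply_matrix (length s) (length t) M v)"
proof
  fix a
  show "apply_matrix (length s) (length t) M (degree_part t n j v) a
    = degree_part s n j (apply_matrix (length s) (length t) M v) a"
  proof (cases "a < length s")
    case True
    have "M a b * degree_part t n j v b = filter_poly (\<lambda>m. mono_degree m + s ! a + n = j) (M a b * v b)"
      if "b < length t" for b
      unfolding degree_part_def
      using assms True that by (intro filter_poly_mult[symmetric]) (auto simp: graded_array_def)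
    then show ?thesis using True by (simp add: apply_matrix_def degree_part_def[of s] filter_poly_sum)
  qed (simp add: apply_matrix_def degree_part_def)
qed

lemma apply_matrix_in_free:
  assumes "graded_array V s t M" "v \<in> free_vecs V (length t)"
  shows "apply_matrix (length s) (length t) M v \<in> free_vecs V (length s)"
  using assms unfolding graded_array_def free_vecs_def apply_matrix_def
  by (auto intro!: poly_ring_sum poly_ring_mult_closed)

lemma graded_submodule_image:
  fixes M :: "nat \<Rightarrow> nat \<Rightarrow> (nat, 'k::field) mpoly"
  assumes "graded_array V s t M"
  shows "graded_submodule V s (matrix_image V (length s) (length t) M)"
proof -
  note F = graded_submodule_free[of V t, where ?'a = 'k]
  note P = poly_submoduleD[OF graded_submoduleD(2)[OF F]]
  let ?A = "apply_matrix (length s) (length t) M"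
  show ?thesis
    unfolding graded_submodule_def poly_submodule_def matrix_image_def
  proof (intro conjI ballI allI)
    show "?A ` free_vecs V (length t) \<subseteq> free_vecs V (length s)"
      using apply_matrix_in_free[OF assms] by blast
    show "0 \<in> ?A ` free_vecs V (length t)" using P(1) by (intro image_eqI[of _ _ 0]) simp_all
    fix v assume "v \<in> ?A ` free_vecs V (length t)"
    then obtain v' where v: "v = ?A v'" "v' \<in> free_vecs V (length t)" by blast
    show "degree_part s n j v \<in> ?A ` free_vecs V (length t)" for n j
      using v graded_submoduleD(3)[OF F, of v' n j] by (metis degree_part_apply_matrix[OF assms] imageI)
    show "scale p v \<in> ?A ` free_vecs V (length t)" if "p \<in> carrier (poly_ring V)" for p
      using v P(3)[OF that, of v'] by (metis apply_matrix_scale imageI)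
    fix w assume "w \<in> ?A ` free_vecs V (length t)"
    then obtain w' where "w = ?A w'" "w' \<in> free_vecs V (length t)" by blast
    then show "v + w \<in> ?A ` free_vecs V (length t)" using v P(2)[of v' w'] by (metis apply_matrix_add imageI)
  qed
qed

lemma graded_submodule_syzygies:
  fixes M :: "nat \<Rightarrow> nat \<Rightarrow> (nat, 'k::field) mpoly"
  assumes "graded_array V s t M"
  shows "graded_submodule V t (syzygies V (length s) (length t) M)"
proof -
  note F = graded_submodule_free[of V t, where ?'a = 'k]
  note P = poly_submoduleD[OF graded_submoduleD(2)[OF F]]
  show ?thesis
    unfolding graded_submodule_def poly_submodule_def syzygies_def
  proof (intro conjI ballI allI)
    let ?A = "apply_matrix (length s) (length t) M"
    let ?Z = "{v \<in> free_vecs V (length t). ?A v = 0}"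
    show "?Z \<subseteq> free_vecs V (length t)" by blast
    show "0 \<in> ?Z" using P(1) by simp
    fix v assume v: "v \<in> ?Z"
    show "degree_part t n j v \<in> ?Z" for n j
      using v graded_submoduleD(3)[OF F, of v n j] by (simp add: degree_part_apply_matrix[OF assms])
    show "scale p v \<in> ?Z" if "p \<in> carrier (poly_ring V)" for p
      using v P(3)[OF that, of v] by (simp add: apply_matrix_scale)
    fix w assume "w \<in> ?Z"
    then show "v + w \<in> ?Z" using v P(2)[of v w] by (simp add: apply_matrix_add)
  qed
qed

text \<open>Lifts are chosen face by face, and zero is lifted to zero so that the support of the
  chain does not grow.\<close>

lemma lift_chain:
  assumes M: "graded_array V s t M"
    and c: "koszul_chain V (matrix_image V (length s) (length t) M) i c"
  shows "\<exists>w. koszul_chain V (free_vecs V (length t)) i w \<and>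
    (\<forall>F. apply_matrix (length s) (length t) M (w F) = c F)"
proof -
  have "\<exists>v. v \<in> free_vecs V (length t) \<and> apply_matrix (length s) (length t) M v = c F \<and>
      (c F = 0 \<longrightarrow> v = 0)" for F
  proof (cases "c F = 0")
    case True
    then show ?thesis by (intro exI[of _ 0]) (simp add: free_vecs_def)
  next
    case False
    have "c F \<in> apply_matrix (length s) (length t) M ` free_vecs V (length t)"
      using koszul_chainD(1)[OF c, of F] by (simp add: matrix_image_def)
    then obtain v where "v \<in> free_vecs V (length t)" "c F = apply_matrix (length s) (length t) M v"
      by (rule imageE)
    then show ?thesis using False by auto
  qed
  then obtain w where "\<And>F. w F \<in> free_vecs V (length t)"
    "\<And>F. apply_matrix (length s) (length t) M (w F) = c F" "\<And>F. c F = 0 \<Longrightarrow> w F = 0" by metis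
  then show ?thesis using koszul_chainD[OF c] unfolding koszul_chain_def by blast
qed

lemma lift_homogeneous_chain:
  assumes M: "graded_array V s t M"
    and c: "koszul_chain V (matrix_image V (length s) (length t) M) i c" "homogeneous_chain s j c"
  shows "\<exists>w. koszul_chain V (free_vecs V (length t)) i w \<and> homogeneous_chain t j w \<and>
    (\<forall>F. apply_matrix (length s) (length t) M (w F) = c F)"
proof -
  obtain w where w: "koszul_chain V (free_vecs V (length t)) i w"
    "\<And>F. apply_matrix (length s) (length t) M (w F) = c F" using lift_chain[OF M c(1)] by blast
  have "apply_matrix (length s) (length t) M (chain_degree_part t j w F) = c F" for F
    using fun_cong[OF chain_degree_part_homogeneous[OF c(2)], of F]
    by (simp add: chain_degree_part_def degree_part_apply_matrix[OF M] w(2))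
  then show ?thesis
    using koszul_chain_degree_part[OF graded_submodule_free w(1)] homogeneous_chain_degree_part by blast
qed

lemma koszul_chain_diff:
  assumes "poly_submodule V N" "koszul_chain V N i c" "koszul_chain V N i d"
  shows "koszul_chain V N i (\<lambda>F. c F - d F)"
  using assms(2,3) poly_submoduleD(5)[OF assms(1)] unfolding koszul_chain_def
  by (metis diff_zero)

lemma vec_koszul_diff: "vec_koszul V (\<lambda>F. c F - d F) = vec_koszul V c - vec_koszul V d"
  using koszul_diff[of "\<lambda>x. scale (indet x)" V c d] by (simp add: fun_eq_iff scale_add_right)

lemma koszul_chain_image:
  assumes "koszul_chain V (free_vecs V q) i c"
  shows "koszul_chain V (matrix_image V r q M) i (\<lambda>F. apply_matrix r q M (c F))"
  using koszul_chainD[OF assms] unfolding koszul_chain_def matrix_image_def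
  by (metis apply_matrix_0 imageI)

lemma koszul_chain_syzygies_iff:
  "koszul_chain V (syzygies V r q M) i c \<longleftrightarrow>
     koszul_chain V (free_vecs V q) i c \<and> (\<forall>F. apply_matrix r q M (c F) = 0)"
  by (auto simp: koszul_chain_def syzygies_def)

text \<open>Chase in 0 -> Z -> F -> N -> 0. A lift \<open>w\<close> of \<open>c\<close> has a
  boundary in the syzygies; if \<open>z\<close> there has the same boundary, \<open>w - z\<close> is
  a cycle of the free module with image \<open>c\<close>. It bounds, since in index
  \<open>Suc i\<close> the empty face carries no constant.\<close>

lemma koszul_acyclic_of_syzygies:
  fixes M :: "nat \<Rightarrow> nat \<Rightarrow> (nat, 'k::field) mpoly"
  assumes V: "finite V" and M: "graded_array V s t M"
    and Z: "koszul_acyclic V t (syzygies V (length s) (length t) M) i j"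
  shows "koszul_acyclic V s (matrix_image V (length s) (length t) M) (Suc i) j"
  unfolding koszul_acyclic_def
proof (intro allI impI)
  let ?A = "apply_matrix (length s) (length t) M"
  let ?F = "free_vecs V (length t) :: 'k polyvec set"
  fix c assume c: "koszul_chain V (matrix_image V (length s) (length t) M) (Suc i) c"
    and h: "homogeneous_chain s j c" and cyc: "vec_koszul V c = 0"
  note F = graded_submoduleD(2)[OF graded_submodule_free[of V t, where ?'a = 'k]]
  obtain w where w: "koszul_chain V ?F (Suc i) w" "homogeneous_chain t j w" "\<And>F. ?A (w F) = c F"
    using lift_homogeneous_chain[OF M c h] by blast
  have "koszul_chain V (syzygies V (length s) (length t) M) i (vec_koszul V w)"
    using koszul_chain_vec_koszul[OF V F w(1)] cyc
    by (simp add: koszul_chain_syzygies_iff apply_matrix_koszul w(3))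
  moreover have "homogeneous_chain t j (vec_koszul V w)" using homogeneous_vec_koszul[OF V w(1,2)] .
  moreover have "vec_koszul V (vec_koszul V w) = 0" using vec_koszul_vec_koszul[OF V w(1)] .
  ultimately obtain z where z: "koszul_chain V (syzygies V (length s) (length t) M) (Suc i) z"
    "vec_koszul V z = vec_koszul V w" using Z unfolding koszul_acyclic_def by blast
  have z': "koszul_chain V ?F (Suc i) z" "\<And>F. ?A (z F) = 0"
    using z(1) by (auto simp: koszul_chain_syzygies_iff)
  let ?d = "\<lambda>F. w F - z F"
  have d: "koszul_chain V ?F (Suc i) ?d" using koszul_chain_diff[OF F w(1) z'(1)] .
  moreover have "vec_koszul V ?d = 0" by (simp add: vec_koszul_diff z(2))
  moreover have "?d {} = 0" using koszul_chainD(3)[OF d, of "{}"] by auto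
  ultimately obtain u where u: "koszul_chain V ?F (Suc (Suc i)) u" "vec_koszul V u = ?d"
    using koszul_exact_free[OF V, of "length t" "Suc i" ?d] by (metis lookup_zero zero_fun_apply)
  have "vec_koszul V (\<lambda>F. ?A (u F)) = c"
  proof
    fix F
    have "vec_koszul V (\<lambda>F. ?A (u F)) F = ?A (w F - z F)"
      using fun_cong[OF u(2), of F] by (simp flip: apply_matrix_koszul)
    then show "vec_koszul V (\<lambda>F. ?A (u F)) F = c F" by (simp add: apply_matrix_diff w(3) z'(2))
  qed
  then show "\<exists>u. koszul_chain V (matrix_image V (length s) (length t) M) (Suc (Suc i)) u \<and> vec_koszul V u = c"
    using koszul_chain_image[OF u(1)] by blast
qed

text \<open>Minimality says that the syzygies lie in \<open>\<mm>\<close> times the free module.\<close>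

definition minimal_array ::
    "nat set \<Rightarrow> nat \<Rightarrow> nat \<Rightarrow> (nat \<Rightarrow> nat \<Rightarrow> (nat, 'k::field) mpoly) \<Rightarrow> bool" where
  "minimal_array V r q M \<longleftrightarrow> (\<forall>v\<in>syzygies V r q M. \<forall>b. lookup (v b) 0 = 0)"

text \<open>The reverse chase: \<open>c\<close> bounds some \<open>u\<close> in the free module, the
  image of \<open>u\<close> is a cycle of N and bounds, and lifting that bound corrects
  \<open>u\<close> into the syzygies. For \<open>i = 0\<close> the free module has homology, its
  constants; minimality keeps the syzygies away from them.\<close>

lemma koszul_acyclic_syzygies:
  fixes M :: "nat \<Rightarrow> nat \<Rightarrow> (nat, 'k::field) mpoly"
  assumes V: "finite V" and M: "graded_array V s t M" and min: "minimal_array V (length s) (length t) M"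
    and Z: "koszul_acyclic V s (matrix_image V (length s) (length t) M) (Suc i) j"
  shows "koszul_acyclic V t (syzygies V (length s) (length t) M) i j"
  unfolding koszul_acyclic_def
proof (intro allI impI)
  let ?A = "apply_matrix (length s) (length t) M"
  let ?F = "free_vecs V (length t) :: 'k polyvec set"
  fix c assume c: "koszul_chain V (syzygies V (length s) (length t) M) i c"
    and h: "homogeneous_chain t j c" and cyc: "vec_koszul V c = 0"
  note G = graded_submodule_free[of V t, where ?'a = 'k]
  note F = graded_submoduleD(2)[OF G]
  have cF: "koszul_chain V ?F i c" and c0: "\<And>F. ?A (c F) = 0"
    using c by (auto simp: koszul_chain_syzygies_iff)
  have "lookup (c {} a) 0 = 0" for a
    using min koszul_chainD(1)[OF c] by (auto simp: minimal_array_def)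
  then obtain u0 where u0: "koszul_chain V ?F (Suc i) u0" "vec_koszul V u0 = c"
    using koszul_exact_free[OF V cF cyc] by blast
  define u where "u = chain_degree_part t j u0"
  have u: "koszul_chain V ?F (Suc i) u" "homogeneous_chain t j u" "vec_koszul V u = c"
    using koszul_chain_degree_part[OF G u0(1)] homogeneous_chain_degree_part
      vec_koszul_degree_part[OF V u0(1)] u0(2) chain_degree_part_homogeneous[OF h]
    by (simp_all add: u_def)
  have "vec_koszul V (\<lambda>F. ?A (u F)) = 0"
    by (simp add: fun_eq_iff flip: apply_matrix_koszul) (simp add: u(3) c0)
  moreover have "homogeneous_chain s j (\<lambda>F. ?A (u F))"
    unfolding homogeneous_chain_def
  proof
    fix F
    have "degree_part s (card F) j (?A (u F)) = ?A (u F)"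
      using u(2) by (simp add: degree_part_apply_matrix[OF M, symmetric] homogeneous_chain_def
          degree_part_homogeneous)
    then show "homogeneous s (card F) j (?A (u F))" by (metis homogeneous_degree_part)
  qed
  ultimately obtain y where y: "koszul_chain V (matrix_image V (length s) (length t) M) (Suc (Suc i)) y"
    "vec_koszul V y = (\<lambda>F. ?A (u F))"
    using Z koszul_chain_image[OF u(1)] unfolding koszul_acyclic_def by blast
  obtain w where w: "koszul_chain V ?F (Suc (Suc i)) w" "\<And>F. ?A (w F) = y F"
    using lift_chain[OF M y(1)] by blast
  let ?d = "\<lambda>F. u F - vec_koszul V w F"
  have "koszul_chain V ?F (Suc i) ?d"
    using koszul_chain_diff[OF F u(1) koszul_chain_vec_koszul[OF V F w(1)]] .
  moreover have "?A (?d F) = 0" for F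
    by (simp add: apply_matrix_diff apply_matrix_koszul w(2) y(2))
  moreover have "vec_koszul V ?d = c"
    by (simp add: vec_koszul_diff vec_koszul_vec_koszul[OF V w(1)] u(3))
  ultimately show "\<exists>u. koszul_chain V (syzygies V (length s) (length t) M) (Suc i) u \<and> vec_koszul V u = c"
    unfolding koszul_chain_syzygies_iff by blast
qed

definition unit_vec_poly :: "nat \<Rightarrow> 'k::field polyvec" where
  "unit_vec_poly b a = (if a = b then 1 else 0)"

lemma unit_vec_poly_in_free: "b < r \<Longrightarrow> unit_vec_poly b \<in> free_vecs V r"
  by (auto simp: free_vecs_def unit_vec_poly_def)

lemma apply_matrix_unit_vec:
  "b < q \<Longrightarrow> apply_matrix r q M (unit_vec_poly b) a = (if a < r then M a b else 0)"
  by (simp add: apply_matrix_def unit_vec_poly_def if_distrib[of "(*) _"] cong: if_cong)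

lemma lookup_vec_koszul_0 [simp]: "lookup (vec_koszul V c F a) 0 = 0"
  by (simp add: koszul_apply) (simp add: koszul_def lookup_sum lookup_signed lookup_indet_mult)

text \<open>H_0 is N modulo the indeterminates times N. If the image of a basis vector of degree
  \<open>j\<close> were a boundary, some element without constant terms would have the same image,
  and the difference would be a syzygy with constant 1. Conversely a lift of degree \<open>j\<close>
  has a constant entry only at a generator of degree \<open>j\<close>; without one it bounds in the
  free module.\<close>

lemma koszul_acyclic_0_iff:
  fixes M :: "nat \<Rightarrow> nat \<Rightarrow> (nat, 'k::field) mpoly"
  assumes V: "finite V" and M: "graded_array V s t M" and min: "minimal_array V (length s) (length t) M"
  shows "koszul_acyclic V s (matrix_image V (length s) (length t) M) 0 j \<longleftrightarrow> j \<notin> set t"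
proof
  let ?A = "apply_matrix (length s) (length t) M"
  let ?F = "free_vecs V (length t) :: 'k polyvec set"
  note F = graded_submoduleD(2)[OF graded_submodule_free[of V t, where ?'a = 'k]]
  assume Z: "koszul_acyclic V s (matrix_image V (length s) (length t) M) 0 j"
  show "j \<notin> set t"
  proof
    assume "j \<in> set t"
    then obtain b where b: "b < length t" "j = t ! b" by (metis in_set_conv_nth)
    define c :: "nat set \<Rightarrow> 'k polyvec" where "c F = (if F = {} then unit_vec_poly b else 0)" for F
    have "koszul_chain V ?F 0 c"
      using unit_vec_poly_in_free[OF b(1)] poly_submoduleD(1)[OF F] by (auto simp: koszul_chain_def c_def)
    then have "koszul_chain V (matrix_image V (length s) (length t) M) 0 (\<lambda>F. ?A (c F))"
      by (rule koszul_chain_image)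
    moreover have "homogeneous_chain s j (\<lambda>F. ?A (c F))"
      using M b by (auto simp: homogeneous_chain_def homogeneous_def c_def apply_matrix_unit_vec graded_array_def
          split: if_splits)
    moreover have "vec_koszul V (\<lambda>F. ?A (c F)) = 0"
      by (simp add: koszul_def c_def fun_eq_iff[of _ 0])
    ultimately obtain y where y: "koszul_chain V (matrix_image V (length s) (length t) M) (Suc 0) y"
      "vec_koszul V y = (\<lambda>F. ?A (c F))" using Z unfolding koszul_acyclic_def by blast
    obtain w where w: "koszul_chain V ?F (Suc 0) w" "\<And>F. ?A (w F) = y F"
      using lift_chain[OF M y(1)] by blast
    let ?x = "unit_vec_poly b - vec_koszul V w {}"
    have "?x \<in> ?F"
      using poly_submoduleD(5)[OF F unit_vec_poly_in_free[OF b(1)]]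
        koszul_chainD(1)[OF koszul_chain_vec_koszul[OF V F w(1)]] by blast
    moreover have "?A ?x = 0"
      by (simp add: apply_matrix_diff apply_matrix_koszul w(2) y(2)) (simp add: c_def)
    ultimately have "lookup (?x b) 0 = 0"
      using min unfolding minimal_array_def syzygies_def by blast
    then show False by (simp add: lookup_minus unit_vec_poly_def)
  qed
next
  let ?A = "apply_matrix (length s) (length t) M"
  let ?F = "free_vecs V (length t) :: 'k polyvec set"
  assume j: "j \<notin> set t"
  show "koszul_acyclic V s (matrix_image V (length s) (length t) M) 0 j"
    unfolding koszul_acyclic_def
  proof (intro allI impI)
    fix c assume c: "koszul_chain V (matrix_image V (length s) (length t) M) 0 c"
      and h: "homogeneous_chain s j c"
    obtain w where w: "koszul_chain V ?F 0 w" "homogeneous_chain t j w" "\<And>F. ?A (w F) = c F"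
      using lift_homogeneous_chain[OF M c h] by blast
    have "lookup (w {} a) 0 = 0" for a
    proof (rule ccontr)
      assume "lookup (w {} a) 0 \<noteq> 0"
      then have *: "0 \<in> keys (w {} a)" by (simp add: in_keys_iff)
      then have "t ! a = j" using homogeneous_chainD[OF w(2) *] by simp
      moreover have "w {} a \<noteq> 0" using * by auto
      then have "a < length t" using koszul_chainD(1)[OF w(1), of "{}"] by (auto simp: free_vecs_def not_le[symmetric])
      ultimately show False using j by auto
    qed
    moreover have "vec_koszul V w = 0"
    proof
      fix F
      have "w (insert x F) = 0" if "x \<in> V" for x
        using koszul_chainD(2,3)[OF w(1), of "insert x F"] finite_subset[OF _ V, of "insert x F"] by auto
      then show "vec_koszul V w F = 0 F" by (simp add: koszul_def)
    qed
    ultimately obtain u where u: "koszul_chain V ?F (Suc 0) u" "vec_koszul V u = w"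
      using koszul_exact_free[OF V w(1)] by blast
    have "vec_koszul V (\<lambda>F. ?A (u F)) = c"
      by (simp add: fun_eq_iff flip: apply_matrix_koszul) (simp add: u(2) w(3))
    then show "\<exists>u. koszul_chain V (matrix_image V (length s) (length t) M) (Suc 0) u \<and> vec_koszul V u = c"
      using koszul_chain_image[OF u(1)] by blast
  qed
qed

text \<open>Minimal resolutions in terms of functions: \<open>s i\<close> are the degrees of the target of the
  \<open>i\<close>-th map, so the degrees of its source are \<open>s (Suc i)\<close>.\<close>

definition minimal_array_resolution ::
    "nat set \<Rightarrow> 'k::field polyvec set \<Rightarrow> (nat \<Rightarrow> nat list) \<Rightarrow>
     (nat \<Rightarrow> nat \<Rightarrow> nat \<Rightarrow> (nat, 'k) mpoly) \<Rightarrow> bool" where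
  "minimal_array_resolution V N s M \<longleftrightarrow>
     (\<forall>i. graded_array V (s i) (s (Suc i)) (M i)) \<and>
     (\<forall>i. minimal_array V (length (s i)) (length (s (Suc i))) (M i)) \<and>
     matrix_image V (length (s 0)) (length (s (Suc 0))) (M 0) = N \<and>
     (\<forall>i. matrix_image V (length (s (Suc i))) (length (s (Suc (Suc i)))) (M (Suc i)) =
          syzygies V (length (s i)) (length (s (Suc i))) (M i))"

text \<open>Each shift trades one homological degree for one step along the resolution, until H_0 of
  the \<open>i\<close>-th image reads off its generator degrees. The right side does not mention the
  maps, so all minimal resolutions have the same degrees.\<close>

theorem minimal_resolution_degrees:
  assumes V: "finite V" and res: "minimal_array_resolution V N s M"
  shows "j \<in> set (s (Suc i)) \<longleftrightarrow> \<not> koszul_acyclic V (s 0) N i j"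
proof -
  let ?Z = "\<lambda>i. matrix_image V (length (s i)) (length (s (Suc i))) (M i)"
  have M: "\<And>i. graded_array V (s i) (s (Suc i)) (M i)"
    and min: "\<And>i. minimal_array V (length (s i)) (length (s (Suc i))) (M i)"
    and N: "?Z 0 = N" and syz: "\<And>i. ?Z (Suc i) = syzygies V (length (s i)) (length (s (Suc i))) (M i)"
    using res by (auto simp: minimal_array_resolution_def)
  have shift: "koszul_acyclic V (s l) (?Z l) (Suc i) j \<longleftrightarrow> koszul_acyclic V (s (Suc l)) (?Z (Suc l)) i j" for l i
    using koszul_acyclic_of_syzygies[OF V M] koszul_acyclic_syzygies[OF V M min] unfolding syz by blast
  have "koszul_acyclic V (s l) (?Z l) i j \<longleftrightarrow> koszul_acyclic V (s (l + i)) (?Z (l + i)) 0 j" for l i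
  proof (induction i arbitrary: l)
    case (Suc i)
    show ?case using shift[of l i] Suc[of "Suc l"] by simp
  qed simp
  from this[of 0 i] show ?thesis
    using koszul_acyclic_0_iff[OF V M min, of i j] N by simp
qed

section \<open>Existence of minimal resolutions\<close>

text \<open>Scalars act as constant polynomials, so linear algebra in a single degree can be done
  inside the module.\<close>

definition field_subspace :: "'k::field polyvec set \<Rightarrow> bool" where
  "field_subspace U \<longleftrightarrow> 0 \<in> U \<and> (\<forall>v\<in>U. \<forall>w\<in>U. v + w \<in> U) \<and>
     (\<forall>a. \<forall>v\<in>U. scale (Poly_Mapping.single 0 a) v \<in> U)"

lemma field_subspaceD:
  assumes "field_subspace U"
  shows "0 \<in> U" "v \<in> U \<Longrightarrow> w \<in> U \<Longrightarrow> v + w \<in> U"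
    "v \<in> U \<Longrightarrow> scale (Poly_Mapping.single 0 a) v \<in> U"
  using assms by (auto simp: field_subspace_def)

lemma lookup_scale_const:
  fixes v :: "'k::field polyvec"
  shows "lookup (scale (Poly_Mapping.single 0 a) v b) m = a * lookup (v b) m"
  by (simp add: scale_def lookup_single_mult)

text \<open>Gaussian elimination on the coefficients in \<open>X\<close>.\<close>

lemma finite_coordinates_generate:
  fixes W :: "'k::field polyvec set" and X :: "(nat \<times> (nat \<Rightarrow>\<^sub>0 nat)) set"
  assumes "finite X" "field_subspace W"
    "\<And>w. w \<in> W \<Longrightarrow> (\<And>a m. (a, m) \<in> X \<Longrightarrow> lookup (w a) m = 0) \<Longrightarrow> w = 0"
  shows "\<exists>G. finite G \<and> G \<subseteq> W \<and> (\<forall>U. field_subspace U \<longrightarrow> G \<subseteq> U \<longrightarrow> W \<subseteq> U)"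
  using assms
proof (induction X arbitrary: W rule: finite_induct)
  case empty
  have "w = 0" if "w \<in> W" for w by (rule empty.prems(2)[OF that]) simp
  then have "W \<subseteq> {0}" by blast
  then show ?case by (intro exI[of _ "{}"]) (auto dest: field_subspaceD(1))
next
  case (insert x X)
  obtain a m where x: "x = (a, m)" by force
  let ?l = "\<lambda>w. lookup (w a) m"
  define W0 where "W0 = {w \<in> W. ?l w = 0}"
  note W = field_subspaceD[OF insert.prems(1)]
  have "field_subspace W0"
    using W by (auto simp: field_subspace_def W0_def lookup_add lookup_scale_const)
  moreover have "w = 0" if "w \<in> W0" "\<And>b n. (b, n) \<in> X \<Longrightarrow> lookup (w b) n = 0" for w
    by (rule insert.prems(2)) (use that x in \<open>auto simp: W0_def\<close>)
  ultimately obtain G where G: "finite G" "G \<subseteq> W0" "\<And>U. field_subspace U \<Longrightarrow> G \<subseteq> U \<Longrightarrow> W0 \<subseteq> U"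
    using insert.IH[of W0] by blast
  show ?case
  proof (cases "W0 = W")
    case True
    then show ?thesis using G by blast
  next
    case False
    then obtain g where g: "g \<in> W" "?l g \<noteq> 0" by (auto simp: W0_def)
    have "W \<subseteq> U" if U: "field_subspace U" and "insert g G \<subseteq> U" for U
    proof
      fix w assume w: "w \<in> W"
      let ?a = "?l w / ?l g"
      let ?h = "w + scale (Poly_Mapping.single 0 (- ?a)) g"
      have "?h \<in> W0" using W(2)[OF w W(3)[OF g(1), of "- ?a"]] g(2)
        by (simp add: W0_def lookup_add lookup_scale_const)
      then have "?h \<in> U" using G(3)[OF U] that(2) by blast
      moreover have "scale (Poly_Mapping.single 0 ?a) g \<in> U"
        using field_subspaceD(3)[OF U] that(2) by blast
      moreover have "w = ?h + scale (Poly_Mapping.single 0 ?a) g"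
        by (simp add: fun_eq_iff scale_def single_uminus)
      ultimately show "w \<in> U" using field_subspaceD(2)[OF U] by metis
    qed
    then show ?thesis using G(1,2) g(1) by (intro exI[of _ "insert g G"]) (auto simp: W0_def)
  qed
qed

section \<open>Finite generation from a degree bound on H_0\<close>

lemma finite_monomials:
  assumes "finite V"
  shows "finite {m::nat \<Rightarrow>\<^sub>0 nat. keys m \<subseteq> V \<and> mono_degree m \<le> d}" (is "finite ?M")
proof -
  let ?F = "{f. \<forall>x. (x \<in> V \<longrightarrow> f x \<in> {..d}) \<and> (x \<notin> V \<longrightarrow> f x = (0::nat))}"
  have le: "lookup m x \<le> mono_degree m" for m and x :: nat
  proof (cases "x \<in> keys m")
    case True
    then show ?thesis unfolding mono_degree_def by (intro member_le_sum) auto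
  qed (simp add: in_keys_iff)
  have "lookup ` ?M \<subseteq> ?F"
  proof
    fix f assume "f \<in> lookup ` ?M"
    then obtain m where m: "f = lookup m" "keys m \<subseteq> V" "mono_degree m \<le> d" by blast
    have "f x = 0" if "x \<notin> V" for x using m(1,2) that by (auto simp: in_keys_iff)
    then show "f \<in> ?F" using le m(1,3) order_trans[OF le m(3)] by auto
  qed
  moreover have "finite ?F" using assms by (intro finite_set_of_finite_funs) auto
  ultimately have "finite (lookup ` ?M)" by (rule finite_subset)
  then show ?thesis by (rule finite_imageD) (auto intro!: inj_onI poly_mapping_eqI)
qed

definition homogeneous_elems ::
    "nat list \<Rightarrow> 'k::field polyvec set \<Rightarrow> nat \<Rightarrow> 'k polyvec set" where
  "homogeneous_elems s N j = {v \<in> N. homogeneous s 0 j v}"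

text \<open>Testing against all submodules \<open>U\<close> avoids spans and linear
  combinations.\<close>

definition generates :: "nat set \<Rightarrow> 'k::field polyvec set \<Rightarrow> 'k polyvec set \<Rightarrow> bool" where
  "generates V G N \<longleftrightarrow> (\<forall>U. poly_submodule V U \<longrightarrow> G \<subseteq> U \<longrightarrow> N \<subseteq> U)"

lemma field_subspace_poly_submodule: "poly_submodule V U \<Longrightarrow> field_subspace U"
  by (auto simp: field_subspace_def poly_submodule_def poly_ring_single)

lemma keys_scale_const:
  "keys (scale (Poly_Mapping.single 0 a) v b) \<subseteq> keys ((v :: 'k::field polyvec) b)"
  by (auto simp: in_keys_iff lookup_scale_const)

lemma field_subspace_homogeneous_elems:
  fixes N :: "'k::field polyvec set"
  assumes "poly_submodule V N"
  shows "field_subspace (homogeneous_elems s N j)"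
  unfolding field_subspace_def
proof (intro conjI ballI allI)
  note N = poly_submoduleD[OF assms]
  show "0 \<in> homogeneous_elems s N j" using N(1) by (simp add: homogeneous_elems_def)
  fix v assume v: "v \<in> homogeneous_elems s N j"
  show "scale (Poly_Mapping.single 0 a) v \<in> homogeneous_elems s N j" for a
    using v N(3)[OF poly_ring_single, of 0 v a] keys_scale_const[of a v]
    by (auto simp: homogeneous_elems_def homogeneous_def)
  fix w assume w: "w \<in> homogeneous_elems s N j"
  show "v + w \<in> homogeneous_elems s N j"
    using v w N(2)[of v w] Poly_Mapping.keys_add
    unfolding homogeneous_elems_def homogeneous_def by fastforce
qed

lemma finite_generators_degree:
  fixes N :: "'k::field polyvec set"
  assumes V: "finite V" and N: "graded_submodule V s N"
  shows "\<exists>G. finite G \<and> G \<subseteq> homogeneous_elems s N j \<and>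
    (\<forall>U. field_subspace U \<longrightarrow> G \<subseteq> U \<longrightarrow> homogeneous_elems s N j \<subseteq> U)"
proof (rule finite_coordinates_generate)
  let ?M = "{m::nat \<Rightarrow>\<^sub>0 nat. keys m \<subseteq> V \<and> mono_degree m \<le> j}"
  show "finite ({..<length s} \<times> ?M)" using finite_monomials[OF V] by simp
  show "field_subspace (homogeneous_elems s N j)"
    using field_subspace_homogeneous_elems graded_submoduleD(2)[OF N] .
  fix w assume w: "w \<in> homogeneous_elems s N j"
    and 0: "\<And>a m. (a, m) \<in> {..<length s} \<times> ?M \<Longrightarrow> lookup (w a) m = 0"
  have wF: "w \<in> free_vecs V (length s)" and hw: "homogeneous s 0 j w"
    using w graded_submoduleD(1)[OF N] by (auto simp: homogeneous_elems_def)
  show "w = 0"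
  proof
    fix a
    have "lookup (w a) m = 0" for m
    proof (rule ccontr)
      assume "lookup (w a) m \<noteq> 0"
      then have m: "m \<in> keys (w a)" by (simp add: in_keys_iff)
      then have "mono_degree m \<le> j" using hw by (force simp: homogeneous_def)
      moreover have "keys m \<subseteq> V" using wF m by (auto simp: free_vecs_def poly_ring_simps)
      moreover have "w a \<noteq> 0" using m by auto
      then have "a < length s" using wF by (auto simp: free_vecs_def not_le[symmetric])
      ultimately have "lookup (w a) m = 0" using 0[of a m] by simp
      then show False using m by (simp add: in_keys_iff)
    qed
    then show "w a = 0 a" by (intro poly_mapping_eqI) simp
  qed
qed

lemma sum_degree_parts:
  assumes "v \<in> free_vecs V (length s)"
  shows "\<exists>d. v = (\<Sum>j\<le>d. degree_part s 0 j v)"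
proof -
  let ?D = "\<Union>a\<in>{..<length s}. (\<lambda>m. mono_degree m + s ! a) ` keys (v a)"
  define d where "d = Max (insert 0 ?D)"
  have d: "mono_degree m + s ! a \<le> d" if "m \<in> keys (v a)" for a m
  proof -
    have "v a \<noteq> 0" using that by auto
    then have "a < length s" using assms by (auto simp: free_vecs_def not_le[symmetric])
    then show ?thesis unfolding d_def using that by (intro Max_ge) auto
  qed
  have "v = (\<Sum>j\<le>d. degree_part s 0 j v)"
  proof (intro ext poly_mapping_eqI)
    fix a m
    have "lookup ((\<Sum>j\<le>d. degree_part s 0 j v) a) m
        = (\<Sum>j\<le>d. if mono_degree m + s ! a = j then lookup (v a) m else 0)"
      by (simp add: sum_fun_apply lookup_sum degree_part_def)
    also have "\<dots> = (if mono_degree m + s ! a \<le> d then lookup (v a) m else 0)"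
      by simp
    also have "\<dots> = lookup (v a) m" using d[of m a] by (auto simp: in_keys_iff)
    finally show "lookup (v a) m
        = lookup ((\<Sum>j\<le>d. degree_part s 0 j v) a) m" by simp
  qed
  then show ?thesis by blast
qed

text \<open>Above degree \<open>d\<close>, the vanishing of H_0 writes a homogeneous element as a
  combination of indeterminates with elements of \<open>N\<close> one degree lower. So generators of
  the finite-dimensional parts up to \<open>d\<close> suffice.\<close>

lemma finite_homogeneous_generators:
  fixes N :: "'k::field polyvec set"
  assumes V: "finite V" and N: "graded_submodule V s N"
    and ac: "\<And>j. j > d \<Longrightarrow> koszul_acyclic V s N 0 j"
  shows "\<exists>G. finite G \<and> G \<subseteq> N \<and> (\<forall>g\<in>G. \<exists>j. homogeneous s 0 j g) \<and> generates V G N"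
proof -
  from finite_generators_degree[OF V N] obtain G where
    G: "\<And>j. finite (G j)" "\<And>j. G j \<subseteq> homogeneous_elems s N j"
      "\<And>j U. field_subspace U \<Longrightarrow> G j \<subseteq> U \<Longrightarrow> homogeneous_elems s N j \<subseteq> U" by metis
  let ?G = "\<Union>j\<le>d. G j"
  have "N \<subseteq> U" if U: "poly_submodule V U" and GU: "?G \<subseteq> U" for U
  proof -
    have homU: "homogeneous_elems s N j \<subseteq> U" for j
    proof (induction j rule: less_induct)
      case (less j)
      show ?case
      proof (cases "j \<le> d")
        case True
        then show ?thesis using G(3)[OF field_subspace_poly_submodule[OF U]] GU by blast
      next
        case False
        show ?thesis
        proof
          fix w assume "w \<in> homogeneous_elems s N j"
          then have w: "w \<in> N" "homogeneous s 0 j w" by (auto simp: homogeneous_elems_def)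
          define c where "c F = (if F = {} then w else 0)" for F :: "nat set"
          have c: "koszul_chain V N 0 c" "homogeneous_chain s j c"
            using w poly_submoduleD(1)[OF graded_submoduleD(2)[OF N]]
            by (auto simp: koszul_chain_def homogeneous_chain_def c_def)
          have "vec_koszul V c F = 0" for F by (simp add: koszul_def c_def)
          then have "vec_koszul V c = 0" by (simp add: fun_eq_iff)
          then obtain u where u: "koszul_chain V N (Suc 0) u" "vec_koszul V u = c"
            using ac[of j] False c unfolding koszul_acyclic_def by (metis not_le)
          define y where "y = chain_degree_part s j u"
          have y: "koszul_chain V N (Suc 0) y" "homogeneous_chain s j y"
            unfolding y_def using koszul_chain_degree_part[OF N u(1)] homogeneous_chain_degree_part by auto
          have "vec_koszul V y = c"
            using vec_koszul_degree_part[OF V u(1), of s j] u(2)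
              chain_degree_part_homogeneous[OF c(2)] by (simp add: y_def)
          then have w_eq: "w = vec_koszul V y {}" by (simp add: c_def)
          \<comment> \<open>A one-element face has degree 1, so the entry there of a chain of total
            degree \<open>j\<close> has degree \<open>j - 1\<close>, and the induction hypothesis
            applies.\<close>
          have "y {x} \<in> U" for x
          proof (cases "j = 0")
            case False
            have "mono_degree m + s ! a + 0 = j - 1" if "m \<in> keys (y {x} a)" for a m
              using homogeneous_chainD[OF y(2) that] by simp
            then have "homogeneous s 0 (j - 1) (y {x})" unfolding homogeneous_def by blast
            then have "y {x} \<in> homogeneous_elems s N (j - 1)"
              using koszul_chainD(1)[OF y(1)] by (simp add: homogeneous_elems_def)
            then show ?thesis using less.IH[of "j - 1"] False by auto
          qed (use False in simp)
          then have "signed x {} (scale (indet x) (y {x})) \<in> U" if "x \<in> V" for x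
            using poly_submoduleD(3)[OF U poly_ring_indet[OF that]] by (simp add: signed_def)
          then show "w \<in> U" unfolding w_eq koszul_def by (intro poly_submodule_sum[OF U]) auto
        qed
      qed
    qed
    show "N \<subseteq> U"
    proof
      fix v assume v: "v \<in> N"
      then obtain e where e: "v = (\<Sum>j\<le>e. degree_part s 0 j v)"
        using sum_degree_parts graded_submoduleD(1)[OF N] by blast
      have parts: "degree_part s 0 j v \<in> U" for j
        using subsetD[OF homU[of j], of "degree_part s 0 j v"] graded_submoduleD(3)[OF N v]
        by (simp add: homogeneous_elems_def homogeneous_degree_part)
      show "v \<in> U" by (subst e) (rule poly_submodule_sum[OF U parts])
    qed
  qed
  then have "generates V ?G N" by (simp add: generates_def)
  moreover have "finite ?G" using G(1) by simp
  moreover have "?G \<subseteq> N" "\<forall>g\<in>?G. \<exists>j. homogeneous s 0 j g"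
    using G(2) by (auto simp: homogeneous_elems_def)
  ultimately show ?thesis by blast
qed

text \<open>Homogeneous generators of least number are minimal, as in the graded Nakayama lemma: a
  syzygy with a nonzero constant at \<open>b\<close> would express generator \<open>b\<close>
  through the others.\<close>

lemma minimal_presentation:
  fixes N :: "'k::field polyvec set"
  assumes V: "finite V" and N: "graded_submodule V s N"
    and ac: "\<And>j. j > d \<Longrightarrow> koszul_acyclic V s N 0 j"
  shows "\<exists>t M. graded_array V s t M \<and> minimal_array V (length s) (length t) M \<and>
    matrix_image V (length s) (length t) M = N"
proof -
  define P where "P G \<longleftrightarrow> finite G \<and> G \<subseteq> N \<and> (\<forall>g\<in>G. \<exists>j. homogeneous s 0 j g) \<and> generates V G N" for G
  have "\<exists>G. P G" using finite_homogeneous_generators[OF V N ac] by (simp add: P_def)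
  then obtain G where G: "P G" and least: "\<And>H. P H \<Longrightarrow> card G \<le> card H"
    using ex_has_least_nat[of P _ card] by blast
  have fin: "finite G" and GN: "G \<subseteq> N" and gen: "generates V G N"
    and "\<forall>g\<in>G. \<exists>j. homogeneous s 0 j g" using G by (auto simp: P_def)
  then obtain deg where deg: "\<And>g. g \<in> G \<Longrightarrow> homogeneous s 0 (deg g) g" by metis
  obtain gs where gs: "set gs = G" "distinct gs" using finite_distinct_list[OF fin] by blast
  define t where "t = map deg gs"
  define M where "M a b = (gs ! b) a" for a b
  have lt: "length t = length gs" by (simp add: t_def)
  have gsG: "gs ! b \<in> G" if "b < length t" for b using that gs(1) lt by auto
  have GF: "g \<in> free_vecs V (length s)" if "g \<in> G" for g
    using that GN graded_submoduleD(1)[OF N] by blast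
  have M: "graded_array V s t M"
    unfolding graded_array_def
  proof (intro allI impI conjI ballI)
    fix a b assume b: "b < length t"
    show "M a b \<in> carrier (poly_ring V)" using GF[OF gsG[OF b]] by (simp add: M_def free_vecs_def)
    show "mono_degree m + s ! a = t ! b" if "m \<in> keys (M a b)" for m
      using deg[OF gsG[OF b]] that b lt by (auto simp: M_def homogeneous_def t_def)
  qed
  let ?A = "apply_matrix (length s) (length t) M"
  let ?F = "free_vecs V (length t) :: 'k polyvec set"
  have A: "?A v = (\<Sum>b<length t. scale (v b) (gs ! b))" for v
  proof
    fix a
    show "?A v a = (\<Sum>b<length t. scale (v b) (gs ! b)) a"
    proof (cases "a < length s")
      case True
      then show ?thesis by (simp add: apply_matrix_def sum_fun_apply scale_def M_def mult.commute)
    next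
      case False
      then have "(gs ! b) a = 0" if "b < length t" for b
        using GF[OF gsG[OF that]] by (simp add: free_vecs_def)
      then show ?thesis using False by (simp add: apply_matrix_def sum_fun_apply scale_def)
    qed
  qed
  have scN: "scale p (gs ! b) \<in> N" if "p \<in> carrier (poly_ring V)" "b < length t" for p b
    using poly_submoduleD(3)[OF graded_submoduleD(2)[OF N] that(1)] gsG[OF that(2)] GN by blast
  have image: "matrix_image V (length s) (length t) M = N"
  proof
    show "matrix_image V (length s) (length t) M \<subseteq> N"
      unfolding matrix_image_def A
      using scN by (auto intro!: poly_submodule_sum[OF graded_submoduleD(2)[OF N]] simp: free_vecs_def)
    have "G \<subseteq> matrix_image V (length s) (length t) M"
    proof
      fix g assume g: "g \<in> G"
      then obtain b where b: "b < length t" "g = gs ! b" using gs(1) lt by (metis in_set_conv_nth)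
      have "?A (unit_vec_poly b) = g"
      proof
        fix a show "?A (unit_vec_poly b) a = g a"
          using GF[OF g] b(2) by (auto simp: apply_matrix_unit_vec[OF b(1)] M_def free_vecs_def)
      qed
      then show "g \<in> matrix_image V (length s) (length t) M"
        using unit_vec_poly_in_free[OF b(1)] unfolding matrix_image_def by (metis imageI)
    qed
    then show "N \<subseteq> matrix_image V (length s) (length t) M"
      using gen graded_submoduleD(2)[OF graded_submodule_image[OF M]] unfolding generates_def by blast
  qed
  have "minimal_array V (length s) (length t) M"
    unfolding minimal_array_def
  proof (intro ballI allI, rule ccontr)
    fix v b assume v: "v \<in> syzygies V (length s) (length t) M" and nz: "lookup (v b) 0 \<noteq> 0"
    let ?a = "lookup (v b) 0"
    \<comment> \<open>In the part of degree \<open>t ! b\<close> the entry at \<open>b\<close> has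
      degree 0; it is the bare constant and can be inverted.\<close>
    define w where "w = degree_part t 0 (t ! b) v"
    have wS: "w \<in> syzygies V (length s) (length t) M"
      unfolding w_def using graded_submoduleD(3)[OF graded_submodule_syzygies[OF M] v] .
    then have wF: "w \<in> ?F" and w0: "?A w = 0" by (auto simp: syzygies_def)
    have vF: "v \<in> ?F" using v by (simp add: syzygies_def)
    have b: "b < length t" using vF nz by (auto simp: free_vecs_def not_le[symmetric])
    have wb: "w b = Poly_Mapping.single 0 ?a"
      by (rule poly_mapping_eqI)
        (auto simp: w_def degree_part_def lookup_single when_def mono_degree_eq_0_iff)
    let ?H = "G - {gs ! b}"
    have "P ?H"
      unfolding P_def
    proof (intro conjI)
      show "finite ?H" "?H \<subseteq> N" using fin GN by auto
      show "\<forall>g\<in>?H. \<exists>j. homogeneous s 0 j g" using deg by blast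
      show "generates V ?H N"
        unfolding generates_def
      proof (intro allI impI)
        fix U assume U: "poly_submodule V U" and HU: "?H \<subseteq> U"
        have "(\<Sum>c\<in>{..<length t} - {b}. scale (w c) (gs ! c)) \<in> U"
        proof (rule poly_submodule_sum[OF U])
          fix c assume c: "c \<in> {..<length t} - {b}"
          then have "gs ! c \<noteq> gs ! b" using gs(2) b lt by (auto simp: nth_eq_iff_index_eq)
          then have "gs ! c \<in> U" using gsG[of c] c HU by auto
          then show "scale (w c) (gs ! c) \<in> U"
            using poly_submoduleD(3)[OF U] wF by (simp add: free_vecs_def)
        qed
        moreover have "?A w = scale (w b) (gs ! b) + (\<Sum>c\<in>{..<length t} - {b}. scale (w c) (gs ! c))"
          unfolding A using b by (intro sum.remove) auto
        then have "scale (w b) (gs ! b) = - (\<Sum>c\<in>{..<length t} - {b}. scale (w c) (gs ! c))"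
          using w0 by (simp add: eq_neg_iff_add_eq_0)
        ultimately have "scale (w b) (gs ! b) \<in> U" using poly_submoduleD(4)[OF U] by simp
        then have "scale (Poly_Mapping.single 0 (1 / ?a)) (scale (w b) (gs ! b)) \<in> U"
          using poly_submoduleD(3)[OF U poly_ring_single] by simp
        then have "gs ! b \<in> U" using nz by (simp add: scale_scale wb mult_single)
        then show "N \<subseteq> U" using gen U HU unfolding generates_def by blast
      qed
    qed
    then have "card G \<le> card ?H" by (rule least)
    moreover have "card ?H < card G" using fin gsG[OF b] by (intro psubset_card_mono) auto
    ultimately show False by simp
  qed
  then show ?thesis using M image by blast
qed

text \<open>The invariant is gradedness together with vanishing above \<open>d\<close> in every
  homological degree at once. The dimension shift hands it to the syzygies with the same
  \<open>d\<close>, so all of them have finite minimal presentations.\<close>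

theorem minimal_resolution_exists:
  fixes N :: "'k::field polyvec set"
  assumes V: "finite V" and N: "graded_submodule V s0 N"
    and ac: "\<And>i j. j > d \<Longrightarrow> koszul_acyclic V s0 N i j"
  shows "\<exists>s M. s 0 = s0 \<and> minimal_array_resolution V N s M"
proof -
  define P where "P s M Z t \<longleftrightarrow> graded_array V s t M \<and> minimal_array V (length s) (length t) M \<and>
      matrix_image V (length s) (length t) M = Z" for s M and Z :: "'k polyvec set" and t
  define I where "I s Z \<longleftrightarrow> graded_submodule V s Z \<and> (\<forall>i j. j > d \<longrightarrow> koszul_acyclic V s Z i j)"
    for s and Z :: "'k polyvec set"
  have step: "\<exists>t M. P s M Z t \<and> I t (syzygies V (length s) (length t) M)" if "I s Z" for s Z
  proof -
    have Z: "graded_submodule V s Z" "\<And>i j. j > d \<Longrightarrow> koszul_acyclic V s Z i j"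
      using that by (auto simp: I_def)
    obtain t M where M: "graded_array V s t M" "minimal_array V (length s) (length t) M"
      "matrix_image V (length s) (length t) M = Z"
      using minimal_presentation[OF V Z] by blast
    have "I t (syzygies V (length s) (length t) M)"
      unfolding I_def using graded_submodule_syzygies[OF M(1)] koszul_acyclic_syzygies[OF V M(1,2)] Z(2)
      unfolding M(3) by blast
    then show ?thesis using M unfolding P_def by blast
  qed
  \<comment> \<open>The choice carries pairs of a degree list and a module; the matrix between
    consecutive pairs is recovered afterwards.\<close>
  let ?next = "\<lambda>x y. \<exists>M. P (fst x) M (snd x) (fst y) \<and> snd y = syzygies V (length (fst x)) (length (fst y)) M"
  have "\<exists>f. \<forall>n. (I (fst (f n)) (snd (f n)) \<and> (n = 0 \<longrightarrow> f n = (s0, N))) \<and> ?next (f n) (f (Suc n))"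
  proof (rule dependent_nat_choice)
    show "\<exists>x. I (fst x) (snd x) \<and> (0 = (0::nat) \<longrightarrow> x = (s0, N))"
      using N ac by (intro exI[of _ "(s0, N)"]) (simp add: I_def)
    fix x and n :: nat assume "I (fst x) (snd x) \<and> (n = 0 \<longrightarrow> x = (s0, N))"
    then obtain t M where "P (fst x) M (snd x) t" "I t (syzygies V (length (fst x)) (length t) M)"
      using step by blast
    then show "\<exists>y. (I (fst y) (snd y) \<and> (Suc n = 0 \<longrightarrow> y = (s0, N))) \<and> ?next x y"
      by (intro exI[of _ "(t, syzygies V (length (fst x)) (length t) M)"]) auto
  qed
  then obtain f where f0: "f 0 = (s0, N)" and f: "\<And>n. ?next (f n) (f (Suc n))" by blast
  then obtain M where M: "\<And>n. P (fst (f n)) (M n) (snd (f n)) (fst (f (Suc n)))"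
    "\<And>n. snd (f (Suc n)) = syzygies V (length (fst (f n))) (length (fst (f (Suc n)))) (M n)" by metis
  have "minimal_array_resolution V N (\<lambda>n. fst (f n)) M"
    unfolding minimal_array_resolution_def
  proof (intro conjI allI)
    show "graded_array V (fst (f i)) (fst (f (Suc i))) (M i)"
      "minimal_array V (length (fst (f i))) (length (fst (f (Suc i)))) (M i)" for i
      using M(1)[of i] by (simp_all add: P_def)
    show "matrix_image V (length (fst (f 0))) (length (fst (f (Suc 0)))) (M 0) = N"
      using M(1)[of 0] f0 by (simp add: P_def)
    show "matrix_image V (length (fst (f (Suc i)))) (length (fst (f (Suc (Suc i))))) (M (Suc i)) =
        syzygies V (length (fst (f i))) (length (fst (f (Suc i)))) (M i)" for i
      using M(1)[of "Suc i"] M(2)[of i] by (simp add: P_def)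
  qed
  then show ?thesis using f0 by (intro exI[of _ "\<lambda>n. fst (f n)"] exI[of _ M]) simp
qed

section \<open>Graded Betti numbers as Koszul homology\<close>

definition vec_fun :: "'a::zero vec \<Rightarrow> nat \<Rightarrow> 'a" where
  "vec_fun v a = (if a < dim_vec v then v $ a else 0)"

lemma inj_on_vec_fun: "inj_on vec_fun (carrier_vec r)"
proof (rule inj_onI)
  fix v w :: "'a vec" assume vw: "v \<in> carrier_vec r" "w \<in> carrier_vec r" and eq: "vec_fun v = vec_fun w"
  show "v = w"
  proof (rule eq_vecI)
    fix a assume "a < dim_vec w"
    then show "v $ a = w $ a" using fun_cong[OF eq, of a] vw by (simp add: vec_fun_def)
  qed (use vw in simp)
qed

lemma vec_fun_free_module:
  "vec_fun ` (free_module V r :: (nat, 'k::field) mpoly vec set) = free_vecs V r"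
proof
  show "vec_fun ` (free_module V r :: (nat, 'k) mpoly vec set) \<subseteq> free_vecs V r"
    by (auto simp: free_module_def free_vecs_def vec_fun_def)
  show "free_vecs V r \<subseteq> vec_fun ` (free_module V r :: (nat, 'k) mpoly vec set)"
  proof
    fix f :: "'k polyvec" assume f: "f \<in> free_vecs V r"
    then have "vec r f \<in> free_module V r" by (auto simp: free_module_def free_vecs_def)
    moreover have "vec_fun (vec r f) = f" using f by (auto simp: vec_fun_def free_vecs_def fun_eq_iff)
    ultimately show "f \<in> vec_fun ` free_module V r" by (metis imageI)
  qed
qed

lemma vec_fun_mult:
  assumes "A \<in> carrier_mat r q" "v \<in> carrier_vec q"
  shows "vec_fun (A *\<^sub>v v) = apply_matrix r q (\<lambda>a b. A $$ (a, b)) (vec_fun v)"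
proof
  fix a
  have "(A *\<^sub>v v) $ a = (\<Sum>b<q. A $$ (a, b) * vec_fun v b)" if "a < r"
    using assms that
    by (auto simp: scalar_prod_def vec_fun_def lessThan_atLeast0 intro!: sum.cong)
  then show "vec_fun (A *\<^sub>v v) a = apply_matrix r q (\<lambda>a b. A $$ (a, b)) (vec_fun v) a"
    using assms by (auto simp: vec_fun_def[of "A *\<^sub>v v"] apply_matrix_def)
qed

lemma free_module_carrier: "free_module V r \<subseteq> carrier_vec r"
  by (auto simp: free_module_def)

lemma vec_fun_image:
  assumes "A \<in> carrier_mat r q"
  shows "vec_fun ` (\<lambda>w. A *\<^sub>v w) ` free_module V q = matrix_image V r q (\<lambda>a b. A $$ (a, b))"
proof -
  have "vec_fun (A *\<^sub>v w) = apply_matrix r q (\<lambda>a b. A $$ (a, b)) (vec_fun w)" if "w \<in> free_module V q" for w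
    using vec_fun_mult[OF assms] that free_module_carrier by blast
  then show ?thesis
    unfolding matrix_image_def vec_fun_free_module[symmetric] image_image by (rule image_cong[OF refl])
qed

lemma vec_fun_kernel:
  assumes "A \<in> carrier_mat r q"
  shows "vec_fun ` {v \<in> free_module V q. A *\<^sub>v v = 0\<^sub>v (dim_row A)} = syzygies V r q (\<lambda>a b. A $$ (a, b))"
proof -
  have iff: "A *\<^sub>v v = 0\<^sub>v (dim_row A) \<longleftrightarrow> apply_matrix r q (\<lambda>a b. A $$ (a, b)) (vec_fun v) = 0"
    if "v \<in> free_module V q" for v
  proof -
    have v: "v \<in> carrier_vec q" using that free_module_carrier by blast
    have "vec_fun (0\<^sub>v (dim_row A)) = 0" by (simp add: vec_fun_def fun_eq_iff)
    moreover have "A *\<^sub>v v \<in> carrier_vec r" "0\<^sub>v (dim_row A) \<in> carrier_vec r"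
      using mult_mat_vec_carrier[OF assms v] assms by auto
    ultimately have "A *\<^sub>v v = 0\<^sub>v (dim_row A) \<longleftrightarrow> vec_fun (A *\<^sub>v v) = 0"
      using inj_on_vec_fun[of r] by (metis inj_onD)
    then show ?thesis using vec_fun_mult[OF assms v] by simp
  qed
  show ?thesis
    unfolding syzygies_def vec_fun_free_module[symmetric] using iff by auto
qed

definition ideal_vecs :: "(nat, 'k::field) mpoly set \<Rightarrow> 'k polyvec set" where
  "ideal_vecs J = (\<lambda>p a. if a = 0 then p else 0) ` J"

lemma ideal_vecs_iff: "v \<in> ideal_vecs J \<longleftrightarrow> v 0 \<in> J \<and> (\<forall>a. a \<noteq> 0 \<longrightarrow> v a = 0)"
  by (auto simp: ideal_vecs_def fun_eq_iff image_iff)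

lemma augmentation_image:
  assumes "A \<in> carrier_mat 1 q"
  shows "(\<lambda>v. (A *\<^sub>v v) $ 0) ` free_module V q = J \<longleftrightarrow> matrix_image V 1 q (\<lambda>a b. A $$ (a, b)) = ideal_vecs J"
proof -
  let ?e = "\<lambda>p a. if a = (0::nat) then p else 0"
  have inj: "inj ?e" by (rule injI) (metis)
  have "vec_fun (A *\<^sub>v w) = ?e ((A *\<^sub>v w) $ 0)" if "w \<in> free_module V q" for w
    using assms that by (auto simp: vec_fun_def fun_eq_iff)
  then have "vec_fun ` (\<lambda>w. A *\<^sub>v w) ` free_module V q = ?e ` (\<lambda>v. (A *\<^sub>v v) $ 0) ` free_module V q"
    unfolding image_image by (rule image_cong[OF refl])
  then show ?thesis
    unfolding ideal_vecs_def vec_fun_image[OF assms, symmetric] by (simp add: inj_image_eq_iff[OF inj])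
qed

lemma lookup_mult_0:
  fixes p q :: "(nat, 'k::field) mpoly"
  shows "lookup (p * q) 0 = lookup p 0 * lookup q 0"
proof -
  have p: "p = Poly_Mapping.single 0 (lookup p 0) + filter_poly (\<lambda>m. m \<noteq> 0) p"
    by (rule poly_mapping_eqI) (simp add: lookup_add lookup_single when_def)
  have "0 \<notin> keys (filter_poly (\<lambda>m. m \<noteq> 0) p * q)"
  proof
    assume "0 \<in> keys (filter_poly (\<lambda>m. m \<noteq> 0) p * q)"
    then obtain x y where xy: "0 = x + y" "x \<in> keys (filter_poly (\<lambda>m. m \<noteq> 0) p)"
      using Poly_Mapping.keys_mult by blast
    then have "mono_degree x + mono_degree y = 0" using mono_degree_add[of x y] by simp
    then have "x = 0" using mono_degree_eq_0_iff[of x] by simp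
    then show False using xy(2) by (simp add: keys_filter_poly)
  qed
  then have "lookup (filter_poly (\<lambda>m. m \<noteq> 0) p * q) 0 = 0" by (simp add: in_keys_iff)
  then show ?thesis
    by (subst p) (simp add: distrib_right lookup_add lookup_single_mult)
qed

text \<open>The columns of the next matrix generate the syzygies, and the constant term of a product
  is the product of the constant terms; so constants are absent from all syzygies as soon as they
  are absent from the columns.\<close>

lemma minimal_array_iff:
  fixes M :: "nat \<Rightarrow> nat \<Rightarrow> (nat, 'k::field) mpoly"
  assumes "syzygies V r q L = matrix_image V q n M"
  shows "minimal_array V r q L \<longleftrightarrow> (\<forall>a<q. \<forall>b<n. lookup (M a b) 0 = 0)"
proof
  assume min: "minimal_array V r q L"
  show "\<forall>a<q. \<forall>b<n. lookup (M a b) 0 = 0"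
  proof (intro allI impI)
    fix a b assume ab: "a < q" "b < n"
    have "apply_matrix q n M (unit_vec_poly b) \<in> syzygies V r q L"
      unfolding assms matrix_image_def using unit_vec_poly_in_free[OF ab(2)] by blast
    then have "lookup (apply_matrix q n M (unit_vec_poly b) a) 0 = 0"
      using min by (auto simp: minimal_array_def)
    then show "lookup (M a b) 0 = 0" using ab by (simp add: apply_matrix_unit_vec)
  qed
next
  assume 0: "\<forall>a<q. \<forall>b<n. lookup (M a b) 0 = 0"
  have "lookup (apply_matrix q n M v a) 0 = 0" for v a
    using 0 by (simp add: apply_matrix_def lookup_sum lookup_mult_0)
  then show "minimal_array V r q L" unfolding minimal_array_def assms matrix_image_def by auto
qed

text \<open>The augmentation maps into R(0). Prepending its target degrees \<open>[0]\<close> makes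
  it an ordinary step of the array form.\<close>

definition target_degrees :: "(nat \<Rightarrow> nat list) \<Rightarrow> nat \<Rightarrow> nat list" where
  "target_degrees d i = (case i of 0 \<Rightarrow> [0] | Suc i \<Rightarrow> d i)"

lemma target_degrees_simps [simp]: "target_degrees d 0 = [0]" "target_degrees d (Suc i) = d i"
  by (simp_all add: target_degrees_def)

lemma minimal_graded_free_resolution_iff:
  fixes A :: "nat \<Rightarrow> (nat, 'k::field) mpoly mat"
  assumes "\<And>i. A i \<in> carrier_mat (length (target_degrees d i)) (length (d i))"
  shows "minimal_graded_free_resolution V J d A \<longleftrightarrow>
    minimal_array_resolution V (ideal_vecs J) (target_degrees d) (\<lambda>i a b. A i $$ (a, b))"
proof -
  let ?s = "target_degrees d" and ?M = "\<lambda>i a b. A i $$ (a, b)"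
  let ?syz = "\<lambda>i. syzygies V (length (?s i)) (length (d i)) (?M i)"
  let ?im = "\<lambda>i. matrix_image V (length (?s i)) (length (d i)) (?M i)"
  have graded: "(graded_matrix V [0] (d 0) (A 0) \<and> (\<forall>i. graded_matrix V (d i) (d (Suc i)) (A (Suc i))))
      \<longleftrightarrow> (\<forall>i. graded_array V (?s i) (d i) (?M i))"
  proof -
    have "graded_matrix V (?s i) (d i) (A i) \<longleftrightarrow> graded_array V (?s i) (d i) (?M i)" for i
      using assms[of i] by (simp add: graded_matrix_def graded_array_def)
    from this[symmetric] show ?thesis
      by (metis (no_types, lifting) not0_implies_Suc target_degrees_simps)
  qed
  have im0: "(\<lambda>v. (A 0 *\<^sub>v v) $ 0) ` free_module V (length (d 0)) = J \<longleftrightarrow> ?im 0 = ideal_vecs J"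
    using augmentation_image[of "A 0" "length (d 0)" V J] assms[of 0] by simp
  have exact: "{v \<in> free_module V (length (d i)). A i *\<^sub>v v = 0\<^sub>v (dim_row (A i))} =
      (\<lambda>w. A (Suc i) *\<^sub>v w) ` free_module V (length (d (Suc i))) \<longleftrightarrow> ?syz i = ?im (Suc i)" for i
  proof -
    let ?K = "{v \<in> free_module V (length (d i)). A i *\<^sub>v v = 0\<^sub>v (dim_row (A i))}"
    let ?I = "(\<lambda>w. A (Suc i) *\<^sub>v w) ` free_module V (length (d (Suc i)))"
    have K: "?K \<subseteq> carrier_vec (length (d i))" using free_module_carrier by blast
    have "A (Suc i) \<in> carrier_mat (length (d i)) (length (d (Suc i)))" using assms[of "Suc i"] by simp
    then have I: "?I \<subseteq> carrier_vec (length (d i))"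
      using mult_mat_vec_carrier free_module_carrier by blast
    have "?K = ?I \<longleftrightarrow> vec_fun ` ?K = vec_fun ` ?I"
      by (rule inj_on_image_eq_iff[OF inj_on_vec_fun K I, symmetric])
    then show ?thesis using vec_fun_kernel[OF assms[of i]] vec_fun_image[OF assms[of "Suc i"]] by simp
  qed
  have min: "(\<forall>i. \<forall>a<length (d i). \<forall>b<length (d (Suc i)). lookup (A (Suc i) $$ (a, b)) 0 = 0)
      \<longleftrightarrow> (\<forall>i. minimal_array V (length (?s i)) (length (d i)) (?M i))"
    if "\<forall>i. ?syz i = ?im (Suc i)"
  proof -
    have "minimal_array V (length (?s i)) (length (d i)) (?M i) \<longleftrightarrow>
        (\<forall>a<length (d i). \<forall>b<length (d (Suc i)). lookup (A (Suc i) $$ (a, b)) 0 = 0)" for i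
      using that minimal_array_iff[of V "length (?s i)" "length (d i)" "?M i" "length (d (Suc i))" "?M (Suc i)"]
      by simp
    then show ?thesis by blast
  qed
  have "minimal_array_resolution V (ideal_vecs J) ?s ?M \<longleftrightarrow>
     (\<forall>i. graded_array V (?s i) (d i) (?M i)) \<and>
     (\<forall>i. minimal_array V (length (?s i)) (length (d i)) (?M i)) \<and> ?im 0 = ideal_vecs J \<and>
     (\<forall>i. ?syz i = ?im (Suc i))"
    unfolding minimal_array_resolution_def target_degrees_simps(2) by (simp add: eq_commute)
  then show ?thesis
    unfolding minimal_graded_free_resolution_def im0 exact
    using graded min by blast
qed

text \<open>Existence turns the choice behind \<open>graded_betti\<close> into a genuine minimal
  resolution, and Koszul homology dictates the degrees of whichever one is chosen.\<close>

theorem graded_betti_nonzero_iff: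
  fixes J :: "(nat, 'k::field) mpoly set"
  assumes V: "finite V" and J: "graded_submodule V [0] (ideal_vecs J)"
    and ac: "\<And>i j. j > n \<Longrightarrow> koszul_acyclic V [0] (ideal_vecs J) i j"
  shows "graded_betti V J i j \<noteq> 0 \<longleftrightarrow> \<not> koszul_acyclic V [0] (ideal_vecs J) i j"
proof -
  let ?P = "\<lambda>d. \<exists>A :: nat \<Rightarrow> (nat, 'k) mpoly mat. minimal_graded_free_resolution V J d A"
  obtain s M where s0: "s 0 = [0]" and res: "minimal_array_resolution V (ideal_vecs J) s M"
    using minimal_resolution_exists[OF V J ac] by blast
  define d where "d i = s (Suc i)" for i
  have sd: "target_degrees d = s"
  proof
    fix i show "target_degrees d i = s i" using s0 by (cases i) (simp_all add: d_def)
  qed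
  define A where "A i = mat (length (s i)) (length (d i)) (\<lambda>(a, b). M i a b)" for i
  have A: "A i \<in> carrier_mat (length (target_degrees d i)) (length (d i))" for i
    by (simp add: A_def sd)
  have app: "apply_matrix (length (s i)) (length (s (Suc i))) (\<lambda>a b. A i $$ (a, b))
      = apply_matrix (length (s i)) (length (s (Suc i))) (M i)" for i
    by (auto simp: apply_matrix_def A_def d_def fun_eq_iff)
  have "minimal_array_resolution V (ideal_vecs J) s (\<lambda>i a b. A i $$ (a, b))"
    using res unfolding minimal_array_resolution_def minimal_array_def matrix_image_def syzygies_def app
    by (simp add: graded_array_def A_def d_def)
  then have "minimal_graded_free_resolution V J d A"
    using minimal_graded_free_resolution_iff[of A d V J, OF A] sd by simp
  then have "?P d" by blast
  then have "?P (SOME d. ?P d)" by (rule someI[of ?P])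
  moreover define e where "e = (SOME d. ?P d)"
  ultimately obtain B :: "nat \<Rightarrow> (nat, 'k) mpoly mat"
    where B: "minimal_graded_free_resolution V J e B" by blast
  have "graded_matrix V [0] (e 0) (B 0)" "\<And>i. graded_matrix V (e i) (e (Suc i)) (B (Suc i))"
    using B unfolding minimal_graded_free_resolution_def by blast+
  then have "B i \<in> carrier_mat (length (target_degrees e i)) (length (e i))" for i
    by (cases i) (simp_all add: graded_matrix_def)
  then have "minimal_array_resolution V (ideal_vecs J) (target_degrees e) (\<lambda>i a b. B i $$ (a, b))"
    using minimal_graded_free_resolution_iff[of B e V J] B by simp
  from minimal_resolution_degrees[OF V this, of j i] show ?thesis
    unfolding graded_betti_def e_def[symmetric] by (simp add: count_list_0_iff)
qed

section \<open>Monomial ideals generated by matchings\<close>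

text \<open>Ideals are compared with such spans because membership is then a test on exponents; a
  \<open>Q\<close> closed under multiples makes the span an ideal.\<close>

definition mono_ideal :: "nat set \<Rightarrow> ((nat \<Rightarrow>\<^sub>0 nat) \<Rightarrow> bool) \<Rightarrow> (nat, 'k::field) mpoly set" where
  "mono_ideal V Q = {p \<in> carrier (poly_ring V). \<forall>m\<in>keys p. Q m}"

lemma mono_ideal_closed:
  fixes p q :: "(nat, 'k::field) mpoly"
  shows "0 \<in> mono_ideal V Q"
    "p \<in> mono_ideal V Q \<Longrightarrow> q \<in> mono_ideal V Q \<Longrightarrow> p + q \<in> mono_ideal V Q"
    "p \<in> mono_ideal V Q \<Longrightarrow> - p \<in> mono_ideal V Q"
    "p \<in> mono_ideal V Q \<Longrightarrow> filter_poly R p \<in> mono_ideal V Q"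
proof -
  show "p \<in> mono_ideal V Q \<Longrightarrow> q \<in> mono_ideal V Q \<Longrightarrow> p + q \<in> mono_ideal V Q"
    using poly_ring_add_closed[of p V q] Poly_Mapping.keys_add[of p q] unfolding mono_ideal_def by blast
qed (auto simp: mono_ideal_def poly_ring_uminus filter_poly_in_poly_ring keys_filter_poly)

lemma mono_ideal_mult:
  fixes p q :: "(nat, 'k::field) mpoly"
  assumes "p \<in> mono_ideal V P" "q \<in> mono_ideal V Q" "\<And>x y. P x \<Longrightarrow> Q y \<Longrightarrow> R (x + y)"
  shows "p * q \<in> mono_ideal V R"
proof -
  have "R m" if "m \<in> keys (p * q)" for m
  proof -
    obtain x y where "m = x + y" "x \<in> keys p" "y \<in> keys q"
      using \<open>m \<in> keys (p * q)\<close> Poly_Mapping.keys_mult by blast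
    then show ?thesis using assms by (auto simp: mono_ideal_def)
  qed
  then show ?thesis using assms poly_ring_mult_closed by (auto simp: mono_ideal_def)
qed

lemma poly_ring_eq_mono_ideal: "carrier (poly_ring V) = mono_ideal V (\<lambda>_. True)"
  by (simp add: mono_ideal_def)

lemma ideal_mono_ideal:
  assumes up: "\<And>x y. Q y \<Longrightarrow> Q (x + y)"
  shows "ideal (mono_ideal V Q :: (nat, 'k::field) mpoly set) (poly_ring V)"
proof (rule idealI)
  show "ring (poly_ring V :: (nat, 'k) mpoly ring)" using cring_poly_ring cring.axioms(1) by blast
  interpret R: cring "poly_ring V :: (nat, 'k) mpoly ring" by (rule cring_poly_ring)
  have inv: "\<ominus>\<^bsub>poly_ring V\<^esub> p = - p" if "p \<in> carrier (poly_ring V)" for p :: "(nat, 'k) mpoly"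
    using that by (intro R.minus_equality) (simp_all add: poly_ring_simps(3,5) poly_ring_uminus)
  show "subgroup (mono_ideal V Q :: (nat, 'k) mpoly set) (add_monoid (poly_ring V))"
  proof (rule R.add.subgroupI)
    show "mono_ideal V Q \<subseteq> carrier (poly_ring V)" by (auto simp: mono_ideal_def)
    show "mono_ideal V Q \<noteq> {}" using mono_ideal_closed(1) by blast
    fix p q :: "(nat, 'k) mpoly" assume p: "p \<in> mono_ideal V Q"
    then have "p \<in> carrier (poly_ring V)" by (simp add: mono_ideal_def)
    then show "\<ominus>\<^bsub>poly_ring V\<^esub> p \<in> mono_ideal V Q" using inv mono_ideal_closed(3)[OF p] by simp
    assume "q \<in> mono_ideal V Q"
    then show "p \<oplus>\<^bsub>poly_ring V\<^esub> q \<in> mono_ideal V Q"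
      using mono_ideal_closed(2)[OF p] by (simp add: poly_ring_simps(3))
  qed
  fix a x :: "(nat, 'k) mpoly" assume a: "a \<in> mono_ideal V Q" and x: "x \<in> carrier (poly_ring V)"
  have "x * a \<in> mono_ideal V Q"
    by (rule mono_ideal_mult[OF _ a, of x "\<lambda>_. True"]) (use x up in \<open>auto simp: mono_ideal_def\<close>)
  then show "x \<otimes>\<^bsub>poly_ring V\<^esub> a \<in> mono_ideal V Q" "a \<otimes>\<^bsub>poly_ring V\<^esub> x \<in> mono_ideal V Q"
    by (simp_all add: poly_ring_simps(2) mult.commute)
qed

lemma graded_submodule_mono_ideal:
  assumes up: "\<And>x y. Q y \<Longrightarrow> Q (x + y)"
  shows "graded_submodule V [0] (ideal_vecs (mono_ideal V Q :: (nat, 'k::field) mpoly set))"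
  unfolding graded_submodule_def poly_submodule_def
proof (intro conjI ballI allI)
  show "ideal_vecs (mono_ideal V Q :: (nat, 'k) mpoly set) \<subseteq> free_vecs V (length [0::nat])"
  proof
    fix v :: "'k polyvec" assume v: "v \<in> ideal_vecs (mono_ideal V Q)"
    have "v a \<in> carrier (poly_ring V)" for a
      using v by (cases "a = 0") (auto simp: ideal_vecs_iff mono_ideal_def)
    then show "v \<in> free_vecs V (length [0::nat])" using v by (auto simp: free_vecs_def ideal_vecs_iff)
  qed
  show "0 \<in> ideal_vecs (mono_ideal V Q :: (nat, 'k) mpoly set)"
    by (simp add: ideal_vecs_iff mono_ideal_closed(1))
  fix v :: "'k polyvec" assume v: "v \<in> ideal_vecs (mono_ideal V Q)"
  show "degree_part [0] n j v \<in> ideal_vecs (mono_ideal V Q)" for n j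
    using v by (simp add: ideal_vecs_iff degree_part_def mono_ideal_closed(4))
  show "scale p v \<in> ideal_vecs (mono_ideal V Q)" if "p \<in> carrier (poly_ring V)" for p
    using v that up mono_ideal_mult[of p V "\<lambda>_. True" "v 0" Q Q]
    by (simp add: ideal_vecs_iff scale_def poly_ring_eq_mono_ideal)
  fix w :: "'k polyvec" assume "w \<in> ideal_vecs (mono_ideal V Q)"
  then show "v + w \<in> ideal_vecs (mono_ideal V Q)" using v by (simp add: ideal_vecs_iff mono_ideal_closed(2))
qed

section \<open>Koszul homology of the square-free power through matching complexes\<close>

abbreviation matching_mono :: "nat \<Rightarrow> (nat \<Rightarrow>\<^sub>0 nat) \<Rightarrow> bool" where
  "matching_mono k m \<equiv> has_matching k (keys m)"

lemma keys_add_nat: "keys (x + y :: nat \<Rightarrow>\<^sub>0 nat) = keys x \<union> keys y"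
  by (auto simp: in_keys_iff lookup_add)

lemma matching_mono_up: "matching_mono k y \<Longrightarrow> matching_mono k (x + y)"
  by (rule has_matching_mono) (auto simp: keys_add_nat)

lemma mono_complex_squarefree:
  assumes "finite S"
  shows "mono_complex (matching_mono k) (sqfree_mono S) = matching_complex k S"
proof -
  have "keys (sqfree_mono S - sqfree_mono F) = S - F" if "F \<subseteq> S" for F
    using assms that finite_subset[OF that assms]
    by (auto simp: in_keys_iff lookup_minus split: if_splits)
  then show ?thesis using assms by (auto simp: mono_complex_def matching_complex_def)
qed

lemma simplicial_complex_mono_complex:
  "simplicial_complex (keys m) (mono_complex (matching_mono k) m)"
proof -
  have "\<rho> \<in> mono_complex (matching_mono k) m"
    if "F \<in> mono_complex (matching_mono k) m" "\<rho> \<subseteq> F" for F \<rho>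
  proof -
    have F: "F \<subseteq> keys m" "matching_mono k (m - sqfree_mono F)"
      using that(1) by (auto simp: mono_complex_def)
    have fin: "finite F" "finite \<rho>"
      using F(1) that(2) finite_subset[OF _ finite_keys, of _ m] by auto
    have "keys (m - sqfree_mono F) \<subseteq> keys (m - sqfree_mono \<rho>)"
      using fin that(2) by (auto simp: in_keys_iff lookup_minus split: if_splits)
    then have "matching_mono k (m - sqfree_mono \<rho>)" by (rule has_matching_mono[OF F(2)])
    then show ?thesis using F(1) that(2) by (auto simp: mono_complex_def)
  qed
  moreover have "mono_complex (matching_mono k) m \<subseteq> Pow (keys m)"
    by (auto simp: mono_complex_def)
  ultimately show ?thesis unfolding simplicial_complex_def by (metis finite_keys)
qed

text \<open>Only square-free multidegrees contribute: otherwise the strand is a cone.\<close>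

lemma acyclic_mono_complex_nonsquarefree:
  assumes v: "lookup m v \<ge> 2"
  shows "acyclic_at K (keys m) (mono_complex (matching_mono k) m) i"
proof (rule acyclic_cone[OF simplicial_complex_mono_complex])
  show vm: "v \<in> keys m" using v by (simp add: in_keys_iff)
  fix F assume "F \<in> mono_complex (matching_mono k) m"
  then have F: "F \<subseteq> keys m" "matching_mono k (m - sqfree_mono F)"
    by (auto simp: mono_complex_def)
  have fin: "finite F" using F(1) finite_subset[OF _ finite_keys] by blast
  have "keys (m - sqfree_mono F) \<subseteq> keys (m - sqfree_mono (insert v F))"
    using fin v by (auto simp: in_keys_iff lookup_minus split: if_splits)
  then show "insert v F \<in> mono_complex (matching_mono k) m"
    using has_matching_mono[OF F(2)] F(1) vm by (simp add: mono_complex_def)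
qed

text \<open>A nonzero strand of a chain of degree \<open>j\<close> has a multidegree of total degree
  \<open>j\<close>. If this is square-free, its support has \<open>j\<close> elements and
  \<open>ac\<close> applies; otherwise the strand lies on a cone. Zero strands are bounded by
  zero.\<close>

lemma koszul_acyclic_matching:
  assumes V: "finite V"
    and ac: "\<And>S. S \<subseteq> V \<Longrightarrow> card S = j \<Longrightarrow> acyclic_at TYPE('k::field) S (matching_complex k S) i"
  shows "koszul_acyclic V [0] (ideal_vecs (mono_ideal V (matching_mono k) :: (nat, 'k) mpoly set)) i j"
  unfolding koszul_acyclic_def
proof (intro allI impI)
  let ?J = "mono_ideal V (matching_mono k) :: (nat, 'k) mpoly set"
  fix c assume c: "koszul_chain V (ideal_vecs ?J) i c" and h: "homogeneous_chain [0] j c"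
    and cyc: "vec_koszul V c = 0"
  let ?c = "\<lambda>F. c F 0"
  have c': "mono_chain V (matching_mono k) i ?c"
    unfolding mono_chain_def
  proof (intro allI conjI impI ballI)
    fix F
    have "c F 0 \<in> ?J" using koszul_chainD(1)[OF c] by (simp add: ideal_vecs_iff)
    then show "c F 0 \<in> carrier (poly_ring V)" "\<And>p. p \<in> keys (c F 0) \<Longrightarrow> matching_mono k p"
      by (auto simp: mono_ideal_def)
    assume "c F 0 \<noteq> 0"
    then have "c F \<noteq> 0" by auto
    then show "F \<subseteq> V" "card F = i" using koszul_chainD(2,3)[OF c] by auto
  qed
  have cyc': "poly_koszul V ?c F = 0" for F using koszul_apply[of V c F 0] cyc by simp
  have "\<exists>u. mono_chain V (matching_mono k) (Suc i) u \<and> poly_koszul V u = ?c"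
  proof (rule koszul_boundary_of_strands[OF V c'])
    fix m :: "nat \<Rightarrow>\<^sub>0 nat" assume mV: "keys m \<subseteq> V"
    let ?G = "mono_complex (matching_mono k) m"
    have st: "simplicial_chain ?G i (strand m ?c)" by (rule simplicial_chain_strand[OF c'])
    have b: "\<forall>F. bdry (keys m) (strand m ?c) F = 0"
      by (simp add: strand_koszul[OF V mV, of ?c, symmetric] strand_def[of m "poly_koszul V ?c"] cyc')
    show "\<exists>g. simplicial_chain ?G (Suc i) g \<and> (\<forall>F. bdry (keys m) g F = strand m ?c F)"
    proof (cases "\<forall>F. strand m ?c F = 0")
      case True
      then show ?thesis by (intro exI[of _ 0]) (simp add: koszul_def)
    next
      case False
      then obtain F where F: "strand m ?c F \<noteq> 0" by blast
      then have Fm: "F \<subseteq> keys m" and p: "m - sqfree_mono F \<in> keys (c F 0)"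
        by (auto simp: strand_def in_keys_iff split: if_splits)
      have fin: "finite F" using Fm finite_subset[OF _ finite_keys] by blast
      have "m = (m - sqfree_mono F) + sqfree_mono F"
        using minus_sqfree_mono_eq_iff[OF fin Fm] by blast
      then have "mono_degree m = mono_degree (m - sqfree_mono F) + card F"
        using mono_degree_add[of "m - sqfree_mono F" "sqfree_mono F"] fin by simp
      then have deg: "mono_degree m = j" using homogeneous_chainD[OF h p] by simp
      have "acyclic_at TYPE('k) (keys m) ?G i"
      proof (cases "\<exists>v. lookup m v \<ge> 2")
        case True
        then show ?thesis using acyclic_mono_complex_nonsquarefree by blast
      next
        case False
        have m: "m = sqfree_mono (keys m)"
        proof (rule poly_mapping_eqI)
          fix v
          have "lookup m v < 2" using False by (meson not_le)
          then show "lookup m v = lookup (sqfree_mono (keys m)) v"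
            by (auto simp: in_keys_iff)
        qed
        have "card (keys m) = j"
          using deg m mono_degree_sqfree_mono[OF finite_keys] by metis
        then have "acyclic_at TYPE('k) (keys m) (matching_complex k (keys m)) i"
          using ac mV by blast
        moreover have "?G = matching_complex k (keys m)"
          using mono_complex_squarefree[OF finite_keys, of k m] m by metis
        ultimately show ?thesis by simp
      qed
      then show ?thesis using st b unfolding acyclic_at_def by blast
    qed
  qed
  then obtain u where u: "mono_chain V (matching_mono k) (Suc i) u" "poly_koszul V u = ?c" by blast
  define w :: "nat set \<Rightarrow> 'k polyvec" where "w F a = (if a = 0 then u F else 0)" for F a
  have "koszul_chain V (ideal_vecs ?J) (Suc i) w"
    unfolding koszul_chain_def
  proof (intro allI conjI impI)
    fix F
    show "w F \<in> ideal_vecs ?J"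
      using mono_chainD(3,4)[OF u(1)] by (auto simp: ideal_vecs_iff w_def mono_ideal_def)
    assume "w F \<noteq> 0"
    then have "u F \<noteq> 0" by (auto simp: w_def fun_eq_iff split: if_splits)
    then show "F \<subseteq> V" "card F = Suc i" using mono_chainD(1,2)[OF u(1)] by auto
  qed
  moreover have "vec_koszul V w = c"
  proof (intro ext)
    fix F a
    show "vec_koszul V w F a = c F a"
    proof (cases "a = 0")
      case True
      then have "(\<lambda>F. w F a) = u" by (simp add: w_def)
      then show ?thesis using u(2) True by (simp add: koszul_apply)
    next
      case False
      then have "(\<lambda>F. w F a) = (\<lambda>_. 0)" by (simp add: w_def)
      moreover have "c F a = 0" using False koszul_chainD(1)[OF c, of F] by (simp add: ideal_vecs_iff)
      ultimately show ?thesis by (simp add: koszul_apply) (simp add: koszul_def)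
    qed
  qed
  ultimately show "\<exists>u. koszul_chain V (ideal_vecs ?J) (Suc i) u \<and> vec_koszul V u = c" by blast
qed

text \<open>The simplicial cycle is planted in the single multidegree given by \<open>S\<close>,
  with \<open>f F\<close> as coefficient of the monomial on \<open>S - F\<close>. The strand of a
  bounding Koszul chain in this multidegree is the simplicial chain sought.\<close>

lemma acyclic_matching_of_koszul:
  assumes V: "finite V" and S: "S \<subseteq> V" "card S = j"
    and ac: "koszul_acyclic V [0] (ideal_vecs (mono_ideal V (matching_mono k) :: (nat, 'k::field) mpoly set)) i j"
  shows "acyclic_at TYPE('k) S (matching_complex k S) i"
  unfolding acyclic_at_def
proof (intro allI impI)
  let ?J = "mono_ideal V (matching_mono k) :: (nat, 'k) mpoly set"
  let ?G = "matching_complex k S"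
  fix f :: "nat set \<Rightarrow> 'k" assume f: "simplicial_chain ?G i f" and cyc: "\<forall>F. bdry S f F = 0"
  have fin: "finite S" using S(1) V finite_subset by blast
  define p :: "nat set \<Rightarrow> (nat, 'k) mpoly" where
    "p F = (if F \<subseteq> S then Poly_Mapping.single (sqfree_mono (S - F)) (f F) else 0)" for F
  define c :: "nat set \<Rightarrow> 'k polyvec" where "c F a = (if a = 0 then p F else 0)" for F a
  have keys_p: "m = sqfree_mono (S - F) \<and> F \<in> ?G \<and> card F = i \<and> F \<subseteq> S \<and> keys m = S - F"
    if "m \<in> keys (p F)" for m F
    using that f fin by (auto simp: p_def simplicial_chain_def split: if_splits)
  have pJ: "p F \<in> ?J" for F
    using keys_p S(1) unfolding mono_ideal_def poly_ring_simps(1)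
    by (auto simp: matching_complex_def)
  have "f F = 0 \<Longrightarrow> p F = 0" for F by (simp add: p_def)
  then have p0: "p F \<noteq> 0 \<Longrightarrow> F \<subseteq> S \<and> card F = i" for F
    using simplicial_chainD[OF f, of F] by (auto simp: matching_complex_def)
  have "koszul_chain V (ideal_vecs ?J) i c"
    unfolding koszul_chain_def
  proof (intro allI conjI impI)
    fix F
    show "c F \<in> ideal_vecs ?J" using pJ by (simp add: ideal_vecs_iff c_def)
    assume "c F \<noteq> 0"
    then have "p F \<noteq> 0" by (auto simp: c_def fun_eq_iff split: if_splits)
    then show "F \<subseteq> V" "card F = i" using p0[of F] S(1) by auto
  qed
  moreover have "homogeneous_chain [0] j c"
    unfolding homogeneous_chain_def homogeneous_def
  proof (intro allI ballI)
    fix F a m assume m: "m \<in> keys (c F a)"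
    then have a: "a = 0" by (auto simp: c_def split: if_splits)
    then have *: "m = sqfree_mono (S - F)" "F \<subseteq> S" using keys_p m by (auto simp: c_def)
    then show "mono_degree m + [0] ! a + card F = j"
      using fin S(2) a card_mono[OF fin *(2)] card_Diff_subset[OF finite_subset[OF *(2) fin] *(2)] by simp
  qed
  moreover have "vec_koszul V c = 0"
  proof (intro ext)
    fix F a
    show "vec_koszul V c F a = 0 F a"
    proof (cases "a = 0 \<and> F \<subseteq> V")
      case True
      have "poly_koszul V p F = (\<lambda>_. 0) F"
      proof (rule strand_eqI[OF V])
        show "poly_koszul V p F \<in> carrier (poly_ring V)"
          using pJ by (intro koszul_in_poly_ring) (auto simp: mono_ideal_def)
        fix m :: "nat \<Rightarrow>\<^sub>0 nat" assume mV: "keys m \<subseteq> V"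
        have "strand m p \<rho> = (if m = sqfree_mono S then f \<rho> else 0)" for \<rho>
        proof (cases "\<rho> \<subseteq> S \<and> \<rho> \<subseteq> keys m")
          case True
          then have fr: "finite \<rho>" using fin finite_subset by blast
          have "sqfree_mono (S - \<rho>) + sqfree_mono \<rho> = sqfree_mono S"
            using True fin fr by (intro poly_mapping_eqI) (auto simp: lookup_add)
          then have "m - sqfree_mono \<rho> = sqfree_mono (S - \<rho>) \<longleftrightarrow> m = sqfree_mono S"
            using minus_sqfree_mono_eq_iff[OF fr, of m "sqfree_mono (S - \<rho>)"] True by simp
          then show ?thesis using True by (auto simp: strand_def p_def lookup_single when_def)
        next
          case False
          then have "m = sqfree_mono S \<Longrightarrow> f \<rho> = 0"
            using f fin by (auto simp: simplicial_chain_def matching_complex_def)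
          then show ?thesis using False by (auto simp: strand_def p_def)
        qed
        then have "strand m p = (if m = sqfree_mono S then f else 0)" by auto
        then have "bdry (keys m) (strand m p) F = 0"
          using cyc fin by (auto simp: koszul_def)
        then show "strand m (poly_koszul V p) F = strand m (\<lambda>_. 0) F"
          using strand_koszul[OF V mV, of p F] by (simp add: strand_def[of m "\<lambda>_. 0"])
      qed (use True in auto)
      then show ?thesis using True by (simp add: koszul_apply c_def)
    next
      case False
      have "c (insert x F) a = 0" for x
        using False p0[of "insert x F"] S(1) by (auto simp: c_def)
      then show ?thesis by (simp add: koszul_apply) (simp add: koszul_def)
    qed
  qed
  ultimately obtain u where u: "koszul_chain V (ideal_vecs ?J) (Suc i) u" "vec_koszul V u = c"
    using ac unfolding koszul_acyclic_def by blast
  let ?u = "\<lambda>F. u F 0" and ?m = "sqfree_mono S"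
  have keysm: "keys ?m = S" using fin by simp
  have "mono_chain V (matching_mono k) (Suc i) ?u"
    unfolding mono_chain_def
  proof (intro allI conjI impI ballI)
    fix F
    have "u F 0 \<in> ?J" using koszul_chainD(1)[OF u(1)] by (simp add: ideal_vecs_iff)
    then show "u F 0 \<in> carrier (poly_ring V)" "\<And>p. p \<in> keys (u F 0) \<Longrightarrow> matching_mono k p"
      by (auto simp: mono_ideal_def)
    assume "u F 0 \<noteq> 0"
    then have "u F \<noteq> 0" by auto
    then show "F \<subseteq> V" "card F = Suc i" using koszul_chainD(2,3)[OF u(1)] by auto
  qed
  then have "simplicial_chain ?G (Suc i) (strand ?m ?u)"
    using simplicial_chain_strand[of V "matching_mono k" "Suc i" ?u ?m] mono_complex_squarefree[OF fin] by simp
  moreover have "bdry S (strand ?m ?u) F = f F" for F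
  proof -
    have "bdry S (strand ?m ?u) F = strand ?m (poly_koszul V ?u) F"
      using strand_koszul[OF V, of ?m ?u F] S(1) keysm by simp
    also have "poly_koszul V ?u = p"
      using u(2) koszul_apply[of V u _ 0] by (auto simp: c_def fun_eq_iff)
    also have "strand ?m p F = f F"
    proof (cases "F \<subseteq> S")
      case True
      then have fr: "finite F" using fin finite_subset by blast
      have "?m - sqfree_mono F = sqfree_mono (S - F)"
        using True fin fr by (intro poly_mapping_eqI) (auto simp: lookup_minus)
      then show ?thesis using True keysm by (simp add: strand_def p_def)
    next
      case False
      then show ?thesis using f keysm by (auto simp: strand_def simplicial_chain_def matching_complex_def)
    qed
    finally show ?thesis .
  qed
  ultimately show "\<exists>g. simplicial_chain ?G (Suc i) g \<and> (\<forall>F. bdry S g F = f F)" by blast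
qed

section \<open>The square-free powers of the edge ideal of a path\<close>

text \<open>Describes the ordinary power: unlike in \<open>has_matching\<close>, the edges may
  overlap or repeat.\<close>

fun edge_multiple :: "nat \<Rightarrow> (nat \<Rightarrow>\<^sub>0 nat) \<Rightarrow> bool" where
  "edge_multiple 0 m = True"
| "edge_multiple (Suc k) m = (\<exists>i m'. m = Poly_Mapping.single i 1 + Poly_Mapping.single (Suc i) 1 + m' \<and>
     edge_multiple k m')"

lemma edge_multiple_up: "edge_multiple k y \<Longrightarrow> edge_multiple k (x + y)"
proof (induction k arbitrary: y)
  case (Suc k)
  then obtain i y' where y: "y = Poly_Mapping.single i 1 + Poly_Mapping.single (Suc i) 1 + y'"
    "edge_multiple k y'" by auto
  have "x + y = Poly_Mapping.single i 1 + Poly_Mapping.single (Suc i) 1 + (x + y')"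
    using y(1) by (simp add: ac_simps)
  then show ?case using Suc.IH[OF y(2)] by (metis edge_multiple.simps(2))
qed simp

lemma edge_multiple_add:
  assumes "edge_multiple (Suc 0) x" "edge_multiple k y"
  shows "edge_multiple (Suc k) (x + y)"
proof -
  obtain i x' where x: "x = Poly_Mapping.single i 1 + Poly_Mapping.single (Suc i) 1 + x'"
    using assms(1) by auto
  have "x + y = Poly_Mapping.single i 1 + Poly_Mapping.single (Suc i) 1 + (x' + y)"
    using x by (simp add: ac_simps)
  then show ?thesis using edge_multiple_up[OF assms(2)] by (metis edge_multiple.simps(2))
qed

lemma edge_multiple_of_matching: "matching_mono k m \<Longrightarrow> edge_multiple k m"
proof (induction k arbitrary: m)
  case (Suc k)
  then obtain i where i: "i \<in> keys m" "Suc i \<in> keys m"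
    "has_matching k (keys m - {i, Suc i})" by auto
  let ?e = "Poly_Mapping.single i 1 + Poly_Mapping.single (Suc i) (1::nat)"
  have "keys m - {i, Suc i} \<subseteq> keys (m - ?e)"
    by (auto simp: in_keys_iff lookup_minus lookup_add lookup_single when_def split: if_splits)
  then have "edge_multiple k (m - ?e)" using Suc.IH has_matching_mono[OF i(3)] by blast
  moreover have "m = ?e + (m - ?e)"
    using i(1,2) by (intro poly_mapping_eqI)
      (auto simp: in_keys_iff lookup_minus lookup_add lookup_single when_def)
  ultimately show ?case unfolding edge_multiple.simps(2) by blast
qed simp

text \<open>In a square-free monomial an edge uses up its two vertices entirely, so the remaining
  edges are disjoint from it.\<close>

lemma matching_of_edge_multiple:
  "squarefree_exponent m \<Longrightarrow> edge_multiple k m \<Longrightarrow> matching_mono k m"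
proof (induction k arbitrary: m)
  case (Suc k)
  then obtain i m' where m: "m = Poly_Mapping.single i 1 + Poly_Mapping.single (Suc i) 1 + m'"
    "edge_multiple k m'" by auto
  have look: "lookup m x = (if x = i \<or> x = Suc i then 1 else 0) + lookup m' x" for x
    by (auto simp: m(1) lookup_add lookup_single when_def)
  have le: "lookup m x \<le> 1" for x using Suc.prems(1) by (simp add: squarefree_exponent_def)
  have "lookup m' x \<le> 1" for x using look[of x] le[of x] by linarith
  then have "matching_mono k m'" using Suc.IH[OF _ m(2)] by (simp add: squarefree_exponent_def)
  moreover have "keys m' \<subseteq> keys m - {i, Suc i}"
  proof
    fix x assume "x \<in> keys m'"
    then have "lookup m' x \<noteq> 0" by (simp add: in_keys_iff)
    then show "x \<in> keys m - {i, Suc i}"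
      using look[of x] le[of x] by (auto simp: in_keys_iff split: if_splits)
  qed
  ultimately have "has_matching k (keys m - {i, Suc i})" by (rule has_matching_mono)
  moreover have "i \<in> keys m" "Suc i \<in> keys m"
    using look[of i] look[of "Suc i"] by (auto simp: in_keys_iff)
  ultimately show ?case by auto
qed simp

section \<open>From the ideal-theoretic definition to supports that contain a matching\<close>

lemma verts_path_graph [simp]: "verts (path_graph n) = {1..n}"
  by (simp add: path_graph_def)

lemma edges_path_graph_iff:
  "{x, y} \<in> edges (path_graph n) \<longleftrightarrow>
     (\<exists>i. 1 \<le> i \<and> Suc i \<le> n \<and> (x = i \<and> y = Suc i \<or> x = Suc i \<and> y = i))"
  by (auto simp: path_graph_def doubleton_eq_iff)

lemma monomial_mult: "monomial a * monomial b = (monomial (a + b) :: ('v, 'k::field) mpoly)"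
  by (simp add: monomial_def mult_single)

lemma monomial_in_poly_ring: "keys m \<subseteq> V \<Longrightarrow> monomial m \<in> carrier (poly_ring V)"
  by (simp add: monomial_def poly_ring_single)

lemma monomial_in_mono_ideal_iff:
  "(monomial m :: (nat, 'k::field) mpoly) \<in> mono_ideal V Q \<longleftrightarrow> keys m \<subseteq> V \<and> Q m"
  by (simp add: monomial_def mono_ideal_def poly_ring_simps)

definition edge_generators :: "nat \<Rightarrow> (nat, 'k::field) mpoly set" where
  "edge_generators n = {indet x * indet y | x y. {x, y} \<in> edges (path_graph n)}"

lemma edge_generators_eq:
  "edge_generators n = {monomial (Poly_Mapping.single i 1 + Poly_Mapping.single (Suc i) 1) | i. 1 \<le> i \<and> Suc i \<le> n}"
  unfolding edge_generators_def edges_path_graph_iff indet_def monomial_mult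
  by (auto simp: add.commute)

lemma edge_generators_subset:
  "(edge_generators n :: (nat, 'k::field) mpoly set) \<subseteq> mono_ideal {1..n} (edge_multiple (Suc 0))"
proof
  fix p :: "(nat, 'k) mpoly" assume "p \<in> edge_generators n"
  then obtain i where i: "1 \<le> i" "Suc i \<le> n"
    "p = monomial (Poly_Mapping.single i 1 + Poly_Mapping.single (Suc i) 1)"
    unfolding edge_generators_eq by blast
  have "edge_multiple (Suc 0) (Poly_Mapping.single i 1 + Poly_Mapping.single (Suc i) 1)"
    unfolding edge_multiple.simps by (intro exI[of _ i] exI[of _ 0]) simp
  then show "p \<in> mono_ideal {1..n} (edge_multiple (Suc 0))"
    using i by (simp add: monomial_in_mono_ideal_iff keys_add_nat)
qed

lemma ring_poly_ring: "ring (poly_ring V :: ('v, 'k::field) mpoly ring)"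
  using cring_poly_ring cring.axioms(1) by blast

lemma edge_ideal_eq: "edge_ideal (path_graph n) = genideal (poly_ring {1..n}) (edge_generators n)"
  by (simp add: edge_ideal_def edge_generators_def)

lemma edge_ideal_subset:
  "(edge_ideal (path_graph n) :: (nat, 'k::field) mpoly set) \<subseteq> mono_ideal {1..n} (edge_multiple (Suc 0))"
  unfolding edge_ideal_eq
  by (rule ring.genideal_minimal[OF ring_poly_ring ideal_mono_ideal edge_generators_subset])
    (rule edge_multiple_up)

lemma edge_monomial_in_edge_ideal:
  assumes "1 \<le> i" "Suc i \<le> n"
  shows "(monomial (Poly_Mapping.single i 1 + Poly_Mapping.single (Suc i) 1) :: (nat, 'k::field) mpoly)
    \<in> edge_ideal (path_graph n)"
proof -
  have "(edge_generators n :: (nat, 'k) mpoly set) \<subseteq> carrier (poly_ring {1..n})"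
    using edge_generators_subset by (auto simp: mono_ideal_def)
  then have "(edge_generators n :: (nat, 'k) mpoly set) \<subseteq> edge_ideal (path_graph n)"
    unfolding edge_ideal_eq by (rule ring.genideal_self[OF ring_poly_ring])
  then show ?thesis using assms unfolding edge_generators_eq by blast
qed

lemma ideal_power_simps:
  "ideal_power R I 0 = carrier R"
  "ideal_power R I (Suc k) = ideal_prod R I (ideal_power R I k)"
  by (simp_all add: ideal_power_def)

lemma ideal_power_edge_subset:
  "ideal_power (poly_ring {1..n}) (edge_ideal (path_graph n)) k
     \<subseteq> (mono_ideal {1..n} (edge_multiple k) :: (nat, 'k::field) mpoly set)"
proof (induction k)
  case 0
  then show ?case by (simp add: ideal_power_simps poly_ring_eq_mono_ideal)
next
  case (Suc k)
  show ?case
  proof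
    fix p :: "(nat, 'k) mpoly"
    assume "p \<in> ideal_power (poly_ring {1..n}) (edge_ideal (path_graph n)) (Suc k)"
    then show "p \<in> mono_ideal {1..n} (edge_multiple (Suc k))"
      unfolding ideal_power_simps
    proof (induction rule: ideal_prod.induct)
      case (prod a b)
      then have "a \<in> mono_ideal {1..n} (edge_multiple (Suc 0))" "b \<in> mono_ideal {1..n} (edge_multiple k)"
        using edge_ideal_subset Suc.IH by blast+
      then show ?case
        unfolding poly_ring_simps(2) using edge_multiple_add by (rule mono_ideal_mult)
    next
      case (sum a b)
      then show ?case unfolding poly_ring_simps(3) by (intro mono_ideal_closed(2))
    qed
  qed
qed

lemma monomial_in_ideal_power:
  assumes "keys m \<subseteq> {1..n}" "edge_multiple k m"
  shows "(monomial m :: (nat, 'k::field) mpoly) \<in> ideal_power (poly_ring {1..n}) (edge_ideal (path_graph n)) k"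
  using assms
proof (induction k arbitrary: m)
  case 0
  then show ?case by (simp add: ideal_power_simps monomial_in_poly_ring)
next
  case (Suc k)
  then obtain i m' where m: "m = Poly_Mapping.single i 1 + Poly_Mapping.single (Suc i) 1 + m'"
    "edge_multiple k m'" by auto
  have keys: "i \<in> {1..n}" "Suc i \<in> {1..n}" "keys m' \<subseteq> {1..n}"
    using Suc.prems(1) unfolding m(1) keys_add_nat by auto
  have "(monomial (Poly_Mapping.single i 1 + Poly_Mapping.single (Suc i) 1) :: (nat, 'k) mpoly)
      \<otimes>\<^bsub>poly_ring {1..n}\<^esub> monomial m'
      \<in> ideal_power (poly_ring {1..n}) (edge_ideal (path_graph n)) (Suc k)"
    unfolding ideal_power_simps
    using keys by (intro ideal_prod.prod edge_monomial_in_edge_ideal Suc.IH m(2)) auto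
  then show ?case by (simp only: poly_ring_simps(2) monomial_mult m(1))
qed

lemma sum_single_keys: "p = (\<Sum>m\<in>keys p. Poly_Mapping.single m (lookup p m))"
  by (rule poly_mapping_eqI) (simp add: lookup_sum lookup_single when_def in_keys_iff)

lemma sum_in_ideal:
  fixes f :: "'a \<Rightarrow> ('v, 'k::field) mpoly"
  assumes I: "ideal I (poly_ring V)" and f: "\<And>x. x \<in> A \<Longrightarrow> f x \<in> I"
  shows "sum f A \<in> I"
proof -
  interpret additive_subgroup I "poly_ring V :: ('v, 'k) mpoly ring"
    using I by (rule ideal.axioms(1))
  have "0 \<in> I" "\<And>x y. x \<in> I \<Longrightarrow> y \<in> I \<Longrightarrow> x + y \<in> I"
    using zero_closed a_closed by (simp_all add: poly_ring_simps(3,5))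
  then show ?thesis using f by (induction A rule: infinite_finite_induct) simp_all
qed

text \<open>On square-free monomials the ordinary power and the matching condition agree. A monomial
  whose support contains a matching is a multiple of its square-free part, which is one of the
  generators.\<close>

theorem squarefree_power_path_graph:
  "(squarefree_power (path_graph n) k :: (nat, 'k::field) mpoly set) = mono_ideal {1..n} (matching_mono k)"
proof -
  let ?R = "poly_ring {1..n} :: (nat, 'k) mpoly ring"
  let ?G = "{monomial m | m. squarefree_exponent m \<and> (monomial m :: (nat, 'k) mpoly) \<in>
      ideal_power ?R (edge_ideal (path_graph n)) k}"
  have G: "?G = {monomial m | m. squarefree_exponent m \<and> keys m \<subseteq> {1..n} \<and> matching_mono k m}"
  proof -
    have "(monomial m :: (nat, 'k) mpoly) \<in> ideal_power ?R (edge_ideal (path_graph n)) k \<longleftrightarrow>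
        keys m \<subseteq> {1..n} \<and> matching_mono k m" if "squarefree_exponent m" for m
      using ideal_power_edge_subset[of n k, where ?'k = 'k] monomial_in_ideal_power[of m n k, where ?'k = 'k]
        monomial_in_mono_ideal_iff[of m "{1..n}" "edge_multiple k", where ?'k = 'k]
        matching_of_edge_multiple[OF that] edge_multiple_of_matching by blast
    then show ?thesis by blast
  qed
  have sub: "?G \<subseteq> mono_ideal {1..n} (matching_mono k)"
    unfolding G by (auto simp: monomial_in_mono_ideal_iff)
  then have GR: "?G \<subseteq> carrier ?R" by (auto simp: mono_ideal_def)
  have "genideal ?R ?G = mono_ideal {1..n} (matching_mono k)"
  proof
    show "genideal ?R ?G \<subseteq> mono_ideal {1..n} (matching_mono k)"
      by (rule ring.genideal_minimal[OF ring_poly_ring ideal_mono_ideal sub]) (rule matching_mono_up)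
    have idl: "ideal (genideal ?R ?G) ?R" by (rule ring.genideal_ideal[OF ring_poly_ring GR])
    show "mono_ideal {1..n} (matching_mono k) \<subseteq> genideal ?R ?G"
    proof
      fix p :: "(nat, 'k) mpoly" assume p: "p \<in> mono_ideal {1..n} (matching_mono k)"
      have "Poly_Mapping.single m (lookup p m) \<in> genideal ?R ?G"
        if m: "m \<in> keys p" for m
      proof -
        let ?q = "sqfree_mono (keys m)"
        have mV: "keys m \<subseteq> {1..n}" "matching_mono k m"
          using p m by (auto simp: mono_ideal_def poly_ring_simps)
        have "squarefree_exponent ?q" by (simp add: squarefree_exponent_def)
        then have "monomial ?q \<in> ?G"
          unfolding G using mV by (intro CollectI exI[of _ ?q] conjI) simp_all
        then have q: "monomial ?q \<in> genideal ?R ?G"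
          by (rule subsetD[OF ring.genideal_self[OF ring_poly_ring GR]])
        have "Poly_Mapping.single (m - ?q) (lookup p m) \<in> carrier ?R"
          using mV(1) keys_minus_sqfree_mono_subset[of "keys m" m]
          by (intro poly_ring_single) auto
        from ideal.I_l_closed[OF idl q this]
        have "Poly_Mapping.single (m - ?q) (lookup p m) * monomial ?q \<in> genideal ?R ?G"
          by (simp only: poly_ring_simps(2))
        moreover have "m - ?q + ?q = m"
          using minus_sqfree_mono_eq_iff[of "keys m" m "m - ?q"] by simp
        ultimately show ?thesis by (simp add: monomial_def mult_single)
      qed
      then have "(\<Sum>m\<in>keys p. Poly_Mapping.single m (lookup p m)) \<in> genideal ?R ?G"
        by (rule sum_in_ideal[OF idl])
      then show "p \<in> genideal ?R ?G" using sum_single_keys[of p] by simp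
    qed
  qed
  then show ?thesis unfolding squarefree_power_def by simp
qed

text \<open>Counting covered vertices gives the upper bound; the edges {2i + 1, 2i + 2} attain
  it.\<close>

lemma matching_number_path_graph: "matching_number (path_graph n) = n div 2"
  unfolding matching_number_def
proof (rule Max_eqI)
  have edges: "edges (path_graph n) \<subseteq> Pow {1..n}" by (auto simp: path_graph_def)
  then have fin: "finite (edges (path_graph n))" using finite_subset by blast
  have "{M. matching (path_graph n) M} \<subseteq> Pow (edges (path_graph n))" by (auto simp: matching_def)
  then have "finite {M. matching (path_graph n) M}" using fin finite_subset by blast
  moreover have "{card M | M. matching (path_graph n) M} = card ` {M. matching (path_graph n) M}" by blast
  ultimately show "finite {card M | M. matching (path_graph n) M}" by simp
  show "c \<le> n div 2" if "c \<in> {card M | M. matching (path_graph n) M}" for c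
  proof -
    obtain M where M: "c = card M" "M \<subseteq> edges (path_graph n)" "disjoint M"
      using \<open>c \<in> _\<close> by (auto simp: matching_def)
    have card2: "card e = 2 \<and> finite e" if "e \<in> M" for e using M(2) that by (auto simp: path_graph_def)
    have "card (\<Union>M) = (\<Sum>e\<in>M. card e)"
      using M(3) card2 by (intro card_Union_disjoint) (auto simp: disjoint_def pairwise_def disjnt_def)
    also have "\<dots> = 2 * card M" using card2 by simp
    finally have "card (\<Union>M) = 2 * c" using M(1) by simp
    moreover have "\<Union>M \<subseteq> {1..n}" using M(2) edges by blast
    then have "card (\<Union>M) \<le> n" using card_mono[of "{1..n}" "\<Union>M"] by simp
    ultimately show ?thesis by linarith
  qed
  define E where "E i = {2 * i + 1, 2 * i + 2}" for i :: nat
  let ?M = "E ` {..<n div 2}"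
  have disj: "E i \<inter> E j = {}" if "i \<noteq> j" for i j
    using that unfolding E_def by (auto; presburger)
  have "E i \<noteq> {}" for i by (simp add: E_def)
  then have "inj_on E {..<n div 2}" using disj by (metis inf.idem inj_onI)
  then have "card ?M = n div 2" by (simp add: card_image)
  moreover have "matching (path_graph n) ?M"
    unfolding matching_def
  proof
    show "?M \<subseteq> edges (path_graph n)"
    proof
      fix e assume "e \<in> ?M"
      then obtain i where "e = {2 * i + 1, (2 * i + 1) + 1}" "i < n div 2" by (auto simp: E_def)
      then show "e \<in> edges (path_graph n)" unfolding path_graph_def by (auto intro!: exI[of _ "2 * i + 1"])
    qed
    show "disjoint ?M"
    proof (rule disjointI)
      fix a b assume "a \<in> ?M" "b \<in> ?M" "a \<noteq> b"
      then obtain i j where "a = E i" "b = E j" "i \<noteq> j" by blast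
      then show "a \<inter> b = {}" using disj by simp
    qed
  qed
  ultimately show "n div 2 \<in> {card M | M. matching (path_graph n) M}" by force
qed

section \<open>The regularity as a maximum over nonvanishing Koszul homology\<close>

lemma regularity_path:
  assumes k: "1 \<le> k" "2 * k \<le> n"
  shows "regularity {1..n} (mono_ideal {1..n} (matching_mono k) :: (nat, 'k::field) mpoly set)
    = int (2 * k + (n - 2 * k) div 3)"
proof -
  let ?V = "{1..n}" and ?J = "mono_ideal {1..n} (matching_mono k) :: (nat, 'k) mpoly set"
  let ?KA = "koszul_acyclic ?V [0] (ideal_vecs ?J)"
  have J: "graded_submodule ?V [0] (ideal_vecs ?J)"
    by (rule graded_submodule_mono_ideal) (rule matching_mono_up)
  have nonzero: "\<exists>S\<subseteq>?V. card S = j \<and> \<not> acyclic_at TYPE('k) S (matching_complex k S) i" if "\<not> ?KA i j" for i j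
  proof (rule ccontr)
    assume "\<not> ?thesis"
    then have "?KA i j" by (intro koszul_acyclic_matching) auto
    then show False using that by contradiction
  qed
  have bound: "j \<le> n \<and> i \<le> j \<and> 3 * j \<le> 3 * i + 4 * k + n" if ka: "\<not> ?KA i j" for i j
  proof -
    obtain S where S: "S \<subseteq> ?V" "card S = j" and na: "\<not> acyclic_at TYPE('k) S (matching_complex k S) i"
      using nonzero[OF ka] by blast
    have fin: "finite S" using S(1) finite_subset by blast
    have "j \<le> n" using card_mono[OF _ S(1)] S(2) by simp
    moreover have "3 * j \<le> 3 * i + 4 * k + n"
      using acyclic_matching_complex[OF S(1), of i k "TYPE('k)"] na S(2) by linarith
    moreover have "i \<le> j"
    proof (rule ccontr)
      assume "\<not> i \<le> j"
      then have "f F = 0" if "simplicial_chain (matching_complex k S) i f" for f :: "nat set \<Rightarrow> 'k" and F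
        using simplicial_chainD[OF that, of F] card_mono[OF fin, of F] S(2)
        by (auto simp: matching_complex_def)
      then have "acyclic_at TYPE('k) S (matching_complex k S) i"
        unfolding acyclic_at_def by (intro allI impI exI[of _ 0]) (simp add: koszul_def)
      then show False using na by contradiction
    qed
    ultimately show ?thesis by blast
  qed
  \<comment> \<open>The degree bound, uniform in \<open>i\<close>, on which the existence of a
    minimal resolution rests.\<close>
  have "?KA i j" if "j > n" for i j using bound[of i j] that by linarith
  then have betti: "graded_betti ?V ?J i j \<noteq> 0 \<longleftrightarrow> \<not> ?KA i j" for i j
    using graded_betti_nonzero_iff[OF _ J, of n i j] by simp
  let ?r = "(n - 2 * k) div 3"
  let ?T = "{int j - int i | i j. \<not> ?KA i j}"
  \<comment> \<open>\<open>Max\<close> needs a finite set: the degree is at most \<open>n\<close>,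
    and a face has no more vertices than \<open>S\<close>.\<close>
  have "?T \<subseteq> (\<lambda>(i, j). int j - int i) ` ({..n} \<times> {..n})"
  proof
    fix x assume "x \<in> ?T"
    then obtain i j where x: "x = int j - int i" and ij: "\<not> ?KA i j" by blast
    then have "(i, j) \<in> {..n} \<times> {..n}" using bound[OF ij] by auto
    then show "x \<in> (\<lambda>(i, j). int j - int i) ` ({..n} \<times> {..n})" using x by force
  qed
  then have fin: "finite ?T" using finite_subset by blast
  have "Max ?T = int (2 * k + ?r)"
  proof (rule Max_eqI[OF fin])
    fix x assume "x \<in> ?T"
    then obtain i j where x: "x = int j - int i" and ij: "\<not> ?KA i j" by blast
    have "i \<le> j" "3 * j \<le> 3 * i + 4 * k + n" using bound[OF ij] by auto
    \<comment> \<open>Since 4k + n = 6k + (n - 2k), division by 3 gives the bound 2k + (n - 2k)/3,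
      and integrality gives the floor.\<close>
    then have "3 * (j - i) \<le> 4 * k + n" by linarith
    then have "j - i \<le> 2 * k + ?r" using k(2) by linarith
    then show "x \<le> int (2 * k + ?r)" using x \<open>i \<le> j\<close> by linarith
  next
    \<comment> \<open>After the first 2k vertices there is room for \<open>?r\<close> isolated
      edges, three places each. The class has degree 2k + 2r in step r, which contributes 2k +
      r.\<close>
    let ?S = "extremal_set k ?r"
    have "2 * k + 3 * ?r \<le> n" using k(2) by linarith
    then have "?S \<subseteq> ?V" using extremal_set_subset[of k ?r] by fastforce
    moreover have "card ?S = 2 * k + 2 * ?r" by (rule card_extremal_set)
    ultimately have "\<not> ?KA ?r (2 * k + 2 * ?r)"
      using acyclic_matching_of_koszul[of ?V ?S _ k ?r, where ?'k = 'k] not_acyclic_extremal[OF k(1)] by blast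
    moreover have "int (2 * k + ?r) = int (2 * k + 2 * ?r) - int ?r" by simp
    ultimately show "int (2 * k + ?r) \<in> ?T" by blast
  qed
  then show ?thesis unfolding regularity_def betti .
qed

theorem proposition3p3:
  fixes n :: nat
  shows "matching_number (path_graph n) = n div 2 \<and>
    (\<forall>k::nat. 1 \<le> k \<and> k \<le> matching_number (path_graph n) \<longrightarrow>
       regularity (verts (path_graph n))
         (squarefree_power (path_graph n) k :: (nat, 'k::field) mpoly set)
       = 2 * int k + \<lfloor>(real n - 2 * real k) / 3\<rfloor>)"
proof (intro conjI allI impI)
  show "matching_number (path_graph n) = n div 2" by (rule matching_number_path_graph)
  fix k :: nat assume "1 \<le> k \<and> k \<le> matching_number (path_graph n)"
  then have k: "1 \<le> k" "2 * k \<le> n" by (auto simp: matching_number_path_graph)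
  have "\<lfloor>real (n - 2 * k) / real 3\<rfloor> = int ((n - 2 * k) div 3)"
    by (rule floor_divide_of_nat_eq)
  moreover have "real n - 2 * real k = real (n - 2 * k)" using k(2) by simp
  ultimately have "\<lfloor>(real n - 2 * real k) / 3\<rfloor> = int ((n - 2 * k) div 3)"
    by (simp only: of_nat_numeral)
  then show "regularity (verts (path_graph n))
         (squarefree_power (path_graph n) k :: (nat, 'k::field) mpoly set)
       = 2 * int k + \<lfloor>(real n - 2 * real k) / 3\<rfloor>"
    using regularity_path[OF k, where ?'k = 'k] by (simp add: squarefree_power_path_graph)
qed

end
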